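(* Let $n\ge1$ and $y\ge0$ be fixed integers and $\kappa>0$. As $t\to\infty$ through integers with $t\equiv y\pmod 2$: if $\kappa<2$, $$Z^{(n)}_t(y;\kappa)=2^{nt}t^{-n(2n+1)/2}\,2^{2n^2-\frac n2+1}\kappa\,\pi^{-n/2}(2n-1)!\prod_{i=0}^{n-2}\frac{i!\,(y+n+i-1)!}{(y+2i)!}\Big(\sum_{h=0}^{n}\frac{\binom nh\binom{y+h-2}{h}}{\binom{2n}h}\frac1{(2-\kappa)^{2n-h}}\Big)\big(1+O(t^{-1})\big);$$ if $\kappa=2$, $$Z^{(n)}_t(y;\kappa)=2^{nt}t^{-n(2n-1)/2}\,2^{2n^2-\frac32n+1}\pi^{-n/2}\prod_{i=0}^{n-1}\frac{i!\,(y+n+i-1)!}{(y+2i)!}\big(1+O(t^{-1})\big);$$ if $\kappa>2$, $$Z^{(n)}_t(y;\kappa)=\Big(\frac{2^{n-1}\kappa}{\sqrt{\kappa-1}}\Big)^t t^{-(n-1)(2n-1)/2}\frac{2^{(n-1)(4n-5)/2}\kappa(\kappa-2)^{2n-1}}{\pi^{(n-1)/2}(\kappa-1)^{\frac y2+2n-1}}\prod_{i=0}^{n-2}\frac{i!\,(y+n+i-1)!}{(y+2i)!}\big(1+O(t^{-1})\big).$$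
   Context: A walk is a lattice path in $\mathbb Z^2$ with steps $(1,1)$ and $(1,-1)$ never going below the $x$-axis. A family of walks is vicious if no two of its walks share a lattice point. A contact is a lattice point on the $x$-axis lying on one of the walks (starting and end points included); $c(\mathbf P)$ is the total number of contacts of a family $\mathbf P$. $Z^{(n)}_t(y;\kappa)=\sum_{\mathbf P}\kappa^{c(\mathbf P)}$, summed over vicious families $(P_1,\dots,P_n)$ with $P_i$ running from $(0,2i-2)$ to $(t,y+2i-2)$. Binomials: $\binom mk=m(m-1)\cdots(m-k+1)/k!$ for integers $k\ge0$ (so e.g. $\binom{-1}{1}=-1$). *)

theory Defs
  imports "HOL-Library.Landau_Symbols" "HOL-Library.Product_Plus"
begin

text \<open>A walk is represented by the list of the lattice points it visits.\<close>

definition is_walk :: "(int \<times> int) list \<Rightarrow> bool" where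
  "is_walk ps \<longleftrightarrow> ps \<noteq> [] \<and>
     successively (\<lambda>p q. q - p \<in> {(1, 1), (1, -1)}) ps \<and> (\<forall>p\<in>set ps. 0 \<le> snd p)"

definition walks :: "int \<times> int \<Rightarrow> int \<times> int \<Rightarrow> (int \<times> int) list set" where
  "walks a b = {ps. is_walk ps \<and> hd ps = a \<and> last ps = b}"

definition vicious :: "(int \<times> int) list list \<Rightarrow> bool" where
  "vicious P \<longleftrightarrow>
     (\<forall>i<length P. \<forall>j<length P. i \<noteq> j \<longrightarrow> set (P ! i) \<inter> set (P ! j) = {})"

definition contacts :: "(int \<times> int) list list \<Rightarrow> nat" where
  "contacts P = card {p \<in> (\<Union>W\<in>set P. set W). snd p = 0}"

text \<open>Families are indexed from 0, so the \<open>i\<close>-th walk starts at height \<open>2i\<close> rather than \<open>2i - 2\<close>.\<close>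

definition vicious_families :: "nat \<Rightarrow> nat \<Rightarrow> nat \<Rightarrow> (int \<times> int) list list set" where
  "vicious_families n t y = {P. length P = n \<and> vicious P \<and>
     (\<forall>i<n. P ! i \<in> walks (0, 2 * int i) (int t, int y + 2 * int i))}"

definition Z :: "nat \<Rightarrow> nat \<Rightarrow> nat \<Rightarrow> real \<Rightarrow> real" where
  "Z n t y \<kappa> = (\<Sum>P\<in>vicious_families n t y. \<kappa> ^ contacts P)"

definition at_top_parity :: "nat \<Rightarrow> nat filter" where
  "at_top_parity y = inf at_top (principal {t. t mod 2 = y mod 2})"

text \<open>\<open>f(t) = g(t) (1 + O(1/t))\<close> along the filter \<open>F\<close>.\<close>

definition asymp_rel_inverse :: "nat filter \<Rightarrow> (nat \<Rightarrow> real) \<Rightarrow> (nat \<Rightarrow> real) \<Rightarrow> bool" where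
  "asymp_rel_inverse F f g \<longleftrightarrow>
     (\<exists>r. r \<in> O[F](\<lambda>t. 1 / real t) \<and> (\<forall>\<^sub>F t in F. f t = g t * (1 + r t)))"

text \<open>The sum defining \<^const>\<open>Z\<close> is over a finite set, and the parity filter is proper.\<close>

lemma walk_nth:
  assumes "successively (\<lambda>p q. q - p \<in> {(1, 1), (1, -1)}) ps" "i < length ps"
  shows "fst (ps ! i) = fst (hd ps :: int \<times> int) + int i \<and>
         \<bar>snd (ps ! i) - snd (hd ps)\<bar> \<le> int i"
  using assms(2)
proof (induction i)
  case 0
  then show ?case by (simp add: hd_conv_nth)
next
  case (Suc i)
  have "ps ! Suc i - ps ! i \<in> {(1, 1), (1, -1)}"
    using assms(1) Suc.prems by (auto simp: successively_conv_nth)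
  then show ?case using Suc by (auto simp: prod_eq_iff)
qed

lemma finite_walks: "finite (walks a b)"
proof -
  define m where "m = nat (fst b - fst a)"
  define S where "S = {fst a..fst a + int m} \<times> {snd a - int m..snd a + int m}"
  have "walks a b \<subseteq> {ps. set ps \<subseteq> S \<and> length ps = Suc m}"
  proof
    fix ps assume "ps \<in> walks a b"
    then have ne: "ps \<noteq> []" and st: "successively (\<lambda>p q. q - p \<in> {(1, 1), (1, -1)}) ps"
      and h: "hd ps = a" and l: "last ps = b"
      by (auto simp: walks_def is_walk_def)
    have "fst b = fst a + int (length ps - 1)"
      using walk_nth[OF st, of "length ps - 1"] ne h l by (simp add: last_conv_nth)
    then have len: "length ps = Suc m" using ne by (cases ps) (auto simp: m_def)
    have "p \<in> S" if "p \<in> set ps" for p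
    proof -
      obtain i where i: "i < length ps" "p = ps ! i"
        using \<open>p \<in> set ps\<close> by (metis in_set_conv_nth)
      with walk_nth[OF st i(1)] h len show ?thesis
        by (cases p) (auto simp: S_def mem_Times_iff)
    qed
    with len show "ps \<in> {ps. set ps \<subseteq> S \<and> length ps = Suc m}" by auto
  qed
  moreover have "finite S" by (simp add: S_def)
  ultimately show ?thesis using finite_subset finite_lists_length_eq[of S "Suc m"] by blast
qed

lemma finite_vicious_families: "finite (vicious_families n t y)"
proof (rule finite_subset)
  let ?W = "\<Union>i<n. walks (0, 2 * int i) (int t, int y + 2 * int i)"
  show "vicious_families n t y \<subseteq> {P. set P \<subseteq> ?W \<and> length P = n}"
    by (fastforce simp: vicious_families_def in_set_conv_nth)
  show "finite {P. set P \<subseteq> ?W \<and> length P = n}"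
    by (intro finite_lists_length_eq finite_UN_I finite_walks) auto
qed

lemma eventually_at_top_parity:
  "eventually Q (at_top_parity y) \<longleftrightarrow> (\<exists>T. \<forall>t\<ge>T. t mod 2 = y mod 2 \<longrightarrow> Q t)"
  by (simp add: at_top_parity_def eventually_inf_principal eventually_at_top_linorder)

lemma at_top_parity_neq_bot: "at_top_parity y \<noteq> bot"
proof -
  have "\<exists>t\<ge>T. t mod 2 = y mod 2" for T :: nat
    by (rule exI[of _ "y + 2 * T"]) simp
  then show ?thesis
    by (auto simp: trivial_limit_def eventually_at_top_parity)
qed

end

theory Submission
  imports Defs
    "HOL-Analysis.Gamma_Function"
    "HOL-Analysis.Generalised_Binomial_Theorem"
    "HOL-Real_Asymp.Real_Asymp"
    "Jordan_Normal_Form.Determinant"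
begin

text \<open>In a vicious family only the lowest walk can touch the axis. Removing the last step of all
  walks at once shows that the weight of the families with prescribed end heights satisfies the same
  recurrence as a determinant of single-walk weights: the terms with coinciding heights or with
  height \<open>-1\<close> vanish on both sides. The start points are moved back to \<open>(-2 i, 0)\<close>, so that
  all rows count walks from the axis; this costs a factor \<open>\<kappa> ^ (n - 1)\<close>.

  Column operations remove \<open>\<kappa>\<close> from all but the last column, which becomes a geometric sum of
  ballot numbers with ratio \<open>\<kappa> - 1\<close>. Each of the resulting determinants is of Vandermonde type, so
  that \<open>Z\<close> is an explicit sum \<open>\<Sum>k. (\<kappa> - 1) ^ k * D k\<close>. For \<open>\<kappa> < 2\<close> the series converges after
  normalisation and is evaluated by the Chu-Vandermonde identity; for \<open>\<kappa> = 2\<close> the single-walk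
  weights are binomial coefficients and \<open>Z\<close> is a product; for \<open>\<kappa> > 2\<close> the sum is, up to an
  exponentially small part, a moment of a binomial distribution.\<close>

section \<open>The determinant formula\<close>

text \<open>The factor \<open>\<kappa> ^ (n - 1)\<close>: at abscissa 0 vicious walks from
  \<open>(-2 i, 0)\<close> occupy distinct even heights, the \<open>i\<close>-th at most
  \<open>2 i\<close>, so each must climb diagonally. Its start is its only contact up to there,
  which gives \<open>\<kappa> ^ n\<close> where the original family has the single contact
  \<open>(0, 0)\<close>. The Vandermonde shape: the factorials in an entry lead to products of (P -
  l) (Q - l) = P Q - l (P + Q - l), and P + Q is the same in all columns. Up to row and column
  factors each row is thus a monic polynomial evaluated at one number P Q per column. The obstacle
  is the transition. With s = \<open>\<kappa>\<close> - 1, the contact series needs |s| < 1, while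
  for s > 1 cutting off the binomial sum costs a relative error of order (4 w / (1 + w)^2)^r with w
  = 1 / s. Both arguments break down at s = 1, so \<open>\<kappa> = 2\<close> gets a determinant
  evaluation of its own. Since the claim is a relative error O(1/t), limits alone are not enough and
  every estimate carries a rate; for the central binomial coefficient the rate comes from enclosing
  Wallis' product between monotone sequences.\<close>

definition walk_families :: "nat \<Rightarrow> nat \<Rightarrow> (nat \<Rightarrow> int) \<Rightarrow> (int \<times> int) list list set" where
  "walk_families n t h = {P. length P = n \<and> vicious P \<and>
     (\<forall>i<n. P ! i \<in> walks (0, 2 * int i) (int t, h i))}"

definition family_weight :: "real \<Rightarrow> nat \<Rightarrow> nat \<Rightarrow> (nat \<Rightarrow> int) \<Rightarrow> real" where
  "family_weight \<kappa> n t h = (\<Sum>P\<in>walk_families n t h. \<kappa> ^ contacts P)"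

lemma Z_eq_family_weight: "Z n t y \<kappa> = family_weight \<kappa> n t (\<lambda>i. int y + 2 * int i)"
  by (simp add: Z_def family_weight_def vicious_families_def walk_families_def)

lemma finite_walk_families: "finite (walk_families n t h)"
proof (rule finite_subset)
  let ?W = "\<Union>i<n. walks (0, 2 * int i) (int t, h i)"
  show "walk_families n t h \<subseteq> {P. set P \<subseteq> ?W \<and> length P = n}"
    by (fastforce simp: walk_families_def in_set_conv_nth)
  show "finite {P. set P \<subseteq> ?W \<and> length P = n}"
    by (intro finite_lists_length_eq finite_UN_I finite_walks) auto
qed

lemma walk_fst_le:
  assumes "q \<in> walks (0, a) (int t, b)" and "p \<in> set q"
  shows "fst p \<le> int t"
proof -
  from assms(1) have ne: "q \<noteq> []" and st: "successively (\<lambda>p q. q - p \<in> {(1, 1), (1, -1)}) q"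
    and h: "hd q = (0, a)" and l: "last q = (int t, b)"
    by (auto simp: walks_def is_walk_def)
  have "int t = int (length q - 1)"
    using walk_nth[OF st, of "length q - 1"] ne h l by (simp add: last_conv_nth)
  moreover obtain i where "i < length q" "p = q ! i"
    using assms(2) by (metis in_set_conv_nth)
  ultimately show ?thesis
    using walk_nth[OF st, of i] h by simp
qed

lemma walks_0: "walks (0, a) (0, b) = (if a = b \<and> 0 \<le> a then {[(0, a)]} else {})"
proof -
  have "q = [(0, a)] \<and> b = a \<and> 0 \<le> a" if "q \<in> walks (0, a) (0, b)" for q
  proof -
    from that have ne: "q \<noteq> []" and st: "successively (\<lambda>p q. q - p \<in> {(1, 1), (1, -1)}) q"
      and h: "hd q = (0, a)" and l: "last q = (0, b)" and p: "\<forall>p\<in>set q. 0 \<le> snd p"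
      by (auto simp: walks_def is_walk_def)
    have "length q - 1 = 0"
      using walk_nth[OF st, of "length q - 1"] ne h l by (simp add: last_conv_nth)
    with ne have "length q = 1" by (cases q) auto
    then obtain x where "q = [x]" by (auto simp: length_Suc_conv)
    with h l p show ?thesis by auto
  qed
  then show ?thesis by (auto simp: walks_def is_walk_def)
qed

lemma walks_Suc:
  "ps \<in> walks (0, a) (int (Suc t), b) \<longleftrightarrow>
     0 \<le> b \<and> (\<exists>q. \<exists>e\<in>{1, -1}. q \<in> walks (0, a) (int t, b + e) \<and> ps = q @ [(int (Suc t), b)])"
proof (intro iffI conjI)
  assume ps: "ps \<in> walks (0, a) (int (Suc t), b)"
  then have ne: "ps \<noteq> []" and st: "successively (\<lambda>p q. q - p \<in> {(1, 1), (1, -1)}) ps"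
    and h: "hd ps = (0, a)" and l: "last ps = (int (Suc t), b)" and p: "\<forall>p\<in>set ps. 0 \<le> snd p"
    by (auto simp: walks_def is_walk_def)
  from l p ne show "0 \<le> b" by (metis last_in_set snd_conv)
  define q where "q = butlast ps"
  have q: "ps = q @ [(int (Suc t), b)]"
    using ne l by (metis append_butlast_last_id q_def)
  have qne: "q \<noteq> []" using h q by auto
  have lq: "(int (Suc t), b) - last q \<in> {(1, 1), (1, -1)}"
    and stq: "successively (\<lambda>p q. q - p \<in> {(1, 1), (1, -1)}) q"
    using st qne by (simp_all add: q successively_append_iff)
  then obtain e where e: "e \<in> {1, -1}" "last q = (int t, b + e)"
    by (cases "last q") (auto simp: algebra_simps intro: that[of 1] that[of "-1"])
  have "q \<in> walks (0, a) (int t, b + e)"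
    using qne stq e h p by (auto simp: walks_def is_walk_def q)
  with e q show "\<exists>q. \<exists>e\<in>{1, -1}. q \<in> walks (0, a) (int t, b + e) \<and> ps = q @ [(int (Suc t), b)]"
    by blast
next
  assume "0 \<le> b \<and> (\<exists>q. \<exists>e\<in>{1, -1}. q \<in> walks (0, a) (int t, b + e) \<and> ps = q @ [(int (Suc t), b)])"
  then show "ps \<in> walks (0, a) (int (Suc t), b)"
    by (auto simp: walks_def is_walk_def successively_append_iff)
qed

definition extend :: "nat \<Rightarrow> nat \<Rightarrow> (nat \<Rightarrow> int) \<Rightarrow> (int \<times> int) list list \<Rightarrow> (int \<times> int) list list" where
  "extend n t h Q = map (\<lambda>i. Q ! i @ [(int (Suc t), h i)]) [0..<n]"

text \<open>Step vectors are read backwards: a walk ending at height \<open>h i\<close> comes from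
  height \<open>h i + e i\<close>. Restricting them to \<open>{..<n}\<close> makes the vector
  belonging to a family unique.\<close>

abbreviation steps :: "nat \<Rightarrow> (nat \<Rightarrow> int) set" where
  "steps n \<equiv> PiE {..<n} (\<lambda>_. {1, -1})"

text \<open>The old walks stay at abscissas up to \<open>t\<close>, so a new end point can collide
  only with another new end point, and injectivity of \<open>h\<close> excludes this.\<close>

lemma extend_in_families:
  assumes "Q \<in> walk_families n t (\<lambda>i. h i + e i)" "e \<in> steps n"
    and "inj_on h {..<n}" "\<forall>i<n. 0 \<le> h i"
  shows "extend n t h Q \<in> walk_families n (Suc t) h"
proof -
  from assms(1) have Q: "length Q = n" "vicious Q"
    "\<And>i. i < n \<Longrightarrow> Q ! i \<in> walks (0, 2 * int i) (int t, h i + e i)"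
    by (auto simp: walk_families_def)
  have old: "(int (Suc t), b) \<notin> set (Q ! i)" if "i < n" for i b
    using walk_fst_le[OF Q(3)[OF that]] by force
  have "vicious (extend n t h Q)"
    using Q(1,2) old assms(3) by (auto simp: vicious_def extend_def inj_on_def)
  moreover have "extend n t h Q ! i \<in> walks (0, 2 * int i) (int (Suc t), h i)" if "i < n" for i
    unfolding walks_Suc using Q(3)[OF that] that assms(2,4)
    by (intro conjI exI[of _ "Q ! i"] bexI[of _ "e i"]) (auto simp: extend_def PiE_iff)
  ultimately show ?thesis by (simp add: walk_families_def extend_def)
qed

text \<open>The union runs over all step vectors, including those for which heights
  \<open>h i + e i\<close> coincide or become negative; \<open>families_empty\<close> shows that
  these contribute nothing.\<close>

lemma families_Suc:
  assumes "inj_on h {..<n}" "\<forall>i<n. 0 \<le> h i"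
  shows "walk_families n (Suc t) h =
    (\<Union>e\<in>steps n. extend n t h ` walk_families n t (\<lambda>i. h i + e i))"
proof (intro equalityI subsetI)
  fix P assume "P \<in> walk_families n (Suc t) h"
  then have P: "length P = n" "vicious P"
    and w: "\<forall>i<n. \<exists>q. \<exists>e\<in>{1, -1}. q \<in> walks (0, 2 * int i) (int t, h i + e)
                 \<and> P ! i = q @ [(int (Suc t), h i)]"
    by (auto simp: walk_families_def walks_Suc simp del: of_nat_Suc)
  then obtain q e where qe: "\<And>i. i < n \<Longrightarrow> e i \<in> {1, -1 :: int} \<and>
      q i \<in> walks (0, 2 * int i) (int t, h i + e i) \<and> P ! i = q i @ [(int (Suc t), h i)]"
    by metis
  define Q where "Q = map q [0..<n]"
  define e' where "e' = restrict e {..<n}"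
  have "vicious Q"
    using P qe by (fastforce simp: vicious_def Q_def)
  then have "Q \<in> walk_families n t (\<lambda>i. h i + e' i)"
    using qe by (simp add: walk_families_def Q_def e'_def)
  moreover have "P = extend n t h Q"
    using P(1) qe by (intro nth_equalityI) (simp_all add: extend_def Q_def)
  moreover have "e' \<in> steps n" using qe by (auto simp: e'_def)
  ultimately show "P \<in> (\<Union>e\<in>steps n. extend n t h ` walk_families n t (\<lambda>i. h i + e i))"
    by blast
next
  fix P assume "P \<in> (\<Union>e\<in>steps n. extend n t h ` walk_families n t (\<lambda>i. h i + e i))"
  then show "P \<in> walk_families n (Suc t) h"
    using extend_in_families[OF _ _ assms] by blast
qed

text \<open>Contacts are counted as distinct points, so the only possible new one is
  \<open>(t + 1, 0)\<close>, which lies on no old walk.\<close>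

lemma contacts_extend:
  assumes "Q \<in> walk_families n t h'"
  shows "contacts (extend n t h Q) = contacts Q + (if \<exists>i<n. h i = 0 then 1 else 0)"
proof -
  from assms have Q: "length Q = n" "\<And>i. i < n \<Longrightarrow> Q ! i \<in> walks (0, 2 * int i) (int t, h' i)"
    by (auto simp: walk_families_def)
  let ?S = "{p \<in> (\<Union>W\<in>set Q. set W). snd p = 0}"
  let ?N = "if \<exists>i<n. h i = 0 then {(int (Suc t), 0::int)} else {}"
  have "{p \<in> (\<Union>W\<in>set (extend n t h Q). set W). snd p = 0} = ?S \<union> ?N"
  proof -
    have "(\<Union>W\<in>set (extend n t h Q). set W) = (\<Union>i<n. set (Q ! i) \<union> {(int (Suc t), h i)})"
      by (auto simp: extend_def)
    moreover have "(\<Union>W\<in>set Q. set W) = (\<Union>i<n. set (Q ! i))"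
      using Q(1) by (auto simp: set_conv_nth)
    ultimately show ?thesis by (auto split: if_splits)
  qed
  moreover have "?S \<inter> ?N = {}"
  proof -
    have "(int (Suc t), 0) \<notin> set W" if W: "W \<in> set Q" for W
    proof -
      obtain i where "i < n" "W = Q ! i" using W Q(1) by (metis in_set_conv_nth)
      with walk_fst_le[OF Q(2)] show ?thesis by force
    qed
    then show ?thesis by auto
  qed
  moreover have "finite ?S" by simp
  ultimately show ?thesis by (simp add: contacts_def card_Un_disjoint)
qed

text \<open>The blocks of \<open>families_Suc\<close> are disjoint because the last points of the
  walks in \<open>Q\<close> determine \<open>h i + e i\<close>, and within a block
  \<open>extend\<close> is injective because it only appends points.\<close>

lemma family_weight_Suc:
  assumes "inj_on h {..<n}" "\<forall>i<n. 0 \<le> h i"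
  shows "family_weight \<kappa> n (Suc t) h = (if \<exists>i<n. h i = 0 then \<kappa> else 1) *
    (\<Sum>e\<in>steps n. family_weight \<kappa> n t (\<lambda>i. h i + e i))"
proof -
  let ?F = "\<lambda>e. walk_families n t (\<lambda>i. h i + e i)"
  have ext_inj: "Q = Q'" if "Q \<in> ?F e" "Q' \<in> ?F e'" "extend n t h Q = extend n t h Q'" for Q Q' e e'
  proof (rule nth_equalityI)
    from that show "length Q = length Q'" by (simp add: walk_families_def)
    fix i assume "i < length Q"
    with that(1) have "i < n" by (simp add: walk_families_def)
    with arg_cong[OF that(3), of "\<lambda>P. P ! i"] show "Q ! i = Q' ! i" by (simp add: extend_def)
  qed
  have same_step: "e = e'" if "Q \<in> ?F e" "Q \<in> ?F e'" "e \<in> steps n" "e' \<in> steps n" for Q e e'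
  proof
    fix i
    show "e i = e' i"
    proof (cases "i < n")
      case True
      with that(1,2) show ?thesis by (auto simp: walk_families_def walks_def)
    next
      case False
      with that(3,4) show ?thesis by (simp add: PiE_iff extensional_def)
    qed
  qed
  have "family_weight \<kappa> n (Suc t) h =
      (\<Sum>e\<in>steps n. \<Sum>P\<in>extend n t h ` ?F e. \<kappa> ^ contacts P)"
    unfolding family_weight_def families_Suc[OF assms]
  proof (rule sum.UNION_disjoint)
    show "finite (steps n)" by (intro finite_PiE) auto
    show "\<forall>e\<in>steps n. finite (extend n t h ` ?F e)" by (simp add: finite_walk_families)
    show "\<forall>e\<in>steps n. \<forall>e'\<in>steps n. e \<noteq> e' \<longrightarrow>
      extend n t h ` ?F e \<inter> extend n t h ` ?F e' = {}"
      using ext_inj same_step by (smt (verit) disjoint_iff imageE)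
  qed
  also have "\<dots> = (\<Sum>e\<in>steps n. \<Sum>Q\<in>?F e. \<kappa> ^ contacts (extend n t h Q))"
    using ext_inj by (intro sum.cong refl sum.reindex_cong[OF _ refl]) (auto simp: inj_on_def)
  also have "\<dots> = (if \<exists>i<n. h i = 0 then \<kappa> else 1) *
    (\<Sum>e\<in>steps n. family_weight \<kappa> n t (\<lambda>i. h i + e i))"
    unfolding family_weight_def sum_distrib_left
    by (intro sum.cong refl) (auto simp: contacts_extend)
  finally show ?thesis .
qed

lemma families_empty:
  assumes "i < n" "h i < 0 \<or> (\<exists>j<n. i \<noteq> j \<and> h i = h j)"
  shows "walk_families n t h = {}"
proof (rule ccontr)
  assume "walk_families n t h \<noteq> {}"
  then obtain P where P: "length P = n" "vicious P"
    "\<And>i. i < n \<Longrightarrow> P ! i \<in> walks (0, 2 * int i) (int t, h i)"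
    by (auto simp: walk_families_def)
  have l: "(int t, h j) \<in> set (P ! j) \<and> 0 \<le> h j" if "j < n" for j
  proof -
    have "P ! j \<noteq> []" "last (P ! j) = (int t, h j)" "\<forall>p\<in>set (P ! j). 0 \<le> snd p"
      using P(3)[OF that] by (auto simp: walks_def is_walk_def)
    then show ?thesis by (metis last_in_set snd_conv)
  qed
  from assms(2) show False
    using l[OF assms(1)] l P(1,2) assms(1) by (fastforce simp: vicious_def)
qed

text \<open>Generating function of the contacts of single walks of length \<open>T\<close> from the
  axis to height \<open>m\<close>. The start counts as a contact, hence the value
  \<open>\<kappa>\<close> for \<open>T = 0\<close>. Heights are integers so that
  \<open>m - 1\<close> makes sense at the axis.\<close>

fun walk_weight :: "real \<Rightarrow> nat \<Rightarrow> int \<Rightarrow> real" where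
  "walk_weight \<kappa> 0 m = (if m = 0 then \<kappa> else 0)"
| "walk_weight \<kappa> (Suc T) m = (if m < 0 then 0 else
     (if m = 0 then \<kappa> else 1) * (walk_weight \<kappa> T (m - 1) + walk_weight \<kappa> T (m + 1)))"

lemma walk_weight_neg: "m < 0 \<Longrightarrow> walk_weight \<kappa> T m = 0"
  by (cases T) auto

lemma walk_weight_above: "int T < m \<Longrightarrow> walk_weight \<kappa> T m = 0"
  by (induction T arbitrary: m) auto

lemma walk_weight_diag: "walk_weight \<kappa> T (int T) = \<kappa>"
  by (induction T) (auto simp: walk_weight_above)

definition walk_det :: "real \<Rightarrow> nat \<Rightarrow> nat \<Rightarrow> (nat \<Rightarrow> int) \<Rightarrow> real" where
  "walk_det \<kappa> n t h = det (mat n n (\<lambda>(i, j). walk_weight \<kappa> (t + 2 * i) (h j)))"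

lemma det_mat_col:
  "det (mat n n f) = (\<Sum>p | p permutes {0..<n}. of_int (sign p) * (\<Prod>j<n. f (p j, j)))"
  by (subst det_col[of _ n])
     (auto intro!: sum.cong prod.cong simp: permutes_in_image
           dest: permutes_in_image[of _ _ "_::nat"])

text \<open>The one-step recurrence has the same coefficients in all rows of a column, so
  multilinearity in the columns yields a sum over step vectors. As \<open>h\<close> is injective, at
  most one column carries the factor \<open>\<kappa>\<close>, in agreement with the single new
  contact.\<close>

lemma walk_det_Suc:
  assumes "inj_on h {..<n}" "\<forall>i<n. 0 \<le> h i"
  shows "walk_det \<kappa> n (Suc t) h = (if \<exists>i<n. h i = 0 then \<kappa> else 1) *
    (\<Sum>e\<in>steps n. walk_det \<kappa> n t (\<lambda>i. h i + e i))"
proof -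
  let ?c = "if \<exists>i<n. h i = 0 then \<kappa> else 1"
  have c: "(\<Prod>j<n. if h j = 0 then \<kappa> else 1) = ?c"
  proof (cases "\<exists>i<n. h i = 0")
    case True
    then obtain i where i: "i < n" "h i = 0" by blast
    have "(\<Prod>j<n. if h j = 0 then \<kappa> else 1) = (\<Prod>j<n. if j = i then \<kappa> else 1)"
      using assms(1) i by (intro prod.cong) (auto simp: inj_on_def)
    then show ?thesis using i True by auto
  qed auto
  have "walk_det \<kappa> n (Suc t) h = (\<Sum>p | p permutes {0..<n}. of_int (sign p) *
     (\<Prod>j<n. (if h j = 0 then \<kappa> else 1) *
        (\<Sum>e\<in>{1, -1}. walk_weight \<kappa> (t + 2 * p j) (h j + e))))"
    unfolding walk_det_def det_mat_col using assms(2)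
    by (intro sum.cong refl arg_cong2[where f="(*)"] prod.cong) (auto simp: add.commute)
  also have "\<dots> = (\<Sum>p | p permutes {0..<n}. \<Sum>e\<in>steps n. ?c * (of_int (sign p) *
      (\<Prod>j<n. walk_weight \<kappa> (t + 2 * p j) (h j + e j))))"
    unfolding prod.distrib c
    by (subst prod_sum_PiE) (auto simp: sum_distrib_left mult_ac)
  also have "\<dots> = ?c * (\<Sum>e\<in>steps n. walk_det \<kappa> n t (\<lambda>i. h i + e i))"
    unfolding walk_det_def det_mat_col
    by (subst sum.swap) (simp add: sum_distrib_left)
  finally show ?thesis .
qed

lemma walk_det_eq_0:
  assumes "i < n" "h i < 0 \<or> (\<exists>j<n. i \<noteq> j \<and> h i = h j)"
  shows "walk_det \<kappa> n t h = 0"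
  using assms(2)
proof
  assume "h i < 0"
  then have "(\<Prod>j<n. walk_weight \<kappa> (t + 2 * p j) (h j)) = 0" for p
    using assms(1) by (intro prod_zero bexI[of _ i]) (auto simp: walk_weight_neg)
  then show ?thesis by (simp only: walk_det_def det_mat_col prod.case) simp
next
  assume "\<exists>j<n. i \<noteq> j \<and> h i = h j"
  then obtain j where "j < n" "i \<noteq> j" "h i = h j" by blast
  then show ?thesis unfolding walk_det_def
    using assms(1) by (intro det_identical_columns[of _ n i j]) (auto intro!: eq_vecI)
qed

lemma even_gap: "a < b \<Longrightarrow> a mod 2 = b mod 2 \<Longrightarrow> a + 2 \<le> b" for a b :: int
  by presburger

text \<open>Both sides obey the same recurrence and agree at length 0. The hypotheses on
  \<open>h\<close> are chosen to survive the induction: distinct nonnegative heights of one parity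
  are at least 2 apart, so one step may make neighbours equal or reach -1 but cannot interchange
  them, and in these degenerate cases both sides vanish.\<close>

theorem family_weight_eq_walk_det:
  assumes "\<forall>i<n. \<forall>j<n. i < j \<longrightarrow> h i \<le> h j" "\<forall>i<n. -1 \<le> h i" "\<forall>i<n. h i mod 2 = c" "0 < n"
  shows "\<kappa> ^ (n - 1) * family_weight \<kappa> n t h = walk_det \<kappa> n t h"
  using assms
proof (induction t arbitrary: h c)
  case (0 h c)
  show ?case
  proof (cases "\<exists>i<n. h i < 0 \<or> (\<exists>j<n. i \<noteq> j \<and> h i = h j)")
    case True
    then obtain i where "i < n" "h i < 0 \<or> (\<exists>j<n. i \<noteq> j \<and> h i = h j)" by blast
    then show ?thesis by (simp only: walk_det_eq_0 families_empty family_weight_def) simp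
  next
    case False
    \<comment> \<open>Gaps of at least 2 above a nonnegative lowest height give
      \<open>2 * j \<le> h j\<close>. At length 0 a family exists only if equality holds throughout,
      and equality for the top height already forces this.\<close>
    have step: "h i + 2 \<le> h (Suc i)" if "Suc i < n" for i
    proof (rule even_gap)
      have "h i \<noteq> h (Suc i)" using False that by (metis Suc_lessD n_not_Suc_n)
      moreover have "h i \<le> h (Suc i)" using 0(1) that by simp
      ultimately show "h i < h (Suc i)" by simp
      show "h i mod 2 = h (Suc i) mod 2" using 0(3) that by simp
    qed
    have ge: "h i + 2 * (int j - int i) \<le> h j" if "i \<le> j" "j < n" for i j
      using that
    proof (induction j rule: dec_induct)
      case (step k)
      then show ?case using \<open>\<And>i. Suc i < n \<Longrightarrow> h i + 2 \<le> h (Suc i)\<close>[of k] by simp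
    qed simp
    have lb: "2 * int j \<le> h j" if "j < n" for j
      using ge[of 0 j] False that \<open>0 < n\<close> by force
    show ?thesis
    proof (cases "h (n - 1) = 2 * int (n - 1)")
      case True
      have h: "h j = 2 * int j" if "j < n" for j
        using ge[of j "n - 1"] lb[OF that] True that by (simp add: of_nat_diff)
      let ?P = "map (\<lambda>i. [(0::int, 2 * int i)]) [0..<n]"
      have "walk_families n 0 h = {?P}"
      proof (intro equalityI subsetI)
        fix P assume "P \<in> walk_families n 0 h"
        then show "P \<in> {?P}"
          by (auto simp: walk_families_def h walks_0 intro!: nth_equalityI)
      qed (auto simp: walk_families_def h walks_0 vicious_def)
      moreover have "{p \<in> (\<Union>W\<in>set ?P. set W). snd p = 0} = {(0, 0)}"
        using \<open>0 < n\<close> by auto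
      ultimately have W: "family_weight \<kappa> n 0 h = \<kappa>"
        by (simp add: family_weight_def contacts_def)
      let ?M = "mat n n (\<lambda>(i, j). walk_weight \<kappa> (0 + 2 * i) (h j))"
      \<comment> \<open>A walk of length \<open>2 * i\<close> cannot reach height
        \<open>2 * j\<close> with \<open>j > i\<close>, and it reaches \<open>2 * i\<close> only
        along the diagonal, with weight \<open>\<kappa>\<close>.\<close>
      have "det ?M = prod_list (diag_mat ?M)"
        by (rule det_lower_triangular[of n]) (auto simp: h walk_weight_above)
      also have "diag_mat ?M = map (\<lambda>i. \<kappa>) [0..<n]"
        using walk_weight_diag[of \<kappa> "2 * _"] by (auto simp: diag_mat_def h)
      finally have "walk_det \<kappa> n 0 h = \<kappa> ^ n"
        by (simp add: walk_det_def map_replicate_const prod_list_replicate)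
      with W \<open>0 < n\<close> show ?thesis by (cases n) auto
    next
      \<comment> \<open>Here the top height exceeds \<open>2 * (n - 1)\<close>, the length belonging
        to the last row, so the whole last column of the determinant is zero.\<close>
      case F: False
      with lb[of "n - 1"] \<open>0 < n\<close> have gt: "h (n - 1) > 2 * int (n - 1)" by simp
      have "P \<notin> walk_families n 0 h" for P
      proof
        assume "P \<in> walk_families n 0 h"
        then have "\<forall>i<n. P ! i \<in> walks (0, 2 * int i) (0, h i)"
          by (simp add: walk_families_def)
        from this[rule_format, of "n - 1"]
        have "P ! (n - 1) \<in> walks (0, 2 * int (n - 1)) (0, h (n - 1))"
          using \<open>0 < n\<close> by simp
        then show False using gt by (simp add: walks_0 split: if_splits)
      qed
      then have "walk_families n 0 h = {}" by blast
      moreover have "(\<Prod>j<n. walk_weight \<kappa> (0 + 2 * p j) (h j)) = 0" if "p permutes {0..<n}" for p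
      proof (rule prod_zero)
        have "p (n - 1) < n" using permutes_in_image[OF that, of "n - 1"] \<open>0 < n\<close> by simp
        then show "\<exists>j\<in>{..<n}. walk_weight \<kappa> (0 + 2 * p j) (h j) = 0"
          using gt \<open>0 < n\<close> by (intro bexI[of _ "n - 1"] walk_weight_above) (simp_all add: of_nat_diff)
      qed simp
      then have "walk_det \<kappa> n 0 h = 0"
        unfolding walk_det_def det_mat_col prod.case by (intro sum.neutral) simp
      ultimately show ?thesis by (simp add: family_weight_def)
    qed
  qed
next
  case (Suc t h c)
  show ?case
  proof (cases "\<exists>i<n. h i < 0 \<or> (\<exists>j<n. i \<noteq> j \<and> h i = h j)")
    case True
    then obtain i where "i < n" "h i < 0 \<or> (\<exists>j<n. i \<noteq> j \<and> h i = h j)" by blast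
    then show ?thesis by (simp only: walk_det_eq_0 families_empty family_weight_def) simp
  next
    case False
    then have h: "inj_on h {..<n}" "\<forall>i<n. 0 \<le> h i" by (force simp: inj_on_def)+
    have "\<kappa> ^ (n - 1) * family_weight \<kappa> n t (\<lambda>i. h i + e i) = walk_det \<kappa> n t (\<lambda>i. h i + e i)"
      if e: "e \<in> steps n" for e
    proof (rule Suc.IH[of _ "(c + 1) mod 2"])
      have e': "e i = 1 \<or> e i = -1" if "i < n" for i using e that by (auto simp: PiE_iff)
      show "\<forall>i<n. \<forall>j<n. i < j \<longrightarrow> h i + e i \<le> h j + e j"
      proof (intro allI impI)
        fix i j assume ij: "i < n" "j < n" "i < j"
        have "h i \<le> h j" using Suc.prems(1) ij by blast
        moreover have "h i \<noteq> h j" using h(1) ij by (auto simp: inj_on_def)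
        ultimately have "h i < h j" by simp
        then have "h i + 2 \<le> h j" using Suc.prems(3) ij by (intro even_gap) auto
        then show "h i + e i \<le> h j + e j" using e'[OF ij(1)] e'[OF ij(2)] by linarith
      qed
      show "\<forall>i<n. -1 \<le> h i + e i" using e' h(2) by force
      show "\<forall>i<n. (h i + e i) mod 2 = (c + 1) mod 2"
      proof (intro allI impI)
        fix i assume "i < n"
        then have "h i mod 2 = c" using Suc.prems(3) by blast
        with e'[OF \<open>i < n\<close>] show "(h i + e i) mod 2 = (c + 1) mod 2" by (elim disjE) (simp_all, presburger+)
      qed
    qed (use Suc.prems in auto)
    then show ?thesis
      by (simp add: family_weight_Suc[OF h] walk_det_Suc[OF h] sum_distrib_left mult.left_commute)
  qed
qed

section \<open>Evaluation of the determinant\<close>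

text \<open>Away from the axis both sides obey the same linear recurrence. At the axis
  \<open>\<kappa>\<close> is split as 1 + (\<open>\<kappa>\<close> - 1): the first part is rewritten
  by the case of height 1, the second supplies the missing predecessor of height 2. Raising the
  height by 2 means moving to the next column, so this is the column operation that leaves a
  multiple of an unweighted count.\<close>

lemma walk_weight_recurrence:
  "0 \<le> m \<Longrightarrow> walk_weight \<kappa> T m = \<kappa> * walk_weight 1 T m + (\<kappa> - 1) * walk_weight \<kappa> T (m + 2)"
proof (induction T arbitrary: m)
  case (Suc T)
  show ?case
  proof (cases "m = 0")
    case True
    have "walk_weight \<kappa> T 1 = \<kappa> * walk_weight 1 T 1 + (\<kappa> - 1) * walk_weight \<kappa> T 3"
      using Suc.IH[of 1] by simp
    then have "\<kappa> * walk_weight \<kappa> T 1 =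
        \<kappa> * walk_weight 1 T 1 + (\<kappa> - 1) * (walk_weight \<kappa> T 1 + walk_weight \<kappa> T 3)"
    proof -
      have "\<kappa> * walk_weight 1 T 1 + (\<kappa> - 1) * (walk_weight \<kappa> T 1 + walk_weight \<kappa> T 3) =
        (\<kappa> * walk_weight 1 T 1 + (\<kappa> - 1) * walk_weight \<kappa> T 3) + (\<kappa> - 1) * walk_weight \<kappa> T 1"
        by (simp add: algebra_simps)
      also have "\<dots> = walk_weight \<kappa> T 1 + (\<kappa> - 1) * walk_weight \<kappa> T 1"
        using \<open>walk_weight \<kappa> T 1 = _\<close> by simp
      finally show ?thesis by (simp add: algebra_simps)
    qed
    with True show ?thesis by (simp add: walk_weight_neg)
  next
    case False
    then have "0 \<le> m - 1" "0 \<le> m + 1" using Suc.prems by auto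
    note IH = this[THEN Suc.IH]
    have "walk_weight \<kappa> (Suc T) m = walk_weight \<kappa> T (m - 1) + walk_weight \<kappa> T (m + 1)"
      using False Suc.prems by simp
    also have "\<dots> = \<kappa> * (walk_weight 1 T (m - 1) + walk_weight 1 T (m + 1))
        + (\<kappa> - 1) * (walk_weight \<kappa> T (m - 1 + 2) + walk_weight \<kappa> T (m + 1 + 2))"
      by (subst IH(1), subst IH(2)) (simp only: distrib_left add_ac)
    finally show ?thesis using False Suc.prems by (simp add: algebra_simps)
  qed
qed auto

text \<open>Iterating the recurrence raises the height by 2 each time; the remainder vanishes once
  the height exceeds the length of the walk.\<close>

lemma walk_weight_geometric:
  assumes "int T < m + 2 * int (Suc K)" "0 \<le> m"
  shows "walk_weight \<kappa> T m = (\<Sum>k\<le>K. (\<kappa> - 1) ^ k * (\<kappa> * walk_weight 1 T (m + 2 * int k)))"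
proof -
  have "walk_weight \<kappa> T m = (\<Sum>k\<le>K. (\<kappa> - 1) ^ k * (\<kappa> * walk_weight 1 T (m + 2 * int k)))
      + (\<kappa> - 1) ^ Suc K * walk_weight \<kappa> T (m + 2 * int (Suc K))" for K
  proof (induction K)
    case 0
    show ?case using walk_weight_recurrence[OF assms(2), of \<kappa> T] by simp
  next
    case (Suc K)
    have "walk_weight \<kappa> T (m + 2 * int (Suc K)) = \<kappa> * walk_weight 1 T (m + 2 * int (Suc K))
        + (\<kappa> - 1) * walk_weight \<kappa> T (m + 2 * int (Suc (Suc K)))"
    proof -
      have "m + 2 * int (Suc (Suc K)) = m + 2 * int (Suc K) + 2" by simp
      then show ?thesis
        using walk_weight_recurrence[of "m + 2 * int (Suc K)" \<kappa> T] assms(2) by (simp add: algebra_simps)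
    qed
    then have "(\<kappa> - 1) ^ Suc K * walk_weight \<kappa> T (m + 2 * int (Suc K)) =
        (\<kappa> - 1) ^ Suc K * (\<kappa> * walk_weight 1 T (m + 2 * int (Suc K)))
        + (\<kappa> - 1) ^ Suc (Suc K) * walk_weight \<kappa> T (m + 2 * int (Suc (Suc K)))"
      by (simp only: distrib_left power_Suc mult_ac)
    with Suc.IH show ?case by (simp only: sum.atMost_Suc add.assoc)
  qed
  from this[of K] show ?thesis by (simp only: walk_weight_above[OF assms(1)])
qed

section \<open>Closed forms of the single-walk weights for contact weight 1 and 2\<close>

lemma walk_weight_Suc_int:
  "walk_weight \<kappa> (Suc T) (int (Suc m)) = walk_weight \<kappa> T (int m) + walk_weight \<kappa> T (int (m + 2))"
  by (simp add: algebra_simps)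

text \<open>These are the ballot numbers, with \<open>p\<close> the number of down-steps, multiplied
  out to avoid division. In the induction on the length, \<open>m = 0\<close> and
  \<open>p = 0\<close> are the boundaries at which only one predecessor contributes.\<close>

lemma walk_weight_1_closed:
  "walk_weight 1 (m + 2 * p) (int m) * (fact p * fact (m + p + 1)) = (real m + 1) * fact (m + 2 * p)"
proof (induction "m + 2 * p" arbitrary: m p)
  case 0
  then show ?case by simp
next
  case (Suc T)
  note Suc_T = Suc.hyps(2)
  show ?case
  proof (cases m)
    case 0
    with Suc.hyps(2) obtain q where p: "p = Suc q" by (cases p) auto
    with 0 Suc.hyps(2) have T: "T = 1 + 2 * q" by simp
    from Suc.hyps(1)[OF this]
    have IH: "walk_weight 1 T 1 * (fact q * fact (q + 2)) = 2 * fact T" using T by simp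
    have "m + 2 * p = Suc T" using 0 p T by simp
    then have w: "walk_weight 1 (m + 2 * p) (int m) = walk_weight 1 T 1"
      using 0 by (simp add: walk_weight_neg)
    have f: "fact (m + 2 * p) = (2 * real q + 2) * fact T"
      unfolding \<open>m + 2 * p = Suc T\<close> using T by simp
    have "walk_weight 1 T 1 * (fact p * fact (m + p + 1)) =
        (q + 1) * (walk_weight 1 T 1 * (fact q * fact (q + 2)))"
      using 0 p by (simp add: mult_ac)
    then show ?thesis unfolding w f IH using 0 by (simp add: algebra_simps)
  next
    case (Suc m')
    note m = Suc
    show ?thesis
    proof (cases p)
      case 0
      then have T: "T = m' + 2 * 0" using Suc.hyps(2) m by simp
      have w: "walk_weight 1 (m + 2 * p) (int m) = walk_weight 1 T (int m')"
        using walk_weight_Suc_int[of 1 T m', folded m, unfolded Suc_T] T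
        by (simp add: walk_weight_above)
      then show ?thesis using walk_weight_diag[of 1 m'] 0 m T by simp
    next
      case (Suc q)
      have T: "T = m' + 2 * p" "T = (m' + 2) + 2 * q" using Suc.hyps(2) m Suc by simp_all
      define a where "a = walk_weight 1 T (int m')"
      define b where "b = walk_weight 1 T (int (m' + 2))"
      define F :: real where "F = fact T"
      have a: "a * (fact q * fact (m' + q + 2)) * (q + 1) = (real m' + 1) * F"
        using Suc.hyps(1)[OF T(1)] T Suc by (simp add: a_def F_def algebra_simps)
      have b: "b * (fact q * fact (m' + q + 2)) * (m' + q + 3) = (real m' + 3) * F"
        using Suc.hyps(1)[OF T(2)] T(2) by (simp add: b_def F_def algebra_simps)
      have ab: "walk_weight 1 (m + 2 * p) (int m) = a + b"
        unfolding a_def b_def by (rule walk_weight_Suc_int[of 1 T m', folded m, unfolded Suc_T])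
      have f: "fact (m + 2 * p) = (real m' + 2 * q + 3) * F"
        unfolding Suc_T[symmetric] F_def fact_Suc using T(2) by simp
      have "(a + b) * (fact p * fact (m + p + 1)) =
          (a * (fact q * fact (m' + q + 2)) * (q + 1)) * (m' + q + 3)
        + (b * (fact q * fact (m' + q + 2)) * (m' + q + 3)) * (q + 1)"
        using m Suc by (simp add: algebra_simps)
      also have "\<dots> = (real m + 1) * ((real m' + 2 * q + 3) * F)"
        unfolding a b using m by (simp add: algebra_simps)
      finally show ?thesis unfolding ab f .
    qed
  qed
qed

text \<open>A weight 2 per contact amounts to reflecting each piece between contacts freely. For
  \<open>m > 0\<close> the value therefore counts unrestricted paths to \<open>m\<close> or
  \<open>-m\<close>; for \<open>m = 0\<close> the last contact leaves a factor 2. The proof is the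
  same induction as for the ballot numbers.\<close>

lemma walk_weight_2_closed:
  "walk_weight 2 (m + 2 * p) (int m) * (fact p * fact (m + p)) = 2 * fact (m + 2 * p)"
proof (induction "m + 2 * p" arbitrary: m p)
  case 0
  then show ?case by simp
next
  case (Suc T)
  note Suc_T = Suc.hyps(2)
  show ?case
  proof (cases m)
    case 0
    with Suc.hyps(2) obtain q where p: "p = Suc q" by (cases p) auto
    with 0 Suc.hyps(2) have T: "T = 1 + 2 * q" by simp
    from Suc.hyps(1)[OF this]
    have IH: "walk_weight 2 T 1 * (fact q * fact (q + 1)) = 2 * fact T" using T by simp
    have "m + 2 * p = Suc T" using 0 p T by simp
    then have w: "walk_weight 2 (m + 2 * p) (int m) = 2 * walk_weight 2 T 1"
      using 0 by (simp add: walk_weight_neg)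
    have f: "fact (m + 2 * p) = (2 * real q + 2) * fact T"
      unfolding \<open>m + 2 * p = Suc T\<close> using T by simp
    have "2 * walk_weight 2 T 1 * (fact p * fact (m + p)) =
        2 * (q + 1) * (walk_weight 2 T 1 * (fact q * fact (q + 1)))"
      using 0 p by (simp add: mult_ac)
    then show ?thesis unfolding w f IH using 0 by (simp add: algebra_simps)
  next
    case (Suc m')
    note m = Suc
    show ?thesis
    proof (cases p)
      case 0
      then have T: "T = m' + 2 * 0" using Suc.hyps(2) m by simp
      have w: "walk_weight 2 (m + 2 * p) (int m) = walk_weight 2 T (int m')"
        using walk_weight_Suc_int[of 2 T m', folded m, unfolded Suc_T] T
        by (simp add: walk_weight_above)
      then show ?thesis using walk_weight_diag[of 2 m'] 0 m T by simp
    next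
      case (Suc q)
      have T: "T = m' + 2 * p" "T = (m' + 2) + 2 * q" using Suc.hyps(2) m Suc by simp_all
      define a where "a = walk_weight 2 T (int m')"
      define b where "b = walk_weight 2 T (int (m' + 2))"
      define F :: real where "F = fact T"
      have a: "a * (fact q * fact (m' + q + 1)) * (q + 1) = 2 * F"
        using Suc.hyps(1)[OF T(1)] T Suc by (simp add: a_def F_def algebra_simps)
      have b: "b * (fact q * fact (m' + q + 1)) * (m' + q + 2) = 2 * F"
        using Suc.hyps(1)[OF T(2)] T(2) by (simp add: b_def F_def algebra_simps)
      have ab: "walk_weight 2 (m + 2 * p) (int m) = a + b"
        unfolding a_def b_def by (rule walk_weight_Suc_int[of 2 T m', folded m, unfolded Suc_T])
      have f: "fact (m + 2 * p) = (real m' + 2 * q + 3) * F"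
        unfolding Suc_T[symmetric] F_def fact_Suc using T(2) by simp
      have "(a + b) * (fact p * fact (m + p)) =
          (a * (fact q * fact (m' + q + 1)) * (q + 1)) * (m' + q + 2)
        + (b * (fact q * fact (m' + q + 1)) * (m' + q + 2)) * (q + 1)"
        using m Suc by (simp add: algebra_simps)
      also have "\<dots> = 2 * ((real m' + 2 * q + 3) * F)"
        unfolding a b by (simp add: algebra_simps)
      finally show ?thesis unfolding ab f .
    qed
  qed
qed

lemma prod_falling: "d \<le> P \<Longrightarrow> (\<Prod>l<d. real P - real l) * fact (P - d) = fact P"
proof (induction d)
  case (Suc d)
  then have "fact (P - d) = (real P - real d) * fact (P - Suc d)"
    by (metis Suc_diff_Suc Suc_le_eq fact_Suc of_nat_diff Suc_leD)
  with Suc show ?case by (simp add: mult_ac)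
qed simp

text \<open>The product of two falling factorials becomes a polynomial in the product of
  \<open>P\<close> and \<open>Q\<close> alone as soon as their sum is held fixed.\<close>

lemma prod_falling_pair:
  assumes "d \<le> P" "P \<le> Q"
  shows "(\<Prod>l<d. real P * real Q - real l * (real P + real Q - real l)) * (fact (P - d) * fact (Q - d))
    = fact P * fact Q"
proof -
  have "(\<Prod>l<d. real P * real Q - real l * (real P + real Q - real l)) =
      (\<Prod>l<d. real P - real l) * (\<Prod>l<d. real Q - real l)"
    unfolding prod.distrib[symmetric] by (intro prod.cong) (auto simp: algebra_simps)
  then show ?thesis using prod_falling[of d P] prod_falling[of d Q] assms
    by (metis (no_types, lifting) mult.assoc mult.left_commute order_trans)
qed

text \<open>Row and column data separate: the row enters through \<open>d\<close>, the column
  through \<open>m\<close> and \<open>P\<close>, and the nodes \<open>l * (\<tau> + 1 - l)\<close>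
  are common to all columns because \<open>P + (m + P + 1) = \<tau> + 1\<close>. For
  \<open>d > P\<close> the walk is too short to reach \<open>m\<close>, and the factor with
  \<open>l = P\<close> vanishes.\<close>

lemma walk_weight_1_newton:
  assumes "\<tau> = m + 2 * P" "2 * d \<le> \<tau>"
  shows "walk_weight 1 (\<tau> - 2 * d) (int m) =
    fact (\<tau> - 2 * d) * ((real m + 1) / (fact P * fact (m + P + 1))) *
    (\<Prod>l<d. real P * real (m + P + 1) - real l * (real \<tau> + 1 - real l))"
proof (cases "d \<le> P")
  case True
  have "\<tau> - 2 * d = m + 2 * (P - d)" using assms True by simp
  then have "walk_weight 1 (\<tau> - 2 * d) (int m) =
      (real m + 1) * fact (\<tau> - 2 * d) / (fact (P - d) * fact (m + P + 1 - d))"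
    using walk_weight_1_closed[of m "P - d"] True by (simp add: eq_divide_eq Suc_diff_le del: fact_Suc)
  moreover have "(\<Prod>l<d. real P * real (m + P + 1) - real l * (real \<tau> + 1 - real l)) =
      fact P * fact (m + P + 1) / (fact (P - d) * fact (m + P + 1 - d))"
    using prod_falling_pair[of d P "m + P + 1"] True assms(1)
    by (simp add: eq_divide_eq algebra_simps del: fact_Suc)
  ultimately show ?thesis by (simp del: fact_Suc)
next
  case False
  then have "(\<Prod>l<d. real P * real (m + P + 1) - real l * (real \<tau> + 1 - real l)) = 0"
    using assms(1) by (intro prod_zero bexI[of _ P]) (auto simp: algebra_simps)
  then show ?thesis using False assms by (simp add: walk_weight_above)
qed

lemma walk_weight_2_newton:
  assumes "\<tau> = m + 2 * P" "2 * d \<le> \<tau>"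
  shows "walk_weight 2 (\<tau> - 2 * d) (int m) =
    fact (\<tau> - 2 * d) * (2 / (fact P * fact (m + P))) *
    (\<Prod>l<d. real P * real (m + P) - real l * (real \<tau> - real l))"
proof (cases "d \<le> P")
  case True
  have "\<tau> - 2 * d = m + 2 * (P - d)" using assms True by simp
  then have "walk_weight 2 (\<tau> - 2 * d) (int m) =
      2 * fact (\<tau> - 2 * d) / (fact (P - d) * fact (m + P - d))"
    using walk_weight_2_closed[of m "P - d"] True by (simp add: eq_divide_eq)
  moreover have "(\<Prod>l<d. real P * real (m + P) - real l * (real \<tau> - real l)) =
      fact P * fact (m + P) / (fact (P - d) * fact (m + P - d))"
    using prod_falling_pair[of d P "m + P"] True assms(1)
    by (simp add: eq_divide_eq algebra_simps)
  ultimately show ?thesis by simp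
next
  case False
  then have "(\<Prod>l<d. real P * real (m + P) - real l * (real \<tau> - real l)) = 0"
    using assms(1) by (intro prod_zero bexI[of _ P]) (auto simp: algebra_simps)
  then show ?thesis using False assms by (simp add: walk_weight_above)
qed

section \<open>Determinants of Vandermonde type and column operations\<close>

lemma det_mat_cong:
  "(\<And>i j. i < n \<Longrightarrow> j < n \<Longrightarrow> f i j = g i j) \<Longrightarrow>
    det (mat n n (\<lambda>(i, j). f i j)) = det (mat n n (\<lambda>(i, j). g i j))"
  by (intro arg_cong[where f=det] cong_mat) auto

lemma det_unitriangular_mult:
  fixes f g c :: "nat \<Rightarrow> nat \<Rightarrow> real"
  assumes "\<And>i j. i < n \<Longrightarrow> j < n \<Longrightarrow> f i j = (\<Sum>l<n. c i l * g l j)"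
    and "(\<And>i l. i < n \<Longrightarrow> l < i \<Longrightarrow> c i l = 0)" "\<And>i. i < n \<Longrightarrow> c i i = 1"
  shows "det (mat n n (\<lambda>(i, j). f i j)) = det (mat n n (\<lambda>(i, j). g i j))"
proof -
  let ?C = "mat n n (\<lambda>(i, j). c i j)" and ?G = "mat n n (\<lambda>(i, j). g i j)"
  have "mat n n (\<lambda>(i, j). f i j) = ?C * ?G"
    using assms(1) by (intro eq_matI) (auto simp: scalar_prod_def lessThan_atLeast0)
  moreover have "det ?C = prod_list (diag_mat ?C)"
    using assms(2) by (intro det_upper_triangular[of _ n]) auto
  moreover have "diag_mat ?C = map (\<lambda>i. 1) [0..<n]"
    using assms(3) by (auto simp: diag_mat_def)
  ultimately show ?thesis
    by (simp add: det_mult[of _ n] map_replicate_const prod_list_replicate)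
qed

lemma det_scale:
  fixes f :: "nat \<Rightarrow> nat \<Rightarrow> real"
  shows "det (mat n n (\<lambda>(i, j). c i * d j * f i j)) =
    (\<Prod>i<n. c i) * (\<Prod>j<n. d j) * det (mat n n (\<lambda>(i, j). f i j))"
proof -
  have "(\<Prod>j<n. c (p j)) = (\<Prod>i<n. c i)" if "p permutes {0..<n}" for p
    using prod.permute[OF that, of c] by (simp add: lessThan_atLeast0 comp_def)
  then show ?thesis
    by (simp add: det_mat_col prod.distrib sum_distrib_left mult_ac)
qed

lemma prod_monic_linear:
  fixes a :: "nat \<Rightarrow> real"
  defines "q \<equiv> \<lambda>d. \<Prod>l<d. [:- a l, 1:]"
  shows "degree (q d) = d" "coeff (q d) d = 1" "poly (q d) x = (\<Prod>l<d. x - a l)"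
proof -
  have "degree (q d) = d \<and> lead_coeff (q d) = 1"
    unfolding q_def
  proof (induction d)
    case (Suc d)
    define Q where "Q = (\<Prod>l<d. [:- a l, 1:])"
    have Q: "degree Q = d" "lead_coeff Q = 1" "Q \<noteq> 0" using Suc by (auto simp: Q_def)
    have "degree (Q * [:- a d, 1:]) = Suc d"
      using degree_mult_eq[of Q "[:- a d, 1:]"] Q by (simp del: mult_pCons_right)
    moreover have "lead_coeff (Q * [:- a d, 1:]) = 1"
      using lead_coeff_mult[of Q "[:- a d, 1:]"] Q by (simp del: mult_pCons_right)
    ultimately show ?case by (simp only: prod.lessThan_Suc Q_def simp_thms)
  qed simp
  then show "degree (q d) = d" "coeff (q d) d = 1" by auto
  show "poly (q d) x = (\<Prod>l<d. x - a l)" by (simp add: q_def poly_prod)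
qed

text \<open>Passing from one monic polynomial per degree to the plain powers is a unitriangular row
  operation; degrees fall from row to row, so the matrix of coefficients is upper
  triangular.\<close>

lemma det_newton_eq_power:
  fixes a x :: "nat \<Rightarrow> real"
  shows "det (mat n n (\<lambda>(i, j). \<Prod>l<n - 1 - i. x j - a l)) =
    det (mat n n (\<lambda>(i, j). x j ^ (n - 1 - i)))"
proof (rule det_unitriangular_mult)
  let ?q = "\<lambda>d. \<Prod>l<d. [:- a l, 1:]"
  let ?c = "\<lambda>i l. coeff (?q (n - 1 - i)) (n - 1 - l)"
  note q = prod_monic_linear[of a]
  show "?c i i = 1" for i by (rule q(2))
  show "?c i l = 0" if "i < n" "l < i" for i l
    using that q(1)[of "n - 1 - i"] by (intro coeff_eq_0) simp
  show "(\<Prod>l<n - 1 - i. x j - a l) = (\<Sum>l<n. ?c i l * x j ^ (n - 1 - l))" if "i < n" for i j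
  proof -
    have "(\<Prod>l<n - 1 - i. x j - a l) = (\<Sum>l\<le>n - 1 - i. coeff (?q (n - 1 - i)) l * x j ^ l)"
      unfolding q(3)[symmetric] poly_altdef q(1) ..
    also have "\<dots> = (\<Sum>l<n. coeff (?q (n - 1 - i)) l * x j ^ l)"
    proof (rule sum.mono_neutral_left)
      show "\<forall>l\<in>{..<n} - {..n - 1 - i}. coeff (?q (n - 1 - i)) l * x j ^ l = 0"
        using q(1)[of "n - 1 - i"] by (auto intro!: coeff_eq_0)
    qed (use that in auto)
    also have "\<dots> = (\<Sum>l<n. ?c i l * x j ^ (n - 1 - l))"
      by (subst sum.nat_diff_reindex[symmetric]) simp
    finally show ?thesis .
  qed
qed

text \<open>The determinant does not depend on the nodes \<open>a\<close>; with the points \<open>x\<close> themselves as nodes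
  the matrix is triangular.\<close>

lemma det_newton:
  fixes a x :: "nat \<Rightarrow> real"
  shows "det (mat n n (\<lambda>(i, j). \<Prod>l<n - 1 - i. x j - a l)) = (\<Prod>i<n. \<Prod>j\<in>{i<..<n}. x i - x j)"
proof -
  let ?M = "mat n n (\<lambda>(i, j). \<Prod>l<n - 1 - i. x j - x (n - 1 - l))"
  have "det (mat n n (\<lambda>(i, j). \<Prod>l<n - 1 - i. x j - a l)) = det ?M"
    by (simp only: det_newton_eq_power)
  also have "\<dots> = prod_list (diag_mat ?M)"
  proof (rule det_lower_triangular[of n])
    show "?M $$ (i, j) = 0" if "i < j" "j < n" for i j
      using that by (auto intro!: prod_zero bexI[of _ "n - 1 - j"])
  qed simp
  also have "\<dots> = (\<Prod>i<n. \<Prod>l<n - 1 - i. x i - x (n - 1 - l))"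
    by (simp add: diag_mat_def prod.list_conv_set_nth lessThan_atLeast0)
  also have "\<dots> = (\<Prod>i<n. \<Prod>j\<in>{i<..<n}. x i - x j)"
  proof (rule prod.cong[OF refl])
    fix i assume "i \<in> {..<n}"
    then show "(\<Prod>l<n - 1 - i. x i - x (n - 1 - l)) = (\<Prod>j\<in>{i<..<n}. x i - x j)"
      by (intro prod.reindex_bij_witness[of _ "\<lambda>j. n - 1 - j" "\<lambda>l. n - 1 - l"]) auto
  qed
  finally show ?thesis .
qed

text \<open>Right multiplication by a lower bidiagonal matrix with diagonal 1 and entries
  \<open>- s\<close> below it: every column except the last loses \<open>s\<close> times its
  original right neighbour.\<close>

lemma det_column_operations:
  fixes b f :: "nat \<Rightarrow> nat \<Rightarrow> real"
  assumes "\<And>i j. i \<le> m \<Longrightarrow> j < m \<Longrightarrow> f i j = b i j + s * f i (Suc j)"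
  shows "det (mat (Suc m) (Suc m) (\<lambda>(i, j). f i j)) =
    det (mat (Suc m) (Suc m) (\<lambda>(i, j). if j < m then b i j else f i m))"
proof -
  let ?n = "Suc m"
  let ?v = "\<lambda>l j. if l = j then 1 else if l = Suc j then - s else 0"
  let ?V = "mat ?n ?n (\<lambda>(i, j). ?v i j)" and ?F = "mat ?n ?n (\<lambda>(i, j). f i j)"
  have ev: "(\<Sum>l<?n. f i l * ?v l j) = (if j < m then b i j else f i m)" if "i < ?n" "j < ?n" for i j
  proof -
    have "(\<Sum>l<?n. f i l * ?v l j) =
        (\<Sum>l<?n. if l = j then f i l else 0) + (\<Sum>l<?n. if l = Suc j then - s * f i l else 0)"
      unfolding sum.distrib[symmetric] by (intro sum.cong) auto
    also have "\<dots> = (if j < m then b i j else f i m)"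
      using that assms[of i j] less_antisym[of j m] by (cases "j = m") (auto simp del: sum.lessThan_Suc)
    finally show ?thesis .
  qed
  have "mat ?n ?n (\<lambda>(i, j). if j < m then b i j else f i m) = ?F * ?V"
    using ev by (intro eq_matI)
      (auto simp: scalar_prod_def simp flip: lessThan_atLeast0 simp del: sum.lessThan_Suc sum.atLeast0_lessThan_Suc)
  moreover have "det ?V = prod_list (diag_mat ?V)"
    by (rule det_lower_triangular[of ?n]) auto
  moreover have "diag_mat ?V = map (\<lambda>i. 1) [0..<?n]"
    by (auto simp: diag_mat_def)
  ultimately show ?thesis
    by (simp add: det_mult[of _ ?n] map_replicate_const prod_list_replicate)
qed

lemma det_last_column_sum:
  fixes b :: "nat \<Rightarrow> nat \<Rightarrow> real"
  shows "det (mat (Suc m) (Suc m) (\<lambda>(i, j). if j < m then b i j else \<Sum>k\<in>K. c k * e k i)) =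
    (\<Sum>k\<in>K. c k * det (mat (Suc m) (Suc m) (\<lambda>(i, j). if j < m then b i j else e k i)))"
  unfolding det_mat_col sum_distrib_left
  by (subst sum.swap) (simp add: sum_distrib_left mult_ac)

section \<open>The partition function as an explicit sum, and as a product for contact weight
  2\<close>

lemma prod_upper_triangle_Suc:
  "(\<Prod>i<Suc m. \<Prod>j\<in>{i<..<Suc m}. f i j) = (\<Prod>i<m. \<Prod>j\<in>{i<..<m}. f i j) * (\<Prod>i<m. f i m :: real)"
proof -
  have "{m<..<Suc m} = {}" by auto
  moreover have "(\<Prod>j\<in>{i<..<Suc m}. f i j) = (\<Prod>j\<in>{i<..<m}. f i j) * f i m" if "i < m" for i
  proof -
    have "{i<..<Suc m} = insert m {i<..<m}" using that by auto
    then show ?thesis by (simp add: mult.commute)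
  qed
  ultimately show ?thesis by (simp add: prod.distrib)
qed

text \<open>What the last column, of end height \<open>y + 2 * m + 2 * k\<close>, adds to the ballot
  determinant: its ballot numerator and its Vandermonde differences with the columns
  \<open>i < m\<close>.\<close>

definition end_factor :: "nat \<Rightarrow> nat \<Rightarrow> nat \<Rightarrow> real" where
  "end_factor m y k = (real y + 2 * real m + 2 * real k + 1) *
     (\<Prod>i<m. (real m + real k - real i) * (real y + real i + real m + real k + 1))"

text \<open>The corresponding numerators and differences of the first \<open>m\<close> columns among
  themselves; free of \<open>k\<close>, they leave the sum over \<open>k\<close>.\<close>

definition base_factor :: "nat \<Rightarrow> nat \<Rightarrow> real" where
  "base_factor m y = (\<Prod>j<m. real y + 2 * real j + 1) *
     (\<Prod>i<m. \<Prod>j\<in>{i<..<m}. (real j - real i) * (real y + real i + real j + 1))"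

lemma ballot_det:
  assumes "k \<le> r"
  shows "det (mat (Suc m) (Suc m) (\<lambda>(i, j). if j < m then walk_weight 1 (y + 2 * r + 2 * i) (int y + 2 * int j)
        else walk_weight 1 (y + 2 * r + 2 * i) (int y + 2 * int m + 2 * int k))) =
     (\<Prod>i\<le>m. fact (y + 2 * r + 2 * i)) * (\<Prod>j<m. 1 / (fact (r + m - j) * fact (r + m + y + j + 1))) *
     base_factor m y * (end_factor m y k / (fact (r - k) * fact (r + y + 2 * m + k + 1)))"
proof -
  \<comment> \<open>Column \<open>j\<close> has end height \<open>y + 2 * e j\<close>. The
    hypothesis \<open>k \<le> r\<close> makes every \<open>r + m - e j\<close> a true
    difference.\<close>
  define e where "e = (\<lambda>j. if j < m then j else m + k)"
  define x where "x = (\<lambda>j. real (r + m - e j) * real (r + m + y + e j + 1))"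
  define d where "d = (\<lambda>j. (real (y + 2 * e j) + 1) / (fact (r + m - e j) * fact (r + m + y + e j + 1)))"
  define \<tau> where "\<tau> = y + 2 * r + 2 * m"
  have e: "e j \<le> r + m" if "j \<le> m" for j using that assms by (auto simp: e_def)
  have "det (mat (Suc m) (Suc m) (\<lambda>(i, j). if j < m then walk_weight 1 (y + 2 * r + 2 * i) (int y + 2 * int j)
        else walk_weight 1 (y + 2 * r + 2 * i) (int y + 2 * int m + 2 * int k))) =
    det (mat (Suc m) (Suc m) (\<lambda>(i, j). fact (y + 2 * r + 2 * i) * d j *
        (\<Prod>l<Suc m - 1 - i. x j - real l * (real \<tau> + 1 - real l))))"
  proof (rule det_mat_cong)
    fix i j assume ij: "i < Suc m" "j < Suc m"
    have 1: "\<tau> = (y + 2 * e j) + 2 * (r + m - e j)" using e[of j] ij by (simp add: \<tau>_def)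
    have 2: "y + 2 * r + 2 * i = \<tau> - 2 * (m - i)" "2 * (m - i) \<le> \<tau>" using ij by (auto simp: \<tau>_def)
    have 3: "y + 2 * e j + (r + m - e j) = r + m + y + e j" using e[of j] ij by simp
    have "(if j < m then walk_weight 1 (y + 2 * r + 2 * i) (int y + 2 * int j)
        else walk_weight 1 (y + 2 * r + 2 * i) (int y + 2 * int m + 2 * int k))
      = walk_weight 1 (\<tau> - 2 * (m - i)) (int (y + 2 * e j))"
      unfolding 2(1)[symmetric] using ij less_antisym[of j m] by (auto simp: e_def algebra_simps)
    also have "\<dots> = fact (y + 2 * r + 2 * i) * d j *
        (\<Prod>l<Suc m - 1 - i. x j - real l * (real \<tau> + 1 - real l))"
      unfolding walk_weight_1_newton[OF 1 2(2)] 3 unfolding 2(1)[symmetric] d_def x_def by simp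
    finally show "(if j < m then walk_weight 1 (y + 2 * r + 2 * i) (int y + 2 * int j)
        else walk_weight 1 (y + 2 * r + 2 * i) (int y + 2 * int m + 2 * int k)) = \<dots>" .
  qed
  also have "\<dots> = (\<Prod>i<Suc m. fact (y + 2 * r + 2 * i)) * (\<Prod>j<Suc m. d j) *
      (\<Prod>i<Suc m. \<Prod>j\<in>{i<..<Suc m}. x i - x j)"
    by (simp only: det_scale det_newton)
  also have "(\<Prod>j<Suc m. d j) = (\<Prod>j<m. real y + 2 * real j + 1) *
      (\<Prod>j<m. 1 / (fact (r + m - j) * fact (r + m + y + j + 1))) *
      ((real y + 2 * real m + 2 * real k + 1) / (fact (r - k) * fact (r + y + 2 * m + k + 1)))"
  proof -
    have "(\<Prod>j<m. d j) = (\<Prod>j<m. (real y + 2 * real j + 1) * (1 / (fact (r + m - j) * fact (r + m + y + j + 1))))"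
      by (intro prod.cong) (auto simp: d_def e_def)
    moreover have "d m = (real y + 2 * real m + 2 * real k + 1) / (fact (r - k) * fact (r + y + 2 * m + k + 1))"
    proof -
      have "r + m - e m = r - k" "r + m + y + e m + 1 = r + y + 2 * m + k + 1"
        "real (y + 2 * e m) + 1 = real y + 2 * real m + 2 * real k + 1"
        by (simp_all add: e_def)
      then show ?thesis by (simp only: d_def)
    qed
    ultimately show ?thesis by (simp only: prod.lessThan_Suc prod.distrib)
  qed
  also have "(\<Prod>i<Suc m. \<Prod>j\<in>{i<..<Suc m}. x i - x j) =
     (\<Prod>i<m. \<Prod>j\<in>{i<..<m}. (real j - real i) * (real y + real i + real j + 1)) *
     (\<Prod>i<m. (real m + real k - real i) * (real y + real i + real m + real k + 1))"
  proof -
    \<comment> \<open>As a function of \<open>e j\<close>, \<open>x j\<close> is a constant minus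
      \<open>e j * (e j + y + 1)\<close>; the difference of two such values factors.\<close>
    have x: "x i - x j = (real (e j) - real (e i)) * (real y + real (e i) + real (e j) + 1)"
      if "i \<le> m" "j \<le> m" for i j
      using e[OF that(1)] e[OF that(2)] by (simp add: x_def of_nat_diff algebra_simps)
    show ?thesis unfolding prod_upper_triangle_Suc
      by (intro arg_cong2[where f="(*)"] prod.cong) (auto simp: x, auto simp: e_def)
  qed
  finally show ?thesis
    by (simp add: base_factor_def end_factor_def lessThan_Suc_atMost mult_ac del: fact_Suc)
qed

lemma Z_walk_det: "\<kappa> ^ m * Z (Suc m) (y + 2 * r) y \<kappa> = walk_det \<kappa> (Suc m) (y + 2 * r) (\<lambda>j. int y + 2 * int j)"
  unfolding Z_eq_family_weight
  using family_weight_eq_walk_det[of "Suc m" "\<lambda>j. int y + 2 * int j" "int y mod 2" \<kappa> "y + 2 * r"] by simp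

text \<open>After the column operations every column carries a factor \<open>\<kappa>\<close>. Of
  these \<open>m + 1\<close> factors, \<open>m\<close> pay for moving the start points back to the
  axis, and one remains.\<close>

theorem Z_formula:
  assumes "\<kappa> \<noteq> 0"
  shows "Z (Suc m) (y + 2 * r) y \<kappa> = \<kappa> * (\<Prod>i\<le>m. fact (y + 2 * r + 2 * i)) *
    (\<Prod>j<m. 1 / (fact (r + m - j) * fact (r + m + y + j + 1))) * base_factor m y *
    (\<Sum>k\<le>r. (\<kappa> - 1) ^ k * (end_factor m y k / (fact (r - k) * fact (r + y + 2 * m + k + 1))))"
proof -
  let ?t = "y + 2 * r" and ?n = "Suc m"
  let ?g = "\<lambda>i j. walk_weight 1 (?t + 2 * i) (int y + 2 * int j)"
  let ?e = "\<lambda>k i. walk_weight 1 (?t + 2 * i) (int y + 2 * int m + 2 * int k)"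
  have "\<kappa> ^ m * Z ?n ?t y \<kappa> =
      det (mat ?n ?n (\<lambda>(i, j). walk_weight \<kappa> (?t + 2 * i) (int y + 2 * int j)))"
    unfolding Z_walk_det walk_det_def ..
  also have "\<dots> = det (mat ?n ?n (\<lambda>(i, j). if j < m then \<kappa> * ?g i j
      else walk_weight \<kappa> (?t + 2 * i) (int y + 2 * int m)))"
    by (rule det_column_operations[where s="\<kappa> - 1"], subst walk_weight_recurrence)
       (simp_all add: algebra_simps)
  also have "\<dots> = det (mat ?n ?n (\<lambda>(i, j). if j < m then \<kappa> * ?g i j
      else \<Sum>k\<le>r. (\<kappa> - 1) ^ k * (\<kappa> * ?e k i)))"
  proof (rule det_mat_cong)
    fix i j assume "i < ?n"
    \<comment> \<open>Row \<open>i\<close> has length \<open>y + 2 * r + 2 * i\<close>, less than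
      \<open>y + 2 * m + 2 * (r + 1)\<close> for \<open>i \<le> m\<close>, so the geometric sum may
      stop at \<open>r\<close> in all rows at once.\<close>
    then have "walk_weight \<kappa> (?t + 2 * i) (int y + 2 * int m) = (\<Sum>k\<le>r. (\<kappa> - 1) ^ k * (\<kappa> * ?e k i))"
      by (intro walk_weight_geometric) auto
    then show "(if j < m then \<kappa> * ?g i j else walk_weight \<kappa> (?t + 2 * i) (int y + 2 * int m)) =
      (if j < m then \<kappa> * ?g i j else \<Sum>k\<le>r. (\<kappa> - 1) ^ k * (\<kappa> * ?e k i))" by simp
  qed
  also have "\<dots> = (\<Sum>k\<le>r. (\<kappa> - 1) ^ k *
      det (mat ?n ?n (\<lambda>(i, j). if j < m then \<kappa> * ?g i j else \<kappa> * ?e k i)))"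
    by (rule det_last_column_sum)
  also have "\<dots> = (\<Sum>k\<le>r. (\<kappa> - 1) ^ k * (\<kappa> ^ ?n *
      det (mat ?n ?n (\<lambda>(i, j). if j < m then ?g i j else ?e k i))))"
  proof (intro sum.cong refl arg_cong2[where f="(*)"])
    fix k
    have "det (mat ?n ?n (\<lambda>(i, j). if j < m then \<kappa> * ?g i j else \<kappa> * ?e k i)) =
        det (mat ?n ?n (\<lambda>(i, j). 1 * \<kappa> * (if j < m then ?g i j else ?e k i)))"
      by (rule det_mat_cong) simp
    then show "det (mat ?n ?n (\<lambda>(i, j). if j < m then \<kappa> * ?g i j else \<kappa> * ?e k i)) =
        \<kappa> ^ ?n * det (mat ?n ?n (\<lambda>(i, j). if j < m then ?g i j else ?e k i))"
      by (simp only: det_scale) simp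
  qed
  also have "\<dots> = \<kappa> ^ m * (\<kappa> * (\<Prod>i\<le>m. fact (y + 2 * r + 2 * i)) *
    (\<Prod>j<m. 1 / (fact (r + m - j) * fact (r + m + y + j + 1))) * base_factor m y *
    (\<Sum>k\<le>r. (\<kappa> - 1) ^ k * (end_factor m y k / (fact (r - k) * fact (r + y + 2 * m + k + 1)))))"
    unfolding sum_distrib_left
    by (intro sum.cong refl) (subst ballot_det, simp, simp only: power_Suc mult_ac)
  finally show ?thesis using assms by simp
qed

text \<open>No column operation is needed: all entries are twice a binomial coefficient and have
  Newton form already. The columns give \<open>2 ^ Suc m\<close>, of which \<open>2 ^ m\<close>
  cancels.\<close>

theorem Z_2_formula:
  "Z (Suc m) (y + 2 * r) y 2 = 2 * (\<Prod>i\<le>m. fact (y + 2 * r + 2 * i)) *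
    (\<Prod>j\<le>m. 1 / (fact (r + m - j) * fact (r + m + y + j))) *
    (\<Prod>i\<le>m. \<Prod>j\<in>{i<..m}. (real j - real i) * (real y + real i + real j))"
proof -
  let ?n = "Suc m"
  define x where "x = (\<lambda>j. real (r + m - j) * real (r + m + y + j))"
  define d where "d = (\<lambda>j. 2 / (fact (r + m - j) * fact (r + m + y + j)) :: real)"
  define \<tau> where "\<tau> = y + 2 * r + 2 * m"
  have "2 ^ m * Z ?n (y + 2 * r) y 2 =
      det (mat ?n ?n (\<lambda>(i, j). walk_weight 2 (y + 2 * r + 2 * i) (int y + 2 * int j)))"
    unfolding Z_walk_det walk_det_def ..
  also have "\<dots> = det (mat ?n ?n (\<lambda>(i, j). fact (y + 2 * r + 2 * i) * d j *
        (\<Prod>l<?n - 1 - i. x j - real l * (real \<tau> - real l))))"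
  proof (rule det_mat_cong)
    fix i j assume ij: "i < ?n" "j < ?n"
    have 1: "\<tau> = (y + 2 * j) + 2 * (r + m - j)" using ij by (simp add: \<tau>_def)
    have 2: "y + 2 * r + 2 * i = \<tau> - 2 * (m - i)" "2 * (m - i) \<le> \<tau>" using ij by (auto simp: \<tau>_def)
    have 3: "y + 2 * j + (r + m - j) = r + m + y + j" using ij by simp
    have "walk_weight 2 (y + 2 * r + 2 * i) (int y + 2 * int j)
      = walk_weight 2 (\<tau> - 2 * (m - i)) (int (y + 2 * j))"
      unfolding 2(1)[symmetric] by simp
    also have "\<dots> = fact (y + 2 * r + 2 * i) * d j *
        (\<Prod>l<?n - 1 - i. x j - real l * (real \<tau> - real l))"
      unfolding walk_weight_2_newton[OF 1 2(2)] 3 unfolding 2(1)[symmetric] d_def x_def by simp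
    finally show "walk_weight 2 (y + 2 * r + 2 * i) (int y + 2 * int j) = \<dots>" .
  qed
  also have "\<dots> = (\<Prod>i<?n. fact (y + 2 * r + 2 * i)) * (\<Prod>j<?n. d j) *
      (\<Prod>i<?n. \<Prod>j\<in>{i<..<?n}. x i - x j)"
    by (simp only: det_scale det_newton)
  also have "(\<Prod>i<?n. \<Prod>j\<in>{i<..<?n}. x i - x j) =
      (\<Prod>i<?n. \<Prod>j\<in>{i<..<?n}. (real j - real i) * (real y + real i + real j))"
    by (intro prod.cong refl) (auto simp: x_def of_nat_diff algebra_simps)
  also have "(\<Prod>j<?n. d j) = 2 ^ ?n * (\<Prod>j<?n. 1 / (fact (r + m - j) * fact (r + m + y + j)))"
  proof -
    have "(\<Prod>j<?n. d j) = (\<Prod>j<?n. 2 * (1 / (fact (r + m - j) * fact (r + m + y + j))))"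
      by (simp add: d_def)
    then show ?thesis by (simp only: prod.distrib prod_constant card_lessThan)
  qed
  finally have "2 ^ m * Z ?n (y + 2 * r) y 2 = 2 ^ m * (2 * (\<Prod>i<?n. fact (y + 2 * r + 2 * i)) *
    (\<Prod>j<?n. 1 / (fact (r + m - j) * fact (r + m + y + j))) *
    (\<Prod>i<?n. \<Prod>j\<in>{i<..<?n}. (real j - real i) * (real y + real i + real j)))"
    by (simp only: power_Suc mult_ac)
  moreover have "{i<..<Suc m} = {i<..m}" for i by auto
  ultimately show ?thesis by (simp add: lessThan_Suc_atMost)
qed

section \<open>Factorial asymptotics\<close>

text \<open>Rates are measured in the index \<open>r\<close> of \<open>t = y + 2 * r\<close>. This
  builds the parity condition into the parametrisation and keeps all factorial arguments natural
  numbers.\<close>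

definition near_one :: "(nat \<Rightarrow> real) \<Rightarrow> bool" where
  "near_one u \<longleftrightarrow> (\<lambda>r. u r - 1) \<in> O(\<lambda>r. 1 / real r)"

lemma near_one_1: "near_one (\<lambda>_. 1)"
  by (simp add: near_one_def)

lemma near_one_mult:
  assumes "near_one u" "near_one v"
  shows "near_one (\<lambda>r. u r * v r)"
proof -
  have "(\<lambda>r. (u r - 1) * (v r - 1)) \<in> O(\<lambda>r. 1 / real r * (1 / real r))"
    using assms by (intro landau_o.big.mult) (simp_all add: near_one_def)
  also have "(\<lambda>r::nat. 1 / real r * (1 / real r)) \<in> O(\<lambda>r. 1 / real r)"
    by real_asymp
  finally have "(\<lambda>r. (u r - 1) * (v r - 1)) \<in> O(\<lambda>r. 1 / real r)" .
  from sum_in_bigo(1)[OF this sum_in_bigo(1)[OF assms[unfolded near_one_def]]]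
  show ?thesis by (simp add: near_one_def algebra_simps)
qed

lemma near_one_prod: "(\<And>i. i \<in> A \<Longrightarrow> near_one (u i)) \<Longrightarrow> near_one (\<lambda>r. \<Prod>i\<in>A. u i r)"
  by (induction A rule: infinite_finite_induct) (auto intro!: near_one_mult near_one_1)

lemma near_one_power: "near_one u \<Longrightarrow> near_one (\<lambda>r. u r ^ k)"
  by (induction k) (auto intro!: near_one_mult near_one_1)

lemma near_one_tendsto:
  assumes "near_one u"
  shows "u \<longlonglongrightarrow> 1"
proof -
  have "(\<lambda>r. u r - 1) \<in> O(\<lambda>r. 1 / real r)" using assms by (simp add: near_one_def)
  also have "(\<lambda>r. 1 / real r) \<in> o(\<lambda>_. 1 :: real)" by real_asymp
  finally have "(\<lambda>r. u r - 1) \<longlonglongrightarrow> 0" by (auto dest: smalloD_tendsto)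
  then show ?thesis by (simp add: LIM_zero_iff)
qed

lemma near_one_inverse:
  assumes "near_one u"
  shows "near_one (\<lambda>r. inverse (u r))"
proof -
  have "eventually (\<lambda>r. u r > 1 / 2) sequentially"
    using near_one_tendsto[OF assms] by (rule order_tendstoD) simp
  then have "eventually (\<lambda>r. norm (inverse (u r) - 1) \<le> 2 * norm (u r - 1)) sequentially"
  proof eventually_elim
    case (elim r)
    have "inverse (u r) - 1 = (1 - u r) / u r" using elim by (simp add: field_simps)
    then have "norm (inverse (u r) - 1) = norm (u r - 1) / u r"
      using elim by (simp add: abs_minus_commute)
    also have "\<dots> \<le> norm (u r - 1) / (1 / 2)"
      using elim by (intro divide_left_mono) auto
    finally show ?case by simp
  qed
  then have "(\<lambda>r. inverse (u r) - 1) \<in> O(\<lambda>r. u r - 1)" by (rule bigoI)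
  also have "(\<lambda>r. u r - 1) \<in> O(\<lambda>r. 1 / real r)" using assms by (simp add: near_one_def)
  finally show ?thesis by (simp add: near_one_def)
qed

lemma near_one_divide: "near_one u \<Longrightarrow> near_one v \<Longrightarrow> near_one (\<lambda>r. u r / v r)"
  using near_one_mult[OF _ near_one_inverse] by (simp add: divide_inverse)

lemma near_one_sqrt:
  assumes "near_one u"
  shows "near_one (\<lambda>r. sqrt (u r))"
proof -
  have "eventually (\<lambda>r. u r > 0) sequentially"
    using near_one_tendsto[OF assms] by (rule order_tendstoD) simp
  then have "eventually (\<lambda>r. norm (sqrt (u r) - 1) \<le> 1 * norm (u r - 1)) sequentially"
  proof eventually_elim
    case (elim r)
    have "u r - 1 = (sqrt (u r) - 1) * (sqrt (u r) + 1)"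
      using elim by (simp add: algebra_simps)
    then have "norm (u r - 1) = norm (sqrt (u r) - 1) * (sqrt (u r) + 1)"
      using elim by (simp add: abs_mult)
    moreover have "norm (sqrt (u r) - 1) * 1 \<le> norm (sqrt (u r) - 1) * (sqrt (u r) + 1)"
      using elim by (intro mult_left_mono) auto
    ultimately show ?case by simp
  qed
  then have "(\<lambda>r. sqrt (u r) - 1) \<in> O(\<lambda>r. u r - 1)" by (rule bigoI)
  also have "(\<lambda>r. u r - 1) \<in> O(\<lambda>r. 1 / real r)" using assms by (simp add: near_one_def)
  finally show ?thesis by (simp add: near_one_def)
qed

lemma near_one_bound:
  assumes "\<And>r. r \<ge> 1 \<Longrightarrow> \<bar>u r - 1\<bar> \<le> C / real r"
  shows "near_one u"
  unfolding near_one_def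
  by (rule bigoI[of _ C], rule eventually_sequentiallyI[of 1]) (use assms in auto)

lemma near_one_linear:
  assumes "b \<ge> 0"
  shows "near_one (\<lambda>r. (real r + a) / (real r + b))"
proof (rule near_one_bound)
  fix r :: nat assume "r \<ge> 1"
  then have "(real r + a) / (real r + b) - 1 = (a - b) / (real r + b)"
    using assms by (simp add: field_simps)
  moreover have "\<bar>a - b\<bar> / (real r + b) \<le> \<bar>a - b\<bar> / real r"
    using assms \<open>r \<ge> 1\<close> by (intro divide_left_mono) auto
  ultimately show "\<bar>(real r + a) / (real r + b) - 1\<bar> \<le> \<bar>a - b\<bar> / real r"
    using assms \<open>r \<ge> 1\<close> by simp
qed

lemma near_one_linear_prod:
  assumes "b \<ge> 0"
  shows "near_one (\<lambda>r. (\<Prod>l<(k::nat). real r + a l) / (real r + b) ^ k)"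
proof -
  have "(\<Prod>l<k. real r + a l) / (real r + b) ^ k = (\<Prod>l<k. (real r + a l) / (real r + b))" for r
    by (simp add: prod_dividef)
  then show ?thesis using near_one_prod[of "{..<k}" "\<lambda>l r. (real r + a l) / (real r + b)"]
      near_one_linear[OF assms] by simp
qed

lemma fact_add_prod: "fact (n + k) = fact n * (\<Prod>l<k. real n + real l + 1)"
  by (induction k) (simp_all add: algebra_simps)

section \<open>Wallis' product with a rate, and quotients of factorials\<close>

lemma wallis_denominator_pos: "k \<ge> 1 \<Longrightarrow> 4 * real k ^ 2 - 1 > 0"
proof -
  assume "k \<ge> 1"
  then have "1 \<le> real k ^ 2" by (intro one_le_power) simp
  then show ?thesis by linarith
qed

text \<open>Cleared of denominators: the partial product is 16^n divided by \<open>2 * n + 1\<close>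
  and by the square of the central binomial coefficient.\<close>

lemma wallis_prod_eq:
  "(\<Prod>k=1..n. (4 * real k ^ 2) / (4 * real k ^ 2 - 1)) * (2 * real n + 1) * fact (2 * n) ^ 2
    = 16 ^ n * fact n ^ 4"
proof (induction n)
  case (Suc n)
  let ?W = "\<Prod>k=1..n. (4 * real k ^ 2) / (4 * real k ^ 2 - 1)"
  have ne: "4 * real (Suc n) ^ 2 - 1 = (2 * real n + 1) * (2 * real n + 3)"
    by (simp add: power2_eq_square algebra_simps)
  have f: "fact (2 * Suc n) = (2 * real n + 2) * (2 * real n + 1) * fact (2 * n)"
    by (simp add: algebra_simps)
  have "(\<Prod>k=1..Suc n. (4 * real k ^ 2) / (4 * real k ^ 2 - 1)) * (2 * real (Suc n) + 1) * fact (2 * Suc n) ^ 2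
    = ?W * (4 * real (Suc n) ^ 2 / ((2 * real n + 1) * (2 * real n + 3))) * (2 * real n + 3)
      * ((2 * real n + 2) * (2 * real n + 1) * fact (2 * n)) ^ 2"
  proof -
    have "(\<Prod>k=1..Suc n. (4 * real k ^ 2) / (4 * real k ^ 2 - 1)) =
        ?W * (4 * real (Suc n) ^ 2 / ((2 * real n + 1) * (2 * real n + 3)))"
      unfolding ne[symmetric] by simp
    moreover have "2 * real (Suc n) + 1 = 2 * real n + 3" by simp
    ultimately show ?thesis by (simp only: f)
  qed
  also have "\<dots> = (?W * (2 * real n + 1) * fact (2 * n) ^ 2) * (16 * real (Suc n) ^ 4)"
    by (simp add: divide_simps) (simp add: power2_eq_square power4_eq_xxxx algebra_simps)
  also have "\<dots> = 16 ^ Suc n * fact (Suc n) ^ 4"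
    unfolding Suc.IH by (simp add: power_mult_distrib)
  finally show ?case .
qed simp

lemma wallis_prod_le: "(\<Prod>k=1..n. (4 * real k ^ 2) / (4 * real k ^ 2 - 1)) \<le> pi / 2"
proof (rule incseq_le[OF _ wallis], rule incseq_SucI)
  fix n
  let ?W = "\<lambda>n. \<Prod>k=1..n. (4 * real k ^ 2) / (4 * real k ^ 2 - 1)"
  have "?W n \<ge> 0"
  proof (rule prod_nonneg, rule divide_nonneg_nonneg)
    show "0 \<le> 4 * real k ^ 2 - 1" if "k \<in> {1..n}" for k
      using wallis_denominator_pos[of k] that by simp
  qed simp
  moreover have "4 * real (Suc n) ^ 2 - 1 > 0" by (rule wallis_denominator_pos) simp
  then have "1 \<le> (4 * real (Suc n) ^ 2) / (4 * real (Suc n) ^ 2 - 1)"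
    by (subst le_divide_eq_1_pos) simp_all
  ultimately have "?W n * 1 \<le> ?W n * ((4 * real (Suc n) ^ 2) / (4 * real (Suc n) ^ 2 - 1))"
    by (intro mult_left_mono)
  then show "?W n \<le> ?W (Suc n)" by simp
qed

text \<open>The extra factor turns the increasing partial products into a decreasing sequence with
  the same limit. With \<open>wallis_prod_le\<close> this encloses the product up to a factor 1 + 1
  / (2 n).\<close>

lemma wallis_prod_ge:
  assumes "n \<ge> 1"
  shows "pi / 2 \<le> (\<Prod>k=1..n. (4 * real k ^ 2) / (4 * real k ^ 2 - 1)) * ((2 * real n + 1) / (2 * real n))"
proof -
  let ?W = "\<lambda>n. \<Prod>k=1..n. (4 * real k ^ 2) / (4 * real k ^ 2 - 1)"
  \<comment> \<open>The shift to \<open>Suc n\<close> avoids the zero denominator at 0.\<close>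
  let ?V = "\<lambda>n. ?W (Suc n) * ((2 * real (Suc n) + 1) / (2 * real (Suc n)))"
  have "(\<lambda>n. (2 * real (Suc n) + 1) / (2 * real (Suc n))) \<longlonglongrightarrow> 1"
    by real_asymp
  then have lim: "?V \<longlonglongrightarrow> pi / 2 * 1"
    by (intro tendsto_mult LIMSEQ_Suc[OF wallis])
  have "decseq ?V"
  proof (rule decseq_SucI)
    fix n
    define x where "x = real (Suc n)"
    have x: "x \<ge> 1" "real (Suc (Suc n)) = x + 1" by (simp_all add: x_def)
    have W0: "?W (Suc n) \<ge> 0"
    proof (rule prod_nonneg, rule divide_nonneg_nonneg)
      show "0 \<le> 4 * real k ^ 2 - 1" if "k \<in> {1..Suc n}" for k
        using wallis_denominator_pos[of k] that by simp
    qed simp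
    have e: "4 * (x + 1) ^ 2 - 1 = (2 * x + 1) * (2 * x + 3)" by (simp add: power2_eq_square algebra_simps)
    have "(4 * (x + 1) ^ 2) / (4 * (x + 1) ^ 2 - 1) * ((2 * (x + 1) + 1) / (2 * (x + 1))) = 2 * (x + 1) / (2 * x + 1)"
      unfolding e using x(1) by (simp add: divide_simps) (simp add: power2_eq_square algebra_simps)
    also have "\<dots> \<le> (2 * x + 1) / (2 * x)"
      using x(1) by (simp add: divide_simps) (simp add: algebra_simps)
    finally have "(4 * (x + 1) ^ 2) / (4 * (x + 1) ^ 2 - 1) * ((2 * (x + 1) + 1) / (2 * (x + 1)))
        \<le> (2 * x + 1) / (2 * x)" .
    from mult_left_mono[OF this W0] show "?V (Suc n) \<le> ?V n"
      by (simp add: x_def[symmetric] x(2) mult.assoc del: of_nat_Suc)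
  qed
  from decseq_ge[OF this, of "pi / 2"] lim have "pi / 2 \<le> ?V (n - 1)" by simp
  with assms show ?thesis by simp
qed

text \<open>The square of the expression is \<open>pi * r / (W * (2 * r + 1))\<close> for the Wallis
  product \<open>W\<close>; the two bounds on \<open>W\<close> place it between
  \<open>1 - 1 / r\<close> and 1.\<close>

lemma central_factorial_near_one:
  "near_one (\<lambda>r. fact (2 * r) / (fact r) ^ 2 * sqrt (pi * real r) / 4 ^ r)"
proof -
  let ?v = "\<lambda>r::nat. fact (2 * r) / (fact r) ^ 2 * sqrt (pi * real r) / 4 ^ r"
  have "near_one (\<lambda>r. ?v r ^ 2)"
  proof (rule near_one_bound[of _ 1])
    fix r :: nat assume r: "r \<ge> 1"
    define W where "W = (\<Prod>k=1..r. (4 * real k ^ 2) / (4 * real k ^ 2 - 1))"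
    have eq: "W * (2 * real r + 1) * fact (2 * r) ^ 2 = 16 ^ r * fact r ^ 4"
      unfolding W_def by (rule wallis_prod_eq)
    have "pi / 2 > 0" by simp
    also have "pi / 2 \<le> W * ((2 * real r + 1) / (2 * real r))"
      unfolding W_def by (rule wallis_prod_ge[OF r])
    finally have W: "W > 0" by (rule zero_less_mult_pos2) (use r in simp)
    have "?v r ^ 2 = fact (2 * r) ^ 2 * (pi * real r) / (16 ^ r * fact r ^ 4)"
      by (simp add: power_mult_distrib power_divide flip: power_mult)
         (simp add: power_mult mult.commute[of r])
    also have "\<dots> = pi * real r / (W * (2 * real r + 1))"
      unfolding eq[symmetric] by (subst mult.commute[of "fact (2 * r) ^ 2"]) simp
    finally have v: "?v r ^ 2 = pi * real r / (W * (2 * real r + 1))" .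
    have "?v r ^ 2 \<le> 1"
      unfolding v
    proof (subst divide_le_eq_1_pos)
      show pos: "0 < W * (2 * real r + 1)" using W by simp
      show "pi * real r \<le> W * (2 * real r + 1)"
        using wallis_prod_ge[OF r] r unfolding W_def[symmetric] by (simp add: field_simps)
    qed
    moreover have "1 - 1 / real r \<le> ?v r ^ 2"
    proof -
      have "1 - 1 / real r \<le> 2 * real r / (2 * real r + 1)"
        using r by (simp add: field_simps)
      also have "\<dots> \<le> pi * real r / (W * (2 * real r + 1))"
      proof -
        have "2 * real r / (2 * real r + 1) = 2 * real r * W / (W * (2 * real r + 1))"
          using W by simp
        also have "2 * real r * W \<le> pi * real r"
          using mult_left_mono[OF wallis_prod_le[of r], of "2 * real r"] unfolding W_def[symmetric]
          by (simp add: mult.commute)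
        then have "2 * real r * W / (W * (2 * real r + 1)) \<le> pi * real r / (W * (2 * real r + 1))"
          using W by (intro divide_right_mono) auto
        finally show ?thesis .
      qed
      finally show ?thesis unfolding v .
    qed
    ultimately show "\<bar>?v r ^ 2 - 1\<bar> \<le> 1 / real r" by linarith
  qed
  from near_one_sqrt[OF this] show ?thesis by simp
qed

text \<open>The quotient is the central binomial coefficient times a fixed number of factors linear
  in \<open>r\<close>. Each of these is compared with \<open>r + y / 2\<close>, half of
  \<open>t\<close>, or with \<open>t\<close> itself.\<close>

lemma fact_quotient_asymp:
  obtains u where "near_one u"
    and "\<And>r. r \<ge> 1 \<Longrightarrow> fact (y + 2 * r + c) / (fact (r + a) * fact (r + y + b)) =
      2 ^ (y + 2 * r) * sqrt (2 / (pi * real (y + 2 * r))) * real (y + 2 * r) ^ c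
        * (2 / real (y + 2 * r)) ^ (a + b) * u r"
proof -
  let ?x = "\<lambda>r. real r + real y / 2"
  define p where "p = (\<lambda>k s r. (\<Prod>l<k. real r + (s + real l + 1)) / ?x r ^ k)"
  define p2 where "p2 = (\<lambda>k s r. (\<Prod>l<k. real r + (s + real l + 1) / 2) / ?x r ^ k)"
  define v where "v = (\<lambda>r::nat. fact (2 * r) / (fact r) ^ 2 * sqrt (pi * real r) / 4 ^ r)"
  define u where "u = (\<lambda>r. v r * sqrt (?x r / real r) * p2 y 0 r * p2 c y r
    / (p y 0 r * p a 0 r * p b y r))"
  have lin: "near_one (\<lambda>r. ?x r / real r)"
    using near_one_linear[of 0 "real y / 2"] by simp
  have np: "near_one (p k s)" for k s
    unfolding p_def by (rule near_one_linear_prod) simp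
  have np2: "near_one (p2 k s)" for k s
    unfolding p2_def by (rule near_one_linear_prod) simp
  have "near_one u"
    unfolding u_def v_def
    by (intro near_one_divide near_one_mult central_factorial_near_one near_one_sqrt lin np np2)
  moreover have "fact (y + 2 * r + c) / (fact (r + a) * fact (r + y + b)) =
      2 ^ (y + 2 * r) * sqrt (2 / (pi * real (y + 2 * r))) * real (y + 2 * r) ^ c
        * (2 / real (y + 2 * r)) ^ (a + b) * u r" if r: "r \<ge> 1" for r
  proof -
    define X where "X = ?x r"
    have X: "X > 0" "real (y + 2 * r) = 2 * X" using r by (simp_all add: X_def)
    have F1: "fact (n + k) = fact n * (p k s r * X ^ k)" if "n = r + d" "s = real d" for n k d s
    proof -
      have "(\<Prod>l<k. real n + real l + 1) = p k s r * X ^ k"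
        using X(1) that by (simp add: p_def X_def add_ac)
      then show ?thesis by (simp only: fact_add_prod)
    qed
    have F2: "fact (n + k) = fact n * (p2 k s r * (2 * X) ^ k)" if "n = 2 * r + d" "s = real d" for n k d s
    proof -
      have "(\<Prod>l<k. real n + real l + 1) = (\<Prod>l<k. 2 * (real r + (s + real l + 1) / 2))"
        using that by (intro prod.cong) (auto simp: field_simps)
      also have "\<dots> = p2 k s r * (2 * X) ^ k"
        using X(1) unfolding prod.distrib by (simp add: p2_def X_def[symmetric] power_mult_distrib)
      finally show ?thesis by (simp add: fact_add_prod)
    qed
    have a: "fact (r + a) = fact r * (p a 0 r * X ^ a)" by (rule F1[where d=0]) auto
    have b: "fact (r + y + b) = fact r * (p y 0 r * X ^ y) * (p b y r * X ^ b)"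
      using F1[of r 0 0 y] F1[of "r + y" y y b] by simp
    have c: "fact (y + 2 * r + c) = fact (2 * r) * (p2 y 0 r * (2 * X) ^ y) * (p2 c y r * (2 * X) ^ c)"
      using F2[of "2 * r" 0 0 y] F2[of "2 * r + y" y y c] by (simp add: add_ac)
    \<comment> \<open>Exchanges the root belonging to the central binomial coefficient for the
      claimed one, as \<open>t = 2 * X\<close>.\<close>
    have sq: "sqrt (pi * real r) * sqrt (X / real r) * sqrt (2 / (pi * (2 * X))) = 1"
      using r X(1) by (simp flip: real_sqrt_mult)
    have pos: "p k s r > 0" if "s \<ge> 0" for k s
      using X(1) that r by (auto simp: p_def X_def intro!: divide_pos_pos prod_pos)
    have "2 ^ (y + 2 * r) * sqrt (2 / (pi * (2 * X))) * (2 * X) ^ c * (2 / (2 * X)) ^ (a + b) * u r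
      = (sqrt (pi * real r) * sqrt (X / real r) * sqrt (2 / (pi * (2 * X)))) *
        (2 ^ y * 4 ^ r * (2 * X) ^ c / X ^ (a + b) * (fact (2 * r) / (fact r) ^ 2 / 4 ^ r * p2 y 0 r * p2 c y r
          / (p y 0 r * p a 0 r * p b y r)))"
      using X(1) by (simp add: u_def v_def X_def[symmetric] power_add power_mult power_divide)
    also have "\<dots> = fact (y + 2 * r + c) / (fact (r + a) * fact (r + y + b))"
      unfolding sq a b c using X(1) pos[of 0 y] pos[of 0 a] pos[of y b]
      by (simp add: field_simps power_add power_mult_distrib power2_eq_square)
    finally show ?thesis unfolding X(2) ..
  qed
  ultimately show ?thesis by (rule that)
qed

text \<open>In the exponent of \<open>t\<close>, the powers \<open>2 * j\<close> sum to
  \<open>M * (M - 1)\<close>, the square roots contribute \<open>- M / 2\<close>, and the constant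
  sum \<open>D\<close> contributes \<open>- M * D\<close>.\<close>

lemma fact_quotient_prod_asymp:
  assumes "\<And>j. j < M \<Longrightarrow> a j + b j = D"
  obtains u where "near_one u"
    and "\<And>r. r \<ge> 1 \<Longrightarrow> (\<Prod>j<M. fact (y + 2 * r + 2 * j) / (fact (r + a j) * fact (r + y + b j))) =
      2 ^ (M * (y + 2 * r)) * real (y + 2 * r) powr (real M * (real M - 1) - real M / 2 - real M * real D)
        * 2 powr (real M / 2 + real M * real D) * pi powr (- (real M / 2)) * u r"
proof -
  have "\<exists>u. near_one u \<and> (\<forall>r\<ge>1. fact (y + 2 * r + 2 * j) / (fact (r + a j) * fact (r + y + b j)) =
      2 ^ (y + 2 * r) * sqrt (2 / (pi * real (y + 2 * r))) * real (y + 2 * r) ^ (2 * j)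
        * (2 / real (y + 2 * r)) ^ (a j + b j) * u r)" for j
    by (rule fact_quotient_asymp[of y "2 * j" "a j" "b j"]) blast
  then obtain u where u: "\<And>j. near_one (u j)"
    "\<And>j r. r \<ge> 1 \<Longrightarrow> fact (y + 2 * r + 2 * j) / (fact (r + a j) * fact (r + y + b j)) =
      2 ^ (y + 2 * r) * sqrt (2 / (pi * real (y + 2 * r))) * real (y + 2 * r) ^ (2 * j)
        * (2 / real (y + 2 * r)) ^ (a j + b j) * u j r"
    by metis
  have "near_one (\<lambda>r. \<Prod>j<M. u j r)" by (rule near_one_prod) (rule u)
  moreover have "(\<Prod>j<M. fact (y + 2 * r + 2 * j) / (fact (r + a j) * fact (r + y + b j))) =
      2 ^ (M * (y + 2 * r)) * real (y + 2 * r) powr (real M * (real M - 1) - real M / 2 - real M * real D)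
        * 2 powr (real M / 2 + real M * real D) * pi powr (- (real M / 2)) * (\<Prod>j<M. u j r)"
    if r: "r \<ge> 1" for r
  proof -
    define T where "T = real (y + 2 * r)"
    have T: "T > 0" using r by (simp add: T_def)
    have sq: "sqrt (2 / (pi * T)) = 2 powr (1 / 2) * pi powr (- 1 / 2) * T powr (- 1 / 2)"
      using T by (simp add: powr_half_sqrt powr_minus real_sqrt_divide real_sqrt_mult field_simps)
    have "(\<Prod>j<M. fact (y + 2 * r + 2 * j) / (fact (r + a j) * fact (r + y + b j))) =
      (\<Prod>j<M. 2 ^ (y + 2 * r) * sqrt (2 / (pi * T)) * T ^ (2 * j) * (2 / T) ^ D * u j r)"
      using u(2)[OF r] assms by (intro prod.cong) (auto simp: T_def)
    also have "\<dots> = (2 ^ (y + 2 * r)) ^ M * sqrt (2 / (pi * T)) ^ M * (\<Prod>j<M. T ^ (2 * j)) * ((2 / T) ^ D) ^ M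
        * (\<Prod>j<M. u j r)"
      by (simp only: prod.distrib prod_constant card_lessThan)
    also have "(\<Prod>j<M. T ^ (2 * j)) = T powr (real M * (real M - 1))"
    proof (induction M)
      case (Suc M)
      have "T ^ (2 * M) = T powr (2 * real M)" using T by (simp flip: powr_realpow)
      with Suc show ?case using T by (simp add: powr_add[symmetric] algebra_simps)
    qed (use T in simp)
    also have "sqrt (2 / (pi * T)) ^ M = 2 powr (real M / 2) * pi powr (- (real M / 2)) * T powr (- (real M / 2))"
      unfolding sq using T by (simp add: power_mult_distrib powr_power)
    also have "((2 / T) ^ D) ^ M = 2 powr (real M * real D) * T powr (- (real M * real D))"
      using T by (simp add: powr_minus powr_realpow[symmetric] powr_powr power_divide
          flip: power_mult) (simp add: mult.commute powr_realpow[symmetric] field_simps flip: of_nat_mult)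
    also have "(2 ^ (y + 2 * r)) ^ M = (2::real) ^ (M * (y + 2 * r))"
      by (simp add: power_mult[symmetric] mult.commute)
    finally have "(\<Prod>j<M. fact (y + 2 * r + 2 * j) / (fact (r + a j) * fact (r + y + b j))) =
       2 ^ (M * (y + 2 * r)) * (T powr (real M * (real M - 1)) * T powr (- (real M / 2)) * T powr (- (real M * real D)))
        * (2 powr (real M / 2) * 2 powr (real M * real D)) * pi powr (- (real M / 2)) * (\<Prod>j<M. u j r)"
      by (simp only: mult_ac)
    then show ?thesis unfolding T_def[symmetric] powr_add[symmetric] by simp
  qed
  ultimately show ?thesis by (rule that)
qed

section \<open>The contact series below and above the transition\<close>

lemma base_factor_eq: "base_factor m y = (\<Prod>i<m. fact i * fact (y + m + i) / fact (y + 2 * i))"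
proof (induction m)
  case (Suc m)
  have "base_factor (Suc m) y = base_factor m y * ((real y + 2 * real m + 1) *
      (\<Prod>i<m. (real m - real i) * (real y + real i + real m + 1)))"
    by (simp only: base_factor_def prod_upper_triangle_Suc prod.lessThan_Suc mult_ac)
  also have "\<dots> = (\<Prod>i<m. fact i * fact (y + m + i) / fact (y + 2 * i) * (real y + real i + real m + 1))
      * (fact m * (real y + 2 * real m + 1))"
  proof -
    have "(\<Prod>i<m. real m - real i) = fact m" using prod_falling[of m m] by simp
    then show ?thesis unfolding Suc.IH prod.distrib by (simp only: mult_ac)
  qed
  also have "fact m * (real y + 2 * real m + 1) = fact m * fact (y + Suc m + m) / fact (y + 2 * m)"
  proof -
    have "y + Suc m + m = Suc (y + 2 * m)" by simp
    then have "fact (y + Suc m + m) = (real y + 2 * real m + 1) * fact (y + 2 * m)"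
      by (simp only: fact_Suc) simp
    then show ?thesis by (simp only:) simp
  qed
  also have "(\<Prod>i<m. fact i * fact (y + m + i) / fact (y + 2 * i) * (real y + real i + real m + 1))
      = (\<Prod>i<m. fact i * fact (y + Suc m + i) / fact (y + 2 * i))"
    by (intro prod.cong refl) simp
  finally show ?case by simp
qed (simp add: base_factor_def)

lemma base_factor_2_eq:
  "(\<Prod>i<n. \<Prod>j\<in>{i<..<n}. (real j - real i) * (real y + real i + real j)) =
    (\<Prod>i<n. fact i * fact (y + n + i - 1) / fact (y + 2 * i))"
proof (induction n)
  case (Suc n)
  have "(\<Prod>i<n. fact i * fact (y + n + i - 1) / fact (y + 2 * i)) * (\<Prod>i<n. real y + real i + real n)
      = (\<Prod>i<n. fact i * fact (y + n + i) / fact (y + 2 * i))"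
    unfolding prod.distrib[symmetric]
  proof (rule prod.cong[OF refl])
    fix i assume "i \<in> {..<n}"
    then have "fact (y + n + i) = (real y + real i + real n) * fact (y + n + i - 1)"
      by (subst fact_reduce) auto
    then show "fact i * fact (y + n + i - 1) / fact (y + 2 * i) * (real y + real i + real n) =
        fact i * fact (y + n + i) / fact (y + 2 * i)" by simp
  qed
  \<comment> \<open>The new index \<open>i = n\<close> contributes \<open>fact n\<close> alone,
    because \<open>y + Suc n + n - 1\<close> is \<open>y + 2 * n\<close>.\<close>
  moreover have "fact (y + 2 * n) = (fact (y + n + n) :: real)" by (simp add: mult_2 add.assoc)
  ultimately have "(\<Prod>i<Suc n. fact i * fact (y + Suc n + i - 1) / fact (y + 2 * i)) =
      (\<Prod>i<n. fact i * fact (y + n + i - 1) / fact (y + 2 * i)) * (\<Prod>i<n. real y + real i + real n) * fact n"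
    by simp
  then show ?case
    unfolding prod_upper_triangle_Suc Suc.IH using prod_falling[of n n] by (simp add: prod.distrib)
qed simp

section \<open>The convergent contact series below the transition\<close>

lemma pochhammer_mult_fact: "pochhammer (real k + 1) d * fact k = fact (k + d)"
proof (induction d)
  case (Suc d)
  have "pochhammer (real k + 1) (Suc d) * fact k = (pochhammer (real k + 1) d * fact k) * (real k + 1 + real d)"
    by (simp only: pochhammer_Suc mult_ac)
  then show ?case unfolding Suc.IH by (simp add: mult.commute add_ac)
qed simp

text \<open>Negative binomial series: the rising factorial is \<open>fact d\<close> times the
  coefficient of x^k in (1 - x)^(-d-1).\<close>

lemma pochhammer_sums:
  fixes x :: real
  assumes "\<bar>x\<bar> < 1"
  shows "(\<lambda>k. x ^ k * pochhammer (real k + 1) d) sums (fact d / (1 - x) ^ (d + 1))"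
proof -
  have "(\<lambda>k. ((- real (d + 1)) gchoose k) * (- x) ^ k) sums (1 + (- x)) powr (- real (d + 1))"
    using assms by (intro gen_binomial_real) simp
  from sums_mult[OF this, of "fact d"]
  have "(\<lambda>k. fact d * (((- real (d + 1)) gchoose k) * (- x) ^ k)) sums
      (fact d * (1 - x) powr (- real (d + 1)))" by simp
  moreover have "fact d * (((- real (d + 1)) gchoose k) * (- x) ^ k) = x ^ k * pochhammer (real k + 1) d" for k
  proof -
    have "((- real (d + 1)) gchoose k) = (-1) ^ k * real ((d + k) choose k)"
      by (subst gbinomial_minus) (simp add: binomial_gbinomial add_ac)
    moreover have "fact d * real ((d + k) choose k) = pochhammer (real k + 1) d"
      using pochhammer_mult_fact[of k d] by (simp add: binomial_fact field_simps)
    moreover have "(- 1) ^ k * (- x) ^ k = x ^ k" by (simp flip: power_mult_distrib)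
    ultimately show ?thesis by (metis mult.assoc mult.commute)
  qed
  moreover have "(1 - x) powr (- real (d + 1)) = 1 / (1 - x) ^ (d + 1)"
    using assms by (subst powr_minus, subst powr_realpow) (auto simp: divide_inverse)
  ultimately show ?thesis by simp
qed

text \<open>Absorbing \<open>h\<close> into the binomial coefficient lowers the order by one and
  shifts \<open>a\<close> to \<open>a + 1\<close>; the Chu-Vandermonde identity does the
  rest.\<close>

lemma sum_binomial_pochhammer_weighted:
  "(\<Sum>h\<le>Suc m. real (Suc m choose h) * real h * pochhammer a h * pochhammer x (Suc m - h)) =
    real (Suc m) * a * pochhammer (a + 1 + x) m"
proof -
  have "(\<Sum>h\<le>Suc m. real (Suc m choose h) * real h * pochhammer a h * pochhammer x (Suc m - h)) =
     (\<Sum>h\<le>m. real (Suc m choose Suc h) * real (Suc h) * pochhammer a (Suc h) * pochhammer x (m - h))"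
    by (subst sum.atMost_Suc_shift) simp
  also have "\<dots> = (\<Sum>h\<le>m. real (Suc m) * a * (real (m choose h) * pochhammer (a + 1) h * pochhammer x (m - h)))"
  proof (rule sum.cong[OF refl])
    fix h
    have "real (Suc m choose Suc h) * real (Suc h) = real (Suc m) * real (m choose h)"
      by (metis Suc_times_binomial mult.commute of_nat_mult)
    then show "real (Suc m choose Suc h) * real (Suc h) * pochhammer a (Suc h) * pochhammer x (m - h) =
        real (Suc m) * a * (real (m choose h) * pochhammer (a + 1) h * pochhammer x (m - h))"
      by (simp only: pochhammer_rec mult_ac)
  qed
  also have "\<dots> = real (Suc m) * a * pochhammer (a + 1 + x) m"
    by (simp only: sum_distrib_left[symmetric] pochhammer_binomial_sum of_nat_id)
  finally show ?thesis .
qed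

text \<open>With a = y - 1 and x = k + 1 + m, the factor \<open>y + 2 * m + 2 * k + 1\<close> is 2
  (a + x) - a. Both parts are Chu-Vandermonde sums, the second one weighted by \<open>h\<close>,
  which is the origin of \<open>1 - h / (2 * Suc m)\<close>. The expansion is in rising factorials
  of \<open>k + 1\<close>, the terms that \<open>pochhammer_sums\<close> can sum.\<close>

lemma end_factor_expand:
  "end_factor m y k = (\<Sum>h\<le>Suc m. 2 * (real (Suc m choose h) * pochhammer (real y - 1) h *
      (1 - real h / (2 * real (Suc m)))) * pochhammer (real k + 1) (2 * m + 1 - h))"
proof -
  define x where "x = real k + 1 + real m"
  define a where "a = real y - 1"
  let ?b = "\<lambda>h. real (Suc m choose h) * pochhammer a h * pochhammer x (Suc m - h)"
  have "(\<Sum>h\<le>Suc m. 2 * (real (Suc m choose h) * pochhammer a h *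
      (1 - real h / (2 * real (Suc m)))) * pochhammer (real k + 1) (2 * m + 1 - h))
    = (\<Sum>h\<le>Suc m. pochhammer (real k + 1) m * (2 * ?b h - (real (Suc m choose h) * real h * pochhammer a h * pochhammer x (Suc m - h)) / real (Suc m)))"
  proof (rule sum.cong[OF refl])
    fix h assume "h \<in> {..Suc m}"
    then have "2 * m + 1 - h = m + (Suc m - h)" by simp
    then have "pochhammer (real k + 1) (2 * m + 1 - h) = pochhammer (real k + 1) m * pochhammer x (Suc m - h)"
      by (simp only: pochhammer_product' x_def)
    then show "2 * (real (Suc m choose h) * pochhammer a h * (1 - real h / (2 * real (Suc m))))
        * pochhammer (real k + 1) (2 * m + 1 - h)
      = pochhammer (real k + 1) m * (2 * ?b h - (real (Suc m choose h) * real h * pochhammer a h * pochhammer x (Suc m - h)) / real (Suc m))"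
      by (simp add: field_simps del: of_nat_Suc binomial_Suc_Suc)
  qed
  also have "\<dots> = pochhammer (real k + 1) m * (2 * (\<Sum>h\<le>Suc m. ?b h) -
      (\<Sum>h\<le>Suc m. real (Suc m choose h) * real h * pochhammer a h * pochhammer x (Suc m - h)) / real (Suc m))"
    by (simp only: sum_distrib_left[symmetric] sum_subtractf sum_divide_distrib[symmetric])
  also have "(\<Sum>h\<le>Suc m. ?b h) = pochhammer (a + x) (Suc m)"
    by (simp only: pochhammer_binomial_sum of_nat_id)
  also have "\<dots> = (a + x) * pochhammer (a + 1 + x) m"
    by (simp add: pochhammer_rec add_ac)
  also have "(\<Sum>h\<le>Suc m. real (Suc m choose h) * real h * pochhammer a h * pochhammer x (Suc m - h)) / real (Suc m)
      = a * pochhammer (a + 1 + x) m"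
    unfolding sum_binomial_pochhammer_weighted by simp
  also have "pochhammer (real k + 1) m * (2 * ((a + x) * pochhammer (a + 1 + x) m) - a * pochhammer (a + 1 + x) m)
      = (a + 2 * x) * (pochhammer (real k + 1) m * pochhammer (a + 1 + x) m)"
    by (simp add: algebra_simps)
  also have "pochhammer (real k + 1) m = (\<Prod>i<m. real m + real k - real i)"
  proof -
    have "pochhammer (real k + 1) m = (\<Prod>i<m. real k + 1 + real i)"
      by (simp add: pochhammer_prod lessThan_atLeast0)
    also have "\<dots> = (\<Prod>i<m. real k + 1 + real (m - Suc i))"
      by (rule prod.nat_diff_reindex[symmetric])
    also have "\<dots> = (\<Prod>i<m. real m + real k - real i)"
      by (intro prod.cong) (auto simp: of_nat_diff)
    finally show ?thesis .
  qed
  also have "pochhammer (a + 1 + x) m = (\<Prod>i<m. real y + real i + real m + real k + 1)"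
    by (simp add: pochhammer_prod lessThan_atLeast0 a_def x_def add_ac)
  also have "(a + 2 * x) * ((\<Prod>i<m. real m + real k - real i) *
      (\<Prod>i<m. real y + real i + real m + real k + 1)) = end_factor m y k"
  proof -
    have "a + 2 * x = real y + 2 * real m + 2 * real k + 1" by (simp add: a_def x_def)
    then show ?thesis by (simp only: end_factor_def prod.distrib)
  qed
  finally show ?thesis unfolding a_def ..
qed

definition wall_sum :: "nat \<Rightarrow> nat \<Rightarrow> real \<Rightarrow> real" where
  "wall_sum n y \<kappa> = (\<Sum>h=0..n. real (n choose h) * ((real y + real h - 2) gchoose h)
     / real (2 * n choose h) * (1 / (2 - \<kappa>) ^ (2 * n - h)))"

lemma end_factor_sums:
  assumes "\<bar>\<kappa> - 1\<bar> < 1"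
  shows "(\<lambda>k. (\<kappa> - 1) ^ k * end_factor m y k) sums (2 * fact (2 * m + 1) * wall_sum (Suc m) y \<kappa>)"
proof -
  let ?c = "\<lambda>h. 2 * (real (Suc m choose h) * pochhammer (real y - 1) h * (1 - real h / (2 * real (Suc m))))"
  have "(\<lambda>k. \<Sum>h\<le>Suc m. ?c h * ((\<kappa> - 1) ^ k * pochhammer (real k + 1) (2 * m + 1 - h))) sums
     (\<Sum>h\<le>Suc m. ?c h * (fact (2 * m + 1 - h) / (1 - (\<kappa> - 1)) ^ (2 * m + 1 - h + 1)))"
    by (intro sums_sum sums_mult pochhammer_sums assms)
  moreover have "(\<Sum>h\<le>Suc m. ?c h * ((\<kappa> - 1) ^ k * pochhammer (real k + 1) (2 * m + 1 - h))) =
      (\<kappa> - 1) ^ k * end_factor m y k" for k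
    unfolding end_factor_expand sum_distrib_left by (intro sum.cong) (simp_all only: mult_ac)
  moreover have "(\<Sum>h\<le>Suc m. ?c h * (fact (2 * m + 1 - h) / (1 - (\<kappa> - 1)) ^ (2 * m + 1 - h + 1))) =
      2 * fact (2 * m + 1) * wall_sum (Suc m) y \<kappa>"
    unfolding wall_sum_def sum_distrib_left atLeast0AtMost
  proof (rule sum.cong[OF refl])
    fix h assume "h \<in> {..Suc m}"
    then have h: "h \<le> Suc m" by simp
    define d where "d = 2 * m + 1 - h"
    have d: "2 * Suc m - h = d + 1" "2 * Suc m = d + 1 + h" using h by (auto simp: d_def)
    have g: "pochhammer (real y - 1) h = fact h * ((real y + real h - 2) gchoose h)"
      by (simp add: gbinomial_pochhammer' algebra_simps)
    have "real (2 * Suc m choose h) = fact (2 * Suc m) / (fact h * fact (d + 1))"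
      by (subst binomial_fact) (use h in simp, simp only: d(1))
    also have "fact (2 * Suc m) = (2 * real (Suc m)) * fact (2 * m + 1)"
      by (simp add: algebra_simps)
    finally have b: "real (2 * Suc m choose h) = (2 * real (Suc m)) * fact (2 * m + 1) / (fact h * fact (d + 1))" .
    \<comment> \<open>The numerator \<open>d + 1\<close> completes \<open>fact d\<close> to the
      factorial of \<open>2 * Suc m - h\<close>, and thereby produces the reciprocal of the binomial
      coefficient in \<open>wall_sum\<close>.\<close>
    have r: "1 - real h / (2 * real (Suc m)) = (real d + 1) / (2 * real (Suc m))"
      using h by (simp add: d_def of_nat_diff field_simps)
    show "?c h * (fact (2 * m + 1 - h) / (1 - (\<kappa> - 1)) ^ (2 * m + 1 - h + 1)) =
      2 * fact (2 * m + 1) * (real (Suc m choose h) * ((real y + real h - 2) gchoose h)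
        / real (2 * Suc m choose h) * (1 / (2 - \<kappa>) ^ (2 * Suc m - h)))"
    proof -
      have calc: "2 * (C * (H * G) * ((D + 1) / (2 * M))) * (F / q) =
          2 * B * (C * G / (2 * M * B / (H * ((D + 1) * F))) * (1 / q))"
        if "M \<noteq> 0" "B \<noteq> 0" "H \<noteq> 0" "F \<noteq> 0" "D + 1 \<noteq> 0" for B C D F G H M q :: real
        using that by (simp add: divide_simps)
      have "1 - (\<kappa> - 1) = 2 - \<kappa>" "fact (d + 1) = (real d + 1) * fact d" by simp_all
      then show ?thesis
        unfolding b r g d(1) d_def[symmetric] by (simp only:, intro calc) auto
    qed
  qed
  ultimately show ?thesis by simp
qed

text \<open>A relative error makes sense only for a nonzero limit. For \<open>y > 0\<close> no term
  is negative. For \<open>y = 0\<close> the term \<open>h = 1\<close> is negative, but only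
  \<open>h = 0\<close> and \<open>h = 1\<close> survive and can be added explicitly.\<close>

lemma wall_sum_pos:
  assumes "0 < \<kappa>" "\<kappa> < 2" "n \<ge> 1"
  shows "wall_sum n y \<kappa> > 0"
proof (cases "y = 0")
  case True
  obtain m where n: "n = Suc m" using assms(3) by (cases n) auto
  let ?f = "\<lambda>h. real (n choose h) * ((real y + real h - 2) gchoose h)
     / real (2 * n choose h) * (1 / (2 - \<kappa>) ^ (2 * n - h))"
  \<comment> \<open>For \<open>y = 0\<close> and \<open>h \<ge> 2\<close> the upper index
    \<open>h - 2\<close> is a natural number below \<open>h\<close>.\<close>
  have z: "?f h = 0" if "h \<ge> 2" for h
  proof -
    have "real y + real h - 2 = real (h - 2)" using that True by (simp add: of_nat_diff)
    then have "((real y + real h - 2) gchoose h) = real ((h - 2) choose h)"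
      by (simp only: binomial_gbinomial)
    then show ?thesis using that by simp
  qed
  have "wall_sum n y \<kappa> = (\<Sum>h\<in>{0, 1}. ?f h)"
    unfolding wall_sum_def
  proof (rule sum.mono_neutral_right)
    show "\<forall>h\<in>{0..n} - {0, 1}. ?f h = 0"
    proof
      fix h assume "h \<in> {0..n} - {0, 1}"
      then have "h \<ge> 2" by auto
      then show "?f h = 0" by (rule z)
    qed
  qed (use assms(3) in auto)
  also have "\<dots> = 1 / (2 - \<kappa>) ^ (2 * n) - 1 / 2 * (1 / (2 - \<kappa>) ^ (2 * n - 1))"
    using True assms(3) by (simp add: field_simps)
  also have "\<dots> = \<kappa> / 2 / (2 - \<kappa>) ^ (2 * n)"
  proof -
    define P where "P = (2 - \<kappa>) ^ (2 * n - 1)"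
    have "(2 - \<kappa>) ^ (2 * n) = (2 - \<kappa>) * P" by (simp add: n P_def)
    moreover have "P \<noteq> 0" using assms(2) by (simp add: P_def)
    ultimately show ?thesis unfolding P_def[symmetric] using assms(2)
      by (simp add: divide_simps)
  qed
  finally show ?thesis using assms by simp
next
  case False
  let ?f = "\<lambda>h. real (n choose h) * ((real y + real h - 2) gchoose h)
     / real (2 * n choose h) * (1 / (2 - \<kappa>) ^ (2 * n - h))"
  have "0 < ?f 0" using assms by simp
  moreover have "0 \<le> ?f h" for h
  proof -
    have "((real y + real h - 2) gchoose h) = pochhammer (real y - 1) h / fact h"
      by (simp add: gbinomial_pochhammer' algebra_simps)
    also have "\<dots> \<ge> 0" using False by (auto simp: pochhammer_prod intro!: divide_nonneg_nonneg prod_nonneg)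
    finally show ?thesis using assms by simp
  qed
  ultimately show ?thesis unfolding wall_sum_def
    by (intro sum_pos2[of _ 0]) auto
qed

text \<open>Going from \<open>k\<close> to \<open>k + 1\<close> multiplies the ratio by (r - k) / (r
  + b + k + 1), which falls short of 1 by at most (b + 2 k + 1) / r; the shortfalls add up.\<close>

lemma fact_ratio_bounds:
  fixes r k b :: nat
  assumes "r \<ge> 1" "k \<le> r"
  defines "\<rho> \<equiv> fact r * fact (r + b) / (fact (r - k) * fact (r + b + k)) :: real"
  shows "0 \<le> \<rho>" "\<rho> \<le> 1" "1 - \<rho> \<le> real k * (real b + 1 + 2 * real k) / real r"
proof -
  have "0 \<le> fact r * fact (r + b) / (fact (r - k) * fact (r + b + k) :: real) \<and>
      fact r * fact (r + b) / (fact (r - k) * fact (r + b + k) :: real) \<le> 1 \<and>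
      1 - fact r * fact (r + b) / (fact (r - k) * fact (r + b + k) :: real)
        \<le> real k * (real b + 1 + 2 * real k) / real r"
    using assms(2)
  proof (induction k)
    case (Suc k)
    define \<rho> where "\<rho> = (fact r * fact (r + b) / (fact (r - k) * fact (r + b + k)) :: real)"
    define t where "t = (real r - real k) / (real r + real b + real k + 1)"
    have IH: "0 \<le> \<rho>" "\<rho> \<le> 1" "1 - \<rho> \<le> real k * (real b + 1 + 2 * real k) / real r"
      using Suc by (auto simp: \<rho>_def)
    have f: "fact (r - k) = (real r - real k) * fact (r - Suc k)"
      "fact (r + b + Suc k) = (real r + real b + real k + 1) * fact (r + b + k)"
      using Suc.prems by (metis Suc_diff_Suc Suc_le_eq fact_Suc of_nat_diff Suc_leD) simp
    have "real r - real k \<noteq> 0" using Suc.prems by simp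
    then have eq: "fact r * fact (r + b) / (fact (r - Suc k) * fact (r + b + Suc k)) = \<rho> * t"
      unfolding \<rho>_def t_def f by simp
    have t: "0 \<le> t" "t \<le> 1" using Suc.prems by (auto simp: t_def divide_le_eq_1)
    have "1 - t = (real b + 2 * real k + 1) / (real r + real b + real k + 1)"
      using assms(1) by (simp add: t_def field_simps)
    also have "\<dots> \<le> (real b + 2 * real k + 1) / real r"
      using assms(1) by (intro divide_left_mono) auto
    finally have 1: "1 - t \<le> (real b + 2 * real k + 1) / real r" .
    have "1 - \<rho> * t = (1 - \<rho>) + \<rho> * (1 - t)" by (simp add: algebra_simps)
    also have "\<dots> \<le> real k * (real b + 1 + 2 * real k) / real r + 1 * ((real b + 2 * real k + 1) / real r)"
      using IH 1 t by (intro add_mono mult_mono) auto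
    also have "\<dots> \<le> real (Suc k) * (real b + 1 + 2 * real (Suc k)) / real r"
      unfolding mult_1 add_divide_distrib[symmetric]
      by (rule divide_right_mono) (simp_all add: algebra_simps)
    finally show ?case unfolding eq using IH t by (auto intro: mult_le_one)
  qed simp
  then show "0 \<le> \<rho>" "\<rho> \<le> 1" "1 - \<rho> \<le> real k * (real b + 1 + 2 * real k) / real r"
    by (simp_all add: \<rho>_def)
qed

text \<open>Dominated convergence with a rate: after normalisation the \<open>k\<close>-th term is
  \<open>a k\<close> times the ratio of \<open>fact_ratio_bounds\<close>, so the error is at most
  the assumed convergent series divided by \<open>r\<close>.\<close>

lemma factorial_weighted_sum_near_one:
  fixes a :: "nat \<Rightarrow> real"
  assumes "a sums S" "S \<noteq> 0" "summable (\<lambda>k. \<bar>a k\<bar> * (real k * (real b + 1 + 2 * real k)))"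
  shows "near_one (\<lambda>r. (\<Sum>k\<le>r. a k / (fact (r - k) * fact (r + b + k))) * (fact r * fact (r + b)) / S)"
proof (rule near_one_bound)
  fix r :: nat assume r: "r \<ge> 1"
  let ?g = "\<lambda>k. \<bar>a k\<bar> * (real k * (real b + 1 + 2 * real k))"
  define \<rho> where "\<rho> = (\<lambda>k. if k \<le> r then fact r * fact (r + b) / (fact (r - k) * fact (r + b + k)) else 0 :: real)"
  have bd: "\<bar>1 - \<rho> k\<bar> \<le> real k * (real b + 1 + 2 * real k) / real r" for k
  proof (cases "k \<le> r")
    case True
    then show ?thesis using fact_ratio_bounds[OF r, of k b] by (simp add: \<rho>_def)
  next
    case False
    \<comment> \<open>For \<open>k > r\<close> the ratio is set to 0, and its distance 1 from 1
      still obeys the bound, since \<open>k\<close> alone exceeds \<open>r\<close>.\<close>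
    then have "real r * 1 \<le> real k * (real b + 1 + 2 * real k)" by (intro mult_mono) auto
    then show ?thesis using False r by (simp add: \<rho>_def le_divide_eq)
  qed
  have "(\<lambda>k. a k * \<rho> k) sums (\<Sum>k\<le>r. a k * \<rho> k)"
    by (rule sums_finite) (auto simp: \<rho>_def)
  also have "(\<Sum>k\<le>r. a k * \<rho> k) = (\<Sum>k\<le>r. a k / (fact (r - k) * fact (r + b + k))) * (fact r * fact (r + b))"
    unfolding sum_distrib_right by (intro sum.cong) (auto simp: \<rho>_def)
  finally have fin: "(\<lambda>k. a k * \<rho> k) sums ((\<Sum>k\<le>r. a k / (fact (r - k) * fact (r + b + k))) * (fact r * fact (r + b)))"
    (is "_ sums ?F") .
  have "(\<lambda>k. a k - a k * \<rho> k) sums (S - ?F)" by (intro sums_diff assms fin)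
  then have "S - ?F = (\<Sum>k. a k - a k * \<rho> k)" by (rule sums_unique)
  moreover have "norm (\<Sum>k. a k - a k * \<rho> k) \<le> (\<Sum>k. ?g k / real r)"
  proof (rule norm_suminf_le)
    fix k
    have "norm (a k - a k * \<rho> k) = \<bar>a k\<bar> * \<bar>1 - \<rho> k\<bar>"
      by (simp add: abs_mult[symmetric] algebra_simps)
    also have "\<dots> \<le> \<bar>a k\<bar> * (real k * (real b + 1 + 2 * real k) / real r)"
      by (intro mult_left_mono bd) simp
    finally show "norm (a k - a k * \<rho> k) \<le> ?g k / real r" by simp
  qed (intro summable_divide assms)
  moreover have "(\<Sum>k. ?g k / real r) = (\<Sum>k. ?g k) / real r"
    by (rule suminf_divide[OF assms(3)])
  ultimately have "\<bar>S - ?F\<bar> \<le> (\<Sum>k. ?g k) / real r" by simp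
  then have "\<bar>S - ?F\<bar> / \<bar>S\<bar> \<le> (\<Sum>k. ?g k) / real r / \<bar>S\<bar>"
    by (intro divide_right_mono) auto
  moreover have "?F / S - 1 = - ((S - ?F) / S)" using assms(2) by (simp add: field_simps)
  ultimately show "\<bar>?F / S - 1\<bar> \<le> (\<Sum>k. ?g k) / \<bar>S\<bar> / real r"
    by (simp add: mult.commute)
qed

lemma summable_end_factor:
  assumes "\<bar>s\<bar> < 1"
  shows "summable (\<lambda>k. \<bar>s ^ k * end_factor m y k\<bar> * (real k * (real (y + 2 * m + 1) + 1 + 2 * real k)))"
proof (rule summable_comparison_test')
  \<comment> \<open>Chosen so that \<open>B * (k + 1)\<close> dominates each linear factor. There
    are \<open>2 * m + 1\<close> of them in \<open>end_factor\<close> and two more in the weight,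
    hence the exponent \<open>2 * m + 3\<close>.\<close>
  define B where "B = real y + 2 * real m + 2"
  show "summable (\<lambda>k. B ^ (2 * m + 3) * (\<bar>s\<bar> ^ k * pochhammer (real k + 1) (2 * m + 3)))"
    using pochhammer_sums[of "\<bar>s\<bar>" "2 * m + 3"] assms by (intro summable_mult sums_summable) auto
  fix k :: nat assume "k \<ge> 0"
  define K where "K = B * (real k + 1)"
  have B: "B \<ge> 2" by (simp add: B_def)
  have lin: "c + d * real k \<le> K" if "c \<le> B" "d \<le> 2" for c d
  proof -
    have "d * real k \<le> B * real k" using that B by (intro mult_right_mono) auto
    with that show ?thesis by (simp add: K_def algebra_simps)
  qed
  have K: "K \<ge> 0" using B by (simp add: K_def)
  have E: "0 \<le> end_factor m y k" "end_factor m y k \<le> K * (\<Prod>i<m. K * K)"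
    unfolding end_factor_def
  proof -
    have p: "0 \<le> (real m + real k - real i) * (real y + real i + real m + real k + 1)" if "i < m" for i
      using that by (intro mult_nonneg_nonneg) auto
    then show "0 \<le> (real y + 2 * real m + 2 * real k + 1) *
     (\<Prod>i<m. (real m + real k - real i) * (real y + real i + real m + real k + 1))"
      by (intro mult_nonneg_nonneg prod_nonneg) auto
    have "(\<Prod>i<m. (real m + real k - real i) * (real y + real i + real m + real k + 1)) \<le> (\<Prod>i<m. K * K)"
    proof (rule prod_mono, intro conjI)
      fix i assume i: "i \<in> {..<m}"
      then show "0 \<le> (real m + real k - real i) * (real y + real i + real m + real k + 1)" using p by simp
      show "(real m + real k - real i) * (real y + real i + real m + real k + 1) \<le> K * K"
        using lin[of "real m - real i" 1] lin[of "real y + real i + real m + 1" 1] i K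
        by (intro mult_mono) (auto simp: B_def algebra_simps)
    qed
    moreover have "real y + 2 * real m + 2 * real k + 1 \<le> K"
      using lin[of "real y + 2 * real m + 1" 2] by (simp add: B_def)
    ultimately show "(real y + 2 * real m + 2 * real k + 1) *
     (\<Prod>i<m. (real m + real k - real i) * (real y + real i + real m + real k + 1)) \<le> K * (\<Prod>i<m. K * K)"
      using p K by (intro mult_mono prod_nonneg) auto
  qed
  have "\<bar>s ^ k * end_factor m y k\<bar> * (real k * (real (y + 2 * m + 1) + 1 + 2 * real k))
      \<le> \<bar>s\<bar> ^ k * (K * (\<Prod>i<m. K * K)) * (K * K)"
    using E K lin[of 0 1] lin[of "real (y + 2 * m + 1) + 1" 2] B
    by (intro mult_mono) (auto simp: abs_mult power_abs B_def intro!: mult_left_mono prod_nonneg)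
  also have "\<dots> = \<bar>s\<bar> ^ k * K ^ (2 * m + 3)"
    by (simp add: power_mult power2_eq_square power_add power3_eq_cube)
  also have "\<dots> = \<bar>s\<bar> ^ k * (B ^ (2 * m + 3) * (real k + 1) ^ (2 * m + 3))"
    by (simp only: K_def power_mult_distrib)
  also have "\<dots> \<le> \<bar>s\<bar> ^ k * (B ^ (2 * m + 3) * pochhammer (real k + 1) (2 * m + 3))"
  proof (intro mult_left_mono)
    have "(\<Prod>i<2 * m + 3. real k + 1) \<le> (\<Prod>i<2 * m + 3. real k + 1 + real i)"
      by (intro prod_mono) auto
    then show "(real k + 1) ^ (2 * m + 3) \<le> pochhammer (real k + 1) (2 * m + 3)"
      by (simp add: pochhammer_prod lessThan_atLeast0)
  qed (use B in auto)
  finally show "norm (\<bar>s ^ k * end_factor m y k\<bar> * (real k * (real (y + 2 * m + 1) + 1 + 2 * real k)))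
      \<le> B ^ (2 * m + 3) * (\<bar>s\<bar> ^ k * pochhammer (real k + 1) (2 * m + 3))"
    by (simp add: abs_mult mult_ac)
qed

section \<open>Binomial moments above the transition\<close>

lemma pcompose_shift:
  fixes p :: "real poly"
  assumes "degree p \<le> d"
  shows "degree (pcompose p [:a, 1:]) \<le> d" "coeff (pcompose p [:a, 1:]) d = coeff p d"
proof -
  have deg: "degree (pcompose p [:a, 1:]) = degree p"
    using degree_pcompose[of p "[:a, 1:]"] by simp
  then show "degree (pcompose p [:a, 1:]) \<le> d" using assms by simp
  show "coeff (pcompose p [:a, 1:]) d = coeff p d"
  proof (cases "degree p = d")
    case True
    then show ?thesis using lead_coeff_comp[of "[:a, 1:]" p] deg by simp
  next
    case False
    then show ?thesis using assms deg by (simp add: coeff_eq_0)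
  qed
qed

text \<open>Write \<open>Suc N - 2 * p\<close> as \<open>(Suc N - p) - p\<close> and absorb each
  part into the binomial coefficient; the second absorption also shifts \<open>p\<close> by one and
  releases a factor \<open>w\<close>.\<close>

lemma binomial_moment_recurrence:
  fixes f :: "real \<Rightarrow> real"
  shows "(\<Sum>p\<le>Suc N. real (Suc N choose p) * w ^ p *
      ((real (Suc N) - 2 * real p) * f (real (Suc N) - 2 * real p))) =
    real (Suc N) * ((\<Sum>p\<le>N. real (N choose p) * w ^ p * f (real N - 2 * real p + 1))
      - w * (\<Sum>p\<le>N. real (N choose p) * w ^ p * f (real N - 2 * real p - 1)))"
proof -
  let ?f = "\<lambda>p. f (real (Suc N) - 2 * real p)"
  have "(\<Sum>p\<le>Suc N. real (Suc N choose p) * w ^ p * ((real (Suc N) - 2 * real p) * ?f p)) =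
      (\<Sum>p\<le>Suc N. (real (Suc N) - real p) * real (Suc N choose p) * w ^ p * ?f p)
      - (\<Sum>p\<le>Suc N. real p * real (Suc N choose p) * w ^ p * ?f p)"
    unfolding sum_subtractf[symmetric] by (intro sum.cong refl) (simp add: algebra_simps)
  also have "(\<Sum>p\<le>Suc N. (real (Suc N) - real p) * real (Suc N choose p) * w ^ p * ?f p) =
      (\<Sum>p\<le>N. real (Suc N) * (real (N choose p) * w ^ p * f (real N - 2 * real p + 1)))"
  proof -
    have "(real (Suc N) - real p) * real (Suc N choose p) = real (Suc N) * real (N choose p)" if "p \<le> N" for p
      using binomial_absorb_comp[of "Suc N" p] that
      by (simp only: of_nat_mult[symmetric] of_nat_diff[symmetric] le_SucI) simp
    then have "(\<Sum>p\<le>N. (real (Suc N) - real p) * real (Suc N choose p) * w ^ p * ?f p) =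
      (\<Sum>p\<le>N. real (Suc N) * (real (N choose p) * w ^ p * f (real N - 2 * real p + 1)))"
      by (intro sum.cong refl) (simp add: mult.assoc algebra_simps)
    then show ?thesis by (simp only: sum.atMost_Suc) simp
  qed
  also have "(\<Sum>p\<le>Suc N. real p * real (Suc N choose p) * w ^ p * ?f p) =
      (\<Sum>p\<le>N. real (Suc N) * (w * (real (N choose p) * w ^ p * f (real N - 2 * real p - 1))))"
  proof -
    have "real (Suc p) * real (Suc N choose Suc p) = real (Suc N) * real (N choose p)" for p
      by (metis Suc_times_binomial of_nat_mult)
    moreover have "real (Suc N) - 2 * real (Suc p) = real N - 2 * real p - 1" for p by simp
    ultimately have "(\<Sum>p\<le>N. real (Suc p) * real (Suc N choose Suc p) * w ^ Suc p * ?f (Suc p)) =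
      (\<Sum>p\<le>N. real (Suc N) * (w * (real (N choose p) * w ^ p * f (real N - 2 * real p - 1))))"
      by (simp only: power_Suc) (simp only: mult_ac)
    then show ?thesis by (subst sum.atMost_Suc_shift) simp
  qed
  finally show ?thesis
    by (simp only: sum_distrib_left[symmetric] right_diff_distrib)
qed

text \<open>For \<open>w > 0\<close> and \<open>p\<close> binomial with success probability w / (1 +
  w), the variable N - 2 p has mean N (1 - w) / (1 + w), which explains the leading coefficient. A
  bound \<open>d\<close> in place of the exact degree spares the induction a case distinction on
  vanishing coefficients.\<close>

lemma binomial_moment_poly:
  fixes q :: "real poly"
  assumes "1 + w \<noteq> 0" "degree q \<le> d"
  shows "\<exists>Q. degree Q \<le> d \<and> coeff Q d = coeff q d * ((1 - w) / (1 + w)) ^ d \<and>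
    (\<forall>N. (\<Sum>p\<le>N. real (N choose p) * w ^ p * poly q (real N - 2 * real p)) = (1 + w) ^ N * poly Q (real N))"
  using assms(2)
proof (induction d arbitrary: q)
  case 0
  then obtain c where "q = [:c:]" using degree_eq_zeroE by auto
  moreover have "(\<Sum>p\<le>N. real (N choose p) * w ^ p) = (1 + w) ^ N" for N
    by (subst add.commute) (simp add: binomial_ring)
  ultimately show ?case by (intro exI[of _ "[:c:]"]) (simp add: sum_distrib_right[symmetric])
next
  case (Suc d)
  obtain c q' where q: "q = pCons c q'" by (cases q) auto
  have deg: "degree q' \<le> d" using Suc.prems by (auto simp: q split: if_splits)
  note sh = pcompose_shift[OF deg]
  from Suc.IH[OF sh(1)[of 1]] obtain Q1 where Q1: "degree Q1 \<le> d"
    "coeff Q1 d = coeff q' d * ((1 - w) / (1 + w)) ^ d"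
    "\<And>N. (\<Sum>p\<le>N. real (N choose p) * w ^ p * poly q' (real N - 2 * real p + 1)) = (1 + w) ^ N * poly Q1 (real N)"
    unfolding sh(2) by (auto simp: poly_pcompose add_ac)
  from Suc.IH[OF sh(1)[of "-1"]] obtain Q2 where Q2: "degree Q2 \<le> d"
    "coeff Q2 d = coeff q' d * ((1 - w) / (1 + w)) ^ d"
    "\<And>N. (\<Sum>p\<le>N. real (N choose p) * w ^ p * poly q' (real N - 2 * real p - 1)) = (1 + w) ^ N * poly Q2 (real N)"
    unfolding sh(2) by (auto simp: poly_pcompose algebra_simps)
  \<comment> \<open>The recurrence lowers \<open>N\<close> by one, so \<open>Q1\<close> and
    \<open>Q2\<close> are needed at \<open>N - 1\<close>.\<close>
  define R where "R = pcompose Q1 [:-1, 1:] - smult w (pcompose Q2 [:-1, 1:])"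
  define Q where "Q = [:c:] + smult (1 / (1 + w)) (pCons 0 R)"
  have R: "degree R \<le> d" "coeff R d = (1 - w) * (coeff q' d * ((1 - w) / (1 + w)) ^ d)"
    unfolding R_def using pcompose_shift[OF Q1(1)] pcompose_shift[OF Q2(1)] Q1(2) Q2(2)
    by (auto intro!: degree_diff_le order.trans[OF degree_smult_le] simp: algebra_simps)
  have "degree Q \<le> Suc d"
    unfolding Q_def using R(1)
    by (intro degree_add_le order.trans[OF degree_smult_le]) (auto simp: degree_pCons_eq_if)
  moreover have "coeff Q (Suc d) = coeff q (Suc d) * ((1 - w) / (1 + w)) ^ Suc d"
    by (simp add: Q_def q R(2))
  moreover have "(\<Sum>p\<le>N. real (N choose p) * w ^ p * poly q (real N - 2 * real p)) = (1 + w) ^ N * poly Q (real N)" for N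
  proof -
    have b: "(\<Sum>p\<le>N. real (N choose p) * w ^ p) = (1 + w) ^ N"
      by (subst add.commute) (simp add: binomial_ring)
    have "(\<Sum>p\<le>N. real (N choose p) * w ^ p * poly q (real N - 2 * real p)) =
       c * (\<Sum>p\<le>N. real (N choose p) * w ^ p) +
       (\<Sum>p\<le>N. real (N choose p) * w ^ p * ((real N - 2 * real p) * poly q' (real N - 2 * real p)))"
      unfolding sum_distrib_left sum.distrib[symmetric]
      by (intro sum.cong refl) (simp add: q algebra_simps)
    also have "(\<Sum>p\<le>N. real (N choose p) * w ^ p * ((real N - 2 * real p) * poly q' (real N - 2 * real p)))
      = (1 + w) ^ N * (real N * poly R (real N) / (1 + w))"
    proof (cases N)
      case (Suc M)
      have "poly R (real (Suc M)) = poly Q1 (real M) - w * poly Q2 (real M)"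
        by (simp add: R_def poly_pcompose)
      then show ?thesis
        unfolding Suc binomial_moment_recurrence Q1(3) Q2(3) using assms(1)
        by (simp del: of_nat_Suc) (simp add: right_diff_distrib mult_ac del: of_nat_Suc)
    qed simp
    finally show ?thesis unfolding b using assms(1) by (simp add: Q_def algebra_simps)
  qed
  ultimately show ?case by blast
qed

lemma poly_near_one:
  fixes Q :: "real poly"
  assumes "degree Q \<le> d" "coeff Q d \<noteq> 0"
  shows "near_one (\<lambda>r. poly Q (real (2 * r + e)) / (coeff Q d * real (2 * r + e) ^ d))"
proof (rule near_one_bound)
  let ?C = "\<Sum>i<d. \<bar>coeff Q i\<bar>"
  fix r :: nat assume r: "r \<ge> 1"
  define x where "x = real (2 * r + e)"
  have x: "x \<ge> 1" "x \<ge> real r" using r by (auto simp: x_def)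
  have "poly Q x = (\<Sum>i\<le>d. coeff Q i * x ^ i)"
    unfolding poly_altdef using assms(1) by (intro sum.mono_neutral_left) (auto intro: coeff_eq_0)
  then have p: "poly Q x = coeff Q d * x ^ d + (\<Sum>i<d. coeff Q i * x ^ i)"
    by (simp add: lessThan_Suc_atMost[symmetric])
  have "\<bar>\<Sum>i<d. coeff Q i * x ^ i\<bar> * x \<le> (\<Sum>i<d. \<bar>coeff Q i * x ^ i\<bar>) * x"
    using x by (intro mult_right_mono sum_abs) auto
  also have "\<dots> = (\<Sum>i<d. \<bar>coeff Q i\<bar> * x ^ Suc i)"
    unfolding sum_distrib_right using x by (intro sum.cong) (auto simp: abs_mult)
  also have "\<dots> \<le> (\<Sum>i<d. \<bar>coeff Q i\<bar> * x ^ d)"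
    using x by (intro sum_mono mult_left_mono power_increasing) auto
  finally have *: "\<bar>\<Sum>i<d. coeff Q i * x ^ i\<bar> * x \<le> ?C * x ^ d" by (simp add: sum_distrib_right)
  have "poly Q x / (coeff Q d * x ^ d) - 1 = (\<Sum>i<d. coeff Q i * x ^ i) / (coeff Q d * x ^ d)"
    using x assms(2) unfolding p by (simp add: field_simps)
  then have "\<bar>poly Q x / (coeff Q d * x ^ d) - 1\<bar> = \<bar>\<Sum>i<d. coeff Q i * x ^ i\<bar> / (\<bar>coeff Q d\<bar> * x ^ d)"
    using x by (simp add: abs_mult)
  also have "\<dots> \<le> ?C / \<bar>coeff Q d\<bar> / x"
    using * x assms(2) by (simp add: field_simps)
  also have "\<dots> \<le> ?C / \<bar>coeff Q d\<bar> / real r"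
    using x r by (intro divide_left_mono divide_nonneg_nonneg sum_nonneg) auto
  finally show "\<bar>poly Q (real (2 * r + e)) / (coeff Q d * real (2 * r + e) ^ d) - 1\<bar> \<le> ?C / \<bar>coeff Q d\<bar> / real r"
    unfolding x_def .
qed

text \<open>\<open>end_factor\<close> as an odd polynomial in z = y + 2 m + 1 + 2 k: each pair of
  its factors is a difference of squares divided by 4. In the binomial sum z becomes N - 2
  p.\<close>

definition end_poly :: "nat \<Rightarrow> nat \<Rightarrow> real poly" where
  "end_poly m y = [:0, 1:] * (\<Prod>i<m. [:- (real (y + 2 * i + 1))\<^sup>2 / 4, 0, 1 / 4:])"

lemma end_poly_degree: "degree (end_poly m y) = 2 * m + 1" "coeff (end_poly m y) (2 * m + 1) = (1 / 4) ^ m"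
proof -
  let ?P = "\<lambda>m. \<Prod>i<m. [:- (real (y + 2 * i + 1))\<^sup>2 / 4, 0, 1 / 4:]"
  have "degree (?P m) = 2 * m \<and> lead_coeff (?P m) = (1 / 4) ^ m"
  proof (induction m)
    case (Suc m)
    define Q where "Q = ?P m"
    let ?l = "[:- (real (y + 2 * m + 1))\<^sup>2 / 4, 0, 1 / 4:]"
    have Q: "degree Q = 2 * m" "lead_coeff Q = (1 / 4) ^ m" using Suc by (auto simp: Q_def)
    then have "Q \<noteq> 0" by auto
    then have "degree (Q * ?l) = 2 * Suc m"
      using degree_mult_eq[of Q ?l] Q by (simp del: mult_pCons_right)
    moreover have "lead_coeff (Q * ?l) = (1 / 4) ^ Suc m"
      using lead_coeff_mult[of Q ?l] Q by (simp del: mult_pCons_right)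
    ultimately show ?case by (simp only: prod.lessThan_Suc Q_def simp_thms)
  qed simp
  then have P: "degree (?P m) = 2 * m" "coeff (?P m) (2 * m) = (1 / 4) ^ m" by auto
  then have "?P m \<noteq> 0" by auto
  have e: "end_poly m y = pCons 0 (?P m)" by (simp add: end_poly_def)
  show "degree (end_poly m y) = 2 * m + 1" unfolding e degree_pCons_eq[OF \<open>?P m \<noteq> 0\<close>] P(1) by simp
  show "coeff (end_poly m y) (2 * m + 1) = (1 / 4) ^ m" unfolding e using P by simp
qed

lemma poly_end_poly:
  "poly (end_poly m y) z = z * (\<Prod>i<m. (z ^ 2 - (real (y + 2 * i + 1))\<^sup>2) / 4)"
  by (simp add: end_poly_def poly_prod power2_eq_square diff_divide_distrib)

lemma end_factor_eq_poly: "end_factor m y k = poly (end_poly m y) (real y + 2 * real m + 1 + 2 * real k)"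
proof -
  let ?z = "real y + 2 * real m + 1 + 2 * real k"
  have "(?z ^ 2 - (real (y + 2 * i + 1))\<^sup>2) / 4 = (real m + real k - real i) * (real y + real i + real m + real k + 1)" for i
    by (simp add: power2_eq_square field_simps)
  then show ?thesis unfolding end_factor_def poly_end_poly by simp
qed

text \<open>Stated for \<open>z\<close> of either sign because N - 2 p becomes negative in the tail
  of the binomial sum.\<close>

lemma poly_end_poly_bound:
  assumes "\<bar>z\<bar> \<le> x" "real (y + 2 * m + 1) \<le> x"
  shows "\<bar>poly (end_poly m y) z\<bar> \<le> x ^ (2 * m + 1)"
proof -
  have "\<bar>(z ^ 2 - (real (y + 2 * i + 1))\<^sup>2) / 4\<bar> \<le> x ^ 2" if "i < m" for i
  proof -
    have "z ^ 2 \<le> x ^ 2" using assms(1) by (metis abs_ge_zero power_mono power2_abs)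
    moreover have "(real (y + 2 * i + 1)) ^ 2 \<le> x ^ 2" using assms(2) that by (intro power_mono) auto
    moreover have "0 \<le> z ^ 2" "0 \<le> (real (y + 2 * i + 1)) ^ 2" by simp_all
    moreover have "\<bar>(p - q) / 4\<bar> \<le> t" if "p \<le> t" "q \<le> t" "0 \<le> p" "0 \<le> q" for p q t :: real
      using that by (simp add: abs_if field_simps)
    ultimately show ?thesis by blast
  qed
  then have "(\<Prod>i<m. \<bar>(z ^ 2 - (real (y + 2 * i + 1))\<^sup>2) / 4\<bar>) \<le> (\<Prod>i<m. x ^ 2)"
    by (intro prod_mono) auto
  then have "\<bar>z\<bar> * (\<Prod>i<m. \<bar>(z ^ 2 - (real (y + 2 * i + 1))\<^sup>2) / 4\<bar>) \<le> x * (\<Prod>i<m. x ^ 2)"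
    using assms by (intro mult_mono prod_nonneg) auto
  then show ?thesis unfolding poly_end_poly abs_mult abs_prod by (simp add: power_mult)
qed

lemma power_le_const_over_n:
  fixes \<theta> :: real
  assumes "0 \<le> \<theta>" "\<theta> < 1"
  obtains C where "\<And>r. r \<ge> 1 \<Longrightarrow> \<theta> ^ r \<le> C / real r"
proof -
  have "(\<lambda>r. real r * \<theta> ^ r) \<longlonglongrightarrow> 0"
    using assms by (intro powser_times_n_limit_0) auto
  then have "Bseq (\<lambda>r. real r * \<theta> ^ r)" by (intro convergent_imp_Bseq convergentI)
  then obtain C where C: "\<And>r. norm (real r * \<theta> ^ r) \<le> C" by (auto simp: Bseq_def)
  have "\<theta> ^ r \<le> C / real r" if "r \<ge> 1" for r
    using C[of r] that assms by (simp add: field_simps)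
  then show ?thesis by (rule that)
qed

text \<open>Extending the sum to all \<open>p \<le> N\<close> costs an exponentially small relative error, because
  \<open>4 w / (1 + w)\<^sup>2 < 1\<close>; the full sum is a moment of a binomial distribution.\<close>

lemma supercritical_sum_near_one:
  assumes "1 < s"
  shows "near_one (\<lambda>r. (\<Sum>k\<le>r. s ^ k * (end_factor m y k * real ((2 * r + (y + 2 * m + 1)) choose (r - k))))
    / (s ^ r * (1 + 1 / s) ^ (2 * r + (y + 2 * m + 1)) *
       ((1 / 4) ^ m * ((s - 1) / (s + 1)) ^ (2 * m + 1) * real (2 * r + (y + 2 * m + 1)) ^ (2 * m + 1))))"
proof -
  define w where "w = 1 / s"
  define e where "e = y + 2 * m + 1"
  define c where "c = (1 / 4) ^ m * ((s - 1) / (s + 1)) ^ (2 * m + 1)"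
  define q where "q = end_poly m y"
  define \<theta> where "\<theta> = 4 * w / (1 + w)\<^sup>2"
  have w: "0 < w" "w < 1" using assms by (auto simp: w_def)
  have c: "c > 0" using assms by (simp add: c_def)
  have "1 - w = (s - 1) / s" "1 + w = (s + 1) / s" using assms by (simp_all add: w_def field_simps)
  then have "(1 - w) / (1 + w) = (s - 1) / (s + 1)" using assms by simp
  with binomial_moment_poly[of w q "2 * m + 1"] w end_poly_degree[of m y]
  obtain Q where Q: "degree Q \<le> 2 * m + 1" "coeff Q (2 * m + 1) = c"
    "\<And>N. (\<Sum>p\<le>N. real (N choose p) * w ^ p * poly q (real N - 2 * real p)) = (1 + w) ^ N * poly Q (real N)"
    unfolding c_def q_def by auto
  define u where "u = (\<lambda>r. poly Q (real (2 * r + e)) / (c * real (2 * r + e) ^ (2 * m + 1)))"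
  have u: "near_one u"
    unfolding u_def Q(2)[symmetric] by (rule poly_near_one) (use Q c in auto)
  define tail where "tail = (\<lambda>r. \<Sum>p\<in>{r<..2 * r + e}. real ((2 * r + e) choose p) * w ^ p * poly q (real (2 * r + e) - 2 * real p))"
  define D where "D = (\<lambda>r. (1 + w) ^ (2 * r + e) * (c * real (2 * r + e) ^ (2 * m + 1)))"
  have D: "D r > 0" for r using w c by (simp add: D_def e_def del: of_nat_Suc of_nat_add)
  \<comment> \<open>Substituting p = r - k turns s^k into s^r w^p and the argument of the polynomial
    into N - 2 p with N = 2 r + e.\<close>
  have head: "(\<Sum>k\<le>r. s ^ k * (end_factor m y k * real ((2 * r + e) choose (r - k)))) = s ^ r * (u r * D r - tail r)" for r
  proof -
    let ?N = "2 * r + e"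
    let ?t = "\<lambda>p. real (?N choose p) * w ^ p * poly q (real ?N - 2 * real p)"
    have "(\<Sum>k\<le>r. s ^ k * (end_factor m y k * real (?N choose (r - k)))) = (\<Sum>p\<le>r. s ^ r * ?t p)"
    proof (rule sum.reindex_bij_witness[of _ "\<lambda>p. r - p" "\<lambda>k. r - k"])
      fix k assume "k \<in> {..r}"
      then have k: "k \<le> r" by simp
      then have "s ^ r * w ^ (r - k) = s ^ k"
        using assms by (simp add: w_def power_divide power_diff)
      moreover have "real ?N - 2 * real (r - k) = real y + 2 * real m + 1 + 2 * real k"
        using k by (simp add: e_def of_nat_diff)
      ultimately show "s ^ r * ?t (r - k) = s ^ k * (end_factor m y k * real (?N choose (r - k)))"
        unfolding end_factor_eq_poly q_def by (simp add: mult_ac)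
    qed auto
    also have "(\<Sum>p\<le>r. s ^ r * ?t p) = s ^ r * (\<Sum>p\<le>r. ?t p)" by (simp only: sum_distrib_left)
    also have "(\<Sum>p\<le>r. ?t p) = (\<Sum>p\<le>?N. ?t p) - tail r"
    proof -
      have "{..?N} = {..r} \<union> {r<..?N}" by auto
      then have "(\<Sum>p\<le>?N. ?t p) = (\<Sum>p\<le>r. ?t p) + tail r"
        unfolding tail_def by (simp add: sum.union_disjoint ivl_disj_int)
      then show ?thesis by simp
    qed
    also have "(\<Sum>p\<le>?N. ?t p) = u r * D r"
      unfolding Q(3) u_def D_def using c by (simp add: e_def del: of_nat_Suc of_nat_add)
    finally show ?thesis .
  qed
  \<comment> \<open>In the tail w^p is at most w^r, the binomial coefficients sum to at most 2^N,
    and the power of N cancels against the one in \<open>D\<close>. The part of (2 / (1 + w))^N w^r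
    that depends on \<open>r\<close> is \<open>\<theta> ^ r\<close>.\<close>
  have tail: "\<bar>tail r\<bar> / D r \<le> (2 / (1 + w)) ^ e / c * \<theta> ^ r" for r
  proof -
    let ?N = "2 * r + e"
    have "\<bar>tail r\<bar> \<le> (\<Sum>p\<in>{r<..?N}. real (?N choose p) * (w ^ r * real ?N ^ (2 * m + 1)))"
      unfolding tail_def
    proof (rule order.trans[OF sum_abs], rule sum_mono)
      fix p assume p: "p \<in> {r<..?N}"
      have "\<bar>poly q (real ?N - 2 * real p)\<bar> \<le> real ?N ^ (2 * m + 1)"
        unfolding q_def using p by (intro poly_end_poly_bound) (auto simp: e_def)
      moreover have "w ^ p \<le> w ^ r" using p w by (intro power_decreasing) auto
      ultimately show "\<bar>real (?N choose p) * w ^ p * poly q (real ?N - 2 * real p)\<bar>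
          \<le> real (?N choose p) * (w ^ r * real ?N ^ (2 * m + 1))"
        unfolding abs_mult mult.assoc using w by (intro mult_mono) auto
    qed
    also have "\<dots> = (\<Sum>p\<in>{r<..?N}. real (?N choose p)) * (w ^ r * real ?N ^ (2 * m + 1))"
      by (simp only: sum_distrib_right)
    also have "(\<Sum>p\<in>{r<..?N}. real (?N choose p)) \<le> 2 ^ ?N"
    proof -
      have "(\<Sum>p\<in>{r<..?N}. real (?N choose p)) \<le> (\<Sum>p\<le>?N. real (?N choose p))"
        by (intro sum_mono2) auto
      also have "\<dots> = 2 ^ ?N" by (metis choose_row_sum of_nat_numeral of_nat_power of_nat_sum)
      finally show ?thesis .
    qed
    finally have "\<bar>tail r\<bar> \<le> 2 ^ ?N * (w ^ r * real ?N ^ (2 * m + 1))"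
      using w by (simp add: mult_right_mono)
    then have "\<bar>tail r\<bar> / D r \<le> 2 ^ ?N * (w ^ r * real ?N ^ (2 * m + 1)) / D r"
      using D[of r] by (intro divide_right_mono) auto
    also have "\<dots> = 2 ^ ?N * w ^ r / ((1 + w) ^ ?N * c)"
      by (simp add: D_def e_def del: of_nat_Suc of_nat_add)
    also have "\<dots> = (2 / (1 + w)) ^ e / c * \<theta> ^ r"
      by (simp add: \<theta>_def power_add power_mult power_divide power_mult_distrib)
        (simp only: mult_ac)
    finally show ?thesis .
  qed
  have "(1 + w)\<^sup>2 - 4 * w = (1 - w)\<^sup>2" by (simp add: power2_eq_square algebra_simps)
  moreover have "(1 - w)\<^sup>2 > 0" "(1 + w)\<^sup>2 > 0" using w by simp_all
  ultimately have "4 * w < (1 + w)\<^sup>2" by linarith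
  then have "0 \<le> \<theta>" "\<theta> < 1" using w by (auto simp: \<theta>_def)
  then obtain K where K: "\<And>r. r \<ge> 1 \<Longrightarrow> \<theta> ^ r \<le> K / real r"
    using power_le_const_over_n by blast
  have "(\<lambda>r. tail r / D r) \<in> O(\<lambda>r. 1 / real r)"
  proof (rule bigoI[of _ "(2 / (1 + w)) ^ e / c * K"], rule eventually_sequentiallyI[of 1])
    fix r :: nat assume r: "r \<ge> 1"
    have "norm (tail r / D r) \<le> (2 / (1 + w)) ^ e / c * \<theta> ^ r"
      using tail[of r] D[of r] by simp
    also have "\<dots> \<le> (2 / (1 + w)) ^ e / c * (K / real r)"
      using w c K[OF r] by (intro mult_left_mono) auto
    finally show "norm (tail r / D r) \<le> (2 / (1 + w)) ^ e / c * K * norm (1 / real r)" by simp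
  qed
  with u have "(\<lambda>r. (u r - 1) - tail r / D r) \<in> O(\<lambda>r. 1 / real r)"
    unfolding near_one_def by (rule sum_in_bigo(2))
  moreover have "(\<lambda>r. (u r - 1) - tail r / D r) = (\<lambda>r. (u r - tail r / D r) - 1)" by auto
  ultimately have "near_one (\<lambda>r. u r - tail r / D r)" by (simp only: near_one_def)
  moreover have "u r - tail r / D r = (\<Sum>k\<le>r. s ^ k * (end_factor m y k * real ((2 * r + e) choose (r - k))))
    / (s ^ r * (1 + 1 / s) ^ (2 * r + e) * ((1 / 4) ^ m * ((s - 1) / (s + 1)) ^ (2 * m + 1) * real (2 * r + e) ^ (2 * m + 1)))" for r
  proof -
    have "s ^ r * (1 + 1 / s) ^ (2 * r + e) * ((1 / 4) ^ m * ((s - 1) / (s + 1)) ^ (2 * m + 1) * real (2 * r + e) ^ (2 * m + 1))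
      = s ^ r * D r" by (simp only: D_def c_def w_def mult.assoc)
    then show ?thesis unfolding head using D[of r] assms by (simp add: field_simps)
  qed
  ultimately show ?thesis by (simp only: e_def)
qed

section \<open>Asymptotics of the partition function\<close>

lemma asymp_rel_inverse_parityI:
  assumes "near_one u" "\<And>r. r \<ge> 1 \<Longrightarrow> f (y + 2 * r) = g (y + 2 * r) * u r"
  shows "asymp_rel_inverse (at_top_parity y) f g"
  unfolding asymp_rel_inverse_def
proof (intro exI conjI)
  let ?r = "\<lambda>t. (t - y) div 2"
  have t: "t = y + 2 * ?r t \<and> R \<le> ?r t" if "t \<ge> y + 2 * R" "t mod 2 = y mod 2" for t R
    using that by presburger
  show "\<forall>\<^sub>F t in at_top_parity y. f t = g t * (1 + (u (?r t) - 1))"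
    unfolding eventually_at_top_parity
  proof (intro exI[of _ "y + 2 * 1"] allI impI)
    fix t assume "y + 2 * 1 \<le> t" "t mod 2 = y mod 2"
    from t[OF this] show "f t = g t * (1 + (u (?r t) - 1))" using assms(2)[of "?r t"] by simp
  qed
  obtain C where "eventually (\<lambda>r. norm (u r - 1) \<le> C * norm (1 / real r)) sequentially" and C: "C > 0"
    using assms(1) unfolding near_one_def by (elim landau_o.bigE)
  then obtain R where R: "\<And>r. r \<ge> R \<Longrightarrow> norm (u r - 1) \<le> C * norm (1 / real r)"
    unfolding eventually_sequentially by blast
  show "(\<lambda>t. u (?r t) - 1) \<in> O[at_top_parity y](\<lambda>t. 1 / real t)"
  proof (rule bigoI[of _ "C * (real y + 2)"], unfold eventually_at_top_parity,
      intro exI[of _ "y + 2 * (R + 1)"] allI impI)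
    fix t assume *: "y + 2 * (R + 1) \<le> t" "t mod 2 = y mod 2"
    define r where "r = ?r t"
    have r: "t = y + 2 * r" "R + 1 \<le> r" using t[OF *] by (auto simp: r_def)
    have "norm (u r - 1) \<le> C * (1 / real r)" using R[of r] r(2) by simp
    \<comment> \<open>For \<open>r \<ge> 1\<close> one has
      \<open>t = y + 2 * r \<le> (y + 2) * r\<close>, whence the constant
      \<open>y + 2\<close>.\<close>
    also have "1 / real r \<le> (real y + 2) * (1 / real t)"
    proof -
      have "real y * 1 \<le> real y * real r" using r(2) by (intro mult_left_mono) auto
      then show ?thesis using r by (simp add: field_simps)
    qed
    finally show "norm (u (?r t) - 1) \<le> C * (real y + 2) * norm (1 / real t)"
      using C by (simp add: r_def mult.assoc)
  qed
qed

lemma prod_fact_quotient: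
  "(\<Prod>i<M. fact (t + 2 * i)) * (\<Prod>j<M. 1 / (f j * g j)) = (\<Prod>j<M. fact (t + 2 * j) / (f j * g j) :: real)"
  unfolding prod.distrib[symmetric] by simp

text \<open>Normalising the contact sum by \<open>fact r * fact (r + b)\<close> adds exactly the
  factorials of index \<open>j = m\<close> to those with \<open>j < m\<close>, so
  \<open>Suc m\<close> quotients with constant sum \<open>2 * m + 1\<close> appear. The factor 2 in
  \<open>S\<close> is the \<open>+ 1\<close> in the exponent of 2.\<close>

lemma Z_asymp_subcritical:
  assumes "0 < \<kappa>" "\<kappa> < 2"
  shows "asymp_rel_inverse (at_top_parity y) (\<lambda>t. Z (Suc m) t y \<kappa>)
         (\<lambda>t. 2 ^ (Suc m * t) * real t powr (- (real (Suc m) * (2 * real (Suc m) + 1) / 2))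
            * 2 powr (2 * real (Suc m) ^ 2 - real (Suc m) / 2 + 1) * \<kappa> * pi powr (- (real (Suc m) / 2))
            * fact (2 * m + 1) * base_factor m y * wall_sum (Suc m) y \<kappa>)"
proof -
  define b where "b = y + 2 * m + 1"
  define S where "S = 2 * fact (2 * m + 1) * wall_sum (Suc m) y \<kappa>"
  have s: "\<bar>\<kappa> - 1\<bar> < 1" using assms by auto
  have S: "S \<noteq> 0" using wall_sum_pos[OF assms, of "Suc m" y] by (simp add: S_def)
  define u1 where "u1 = (\<lambda>r. (\<Sum>k\<le>r. (\<kappa> - 1) ^ k * end_factor m y k / (fact (r - k) * fact (r + b + k))) * (fact r * fact (r + b)) / S)"
  have u1: "near_one u1"
    unfolding u1_def
  proof (rule factorial_weighted_sum_near_one)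
    show "(\<lambda>k. (\<kappa> - 1) ^ k * end_factor m y k) sums S"
      unfolding S_def by (rule end_factor_sums[OF s])
    show "summable (\<lambda>k. \<bar>(\<kappa> - 1) ^ k * end_factor m y k\<bar> * (real k * (real b + 1 + 2 * real k)))"
      unfolding b_def by (rule summable_end_factor[OF s])
  qed (rule S)
  obtain u2 where u2: "near_one u2"
    "\<And>r. r \<ge> 1 \<Longrightarrow> (\<Prod>j<Suc m. fact (y + 2 * r + 2 * j) / (fact (r + (m - j)) * fact (r + y + (m + j + 1)))) =
      2 ^ (Suc m * (y + 2 * r)) * real (y + 2 * r) powr (real (Suc m) * (real (Suc m) - 1) - real (Suc m) / 2 - real (Suc m) * real (2 * m + 1))
        * 2 powr (real (Suc m) / 2 + real (Suc m) * real (2 * m + 1)) * pi powr (- (real (Suc m) / 2)) * u2 r"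
    by (rule fact_quotient_prod_asymp[of "Suc m" "\<lambda>j. m - j" "\<lambda>j. m + j + 1" "2 * m + 1" y]) auto
  show ?thesis
  proof (rule asymp_rel_inverse_parityI)
    show "near_one (\<lambda>r. u2 r * u1 r)" by (intro near_one_mult u1 u2)
    fix r :: nat assume r: "r \<ge> 1"
    have sum: "(\<Sum>k\<le>r. (\<kappa> - 1) ^ k * (end_factor m y k / (fact (r - k) * fact (r + y + 2 * m + k + 1))))
        = S * u1 r * (1 / (fact r * fact (r + b)))"
    proof -
      have eq: "r + y + 2 * m + k + 1 = r + b + k" for k by (simp add: b_def)
      show ?thesis unfolding eq using S by (simp add: u1_def)
    qed
    have pr: "(\<Prod>j<m. 1 / (fact (r + m - j) * fact (r + m + y + j + 1))) * (1 / (fact r * fact (r + b))) =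
      (\<Prod>j<Suc m. 1 / (fact (r + (m - j)) * fact (r + y + (m + j + 1))) :: real)"
    proof -
      have "(\<Prod>j<m. 1 / (fact (r + m - j) * fact (r + m + y + j + 1))) =
          (\<Prod>j<m. 1 / (fact (r + (m - j)) * fact (r + y + (m + j + 1))) :: real)"
        by (intro prod.cong) (auto simp: add_ac)
      moreover have "r + y + (m + m + 1) = r + b" by (simp add: b_def)
      ultimately show ?thesis by (simp only: prod.lessThan_Suc diff_self_eq_0 add_0_right)
    qed
    have "Z (Suc m) (y + 2 * r) y \<kappa> = \<kappa> * base_factor m y * S * u1 r *
       ((\<Prod>j<Suc m. fact (y + 2 * r + 2 * j)) * (\<Prod>j<Suc m. 1 / (fact (r + (m - j)) * fact (r + y + (m + j + 1)))))"
      unfolding pr[symmetric] Z_formula[OF less_imp_neq[OF assms(1), symmetric]]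
      unfolding sum unfolding lessThan_Suc_atMost[symmetric] by (simp only: mult_ac)
    also have "\<dots> = \<kappa> * base_factor m y * S * u1 r *
       (2 ^ (Suc m * (y + 2 * r)) * real (y + 2 * r) powr (real (Suc m) * (real (Suc m) - 1) - real (Suc m) / 2 - real (Suc m) * real (2 * m + 1))
        * 2 powr (real (Suc m) / 2 + real (Suc m) * real (2 * m + 1)) * pi powr (- (real (Suc m) / 2)) * u2 r)"
      unfolding prod_fact_quotient u2(2)[OF r] ..
    also have "real (Suc m) * (real (Suc m) - 1) - real (Suc m) / 2 - real (Suc m) * real (2 * m + 1) =
        - (real (Suc m) * (2 * real (Suc m) + 1) / 2)"
      by (simp add: field_simps)
    also have "real (Suc m) / 2 + real (Suc m) * real (2 * m + 1) = 2 * real (Suc m) ^ 2 - real (Suc m) / 2"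
      by (simp add: field_simps power2_eq_square)
    finally have *: "Z (Suc m) (y + 2 * r) y \<kappa> = \<kappa> * base_factor m y * S * u1 r *
       (2 ^ (Suc m * (y + 2 * r)) * real (y + 2 * r) powr (- (real (Suc m) * (2 * real (Suc m) + 1) / 2))
        * 2 powr (2 * real (Suc m) ^ 2 - real (Suc m) / 2) * pi powr (- (real (Suc m) / 2)) * u2 r)" .
    have two: "(2::real) powr 1 = 2" by simp
    from * show "Z (Suc m) (y + 2 * r) y \<kappa> =
      2 ^ (Suc m * (y + 2 * r)) * real (y + 2 * r) powr (- (real (Suc m) * (2 * real (Suc m) + 1) / 2))
            * 2 powr (2 * real (Suc m) ^ 2 - real (Suc m) / 2 + 1) * \<kappa> * pi powr (- (real (Suc m) / 2))
            * fact (2 * m + 1) * base_factor m y * wall_sum (Suc m) y \<kappa> * (u2 r * u1 r)"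
      by (simp only: S_def powr_add two mult_ac)
  qed
qed

lemma Z_asymp_critical:
  "asymp_rel_inverse (at_top_parity y) (\<lambda>t. Z (Suc m) t y 2)
         (\<lambda>t. 2 ^ (Suc m * t) * real t powr (- (real (Suc m) * (2 * real (Suc m) - 1) / 2))
            * 2 powr (2 * real (Suc m) ^ 2 - 3 / 2 * real (Suc m) + 1) * pi powr (- (real (Suc m) / 2))
            * (\<Prod>i<Suc m. fact i * fact (y + Suc m + i - 1) / fact (y + 2 * i)))"
proof -
  obtain u where u: "near_one u"
    "\<And>r. r \<ge> 1 \<Longrightarrow> (\<Prod>j<Suc m. fact (y + 2 * r + 2 * j) / (fact (r + (m - j)) * fact (r + y + (m + j)))) =
      2 ^ (Suc m * (y + 2 * r)) * real (y + 2 * r) powr (real (Suc m) * (real (Suc m) - 1) - real (Suc m) / 2 - real (Suc m) * real (2 * m))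
        * 2 powr (real (Suc m) / 2 + real (Suc m) * real (2 * m)) * pi powr (- (real (Suc m) / 2)) * u r"
    by (rule fact_quotient_prod_asymp[of "Suc m" "\<lambda>j. m - j" "\<lambda>j. m + j" "2 * m" y]) auto
  show ?thesis
  proof (rule asymp_rel_inverse_parityI[OF u(1)])
    fix r :: nat assume r: "r \<ge> 1"
    let ?H = "\<Prod>i<Suc m. \<Prod>j\<in>{i<..<Suc m}. (real j - real i) * (real y + real i + real j)"
    have "(\<Prod>j\<le>m. 1 / (fact (r + m - j) * fact (r + m + y + j))) =
      (\<Prod>j<Suc m. 1 / (fact (r + (m - j)) * fact (r + y + (m + j))) :: real)"
      unfolding lessThan_Suc_atMost by (intro prod.cong) (auto simp: add_ac)
    moreover have "{i<..m} = {i<..<Suc m}" for i by auto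
    ultimately have "Z (Suc m) (y + 2 * r) y 2 = 2 * ?H *
      ((\<Prod>j<Suc m. fact (y + 2 * r + 2 * j)) * (\<Prod>j<Suc m. 1 / (fact (r + (m - j)) * fact (r + y + (m + j)))))"
      unfolding Z_2_formula lessThan_Suc_atMost[symmetric] by (simp only: mult_ac)
    also have "\<dots> = 2 * ?H *
       (2 ^ (Suc m * (y + 2 * r)) * real (y + 2 * r) powr (real (Suc m) * (real (Suc m) - 1) - real (Suc m) / 2 - real (Suc m) * real (2 * m))
        * 2 powr (real (Suc m) / 2 + real (Suc m) * real (2 * m)) * pi powr (- (real (Suc m) / 2)) * u r)"
      unfolding prod_fact_quotient u(2)[OF r] ..
    also have "real (Suc m) * (real (Suc m) - 1) - real (Suc m) / 2 - real (Suc m) * real (2 * m) =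
        - (real (Suc m) * (2 * real (Suc m) - 1) / 2)"
      by (simp add: field_simps)
    also have "real (Suc m) / 2 + real (Suc m) * real (2 * m) = 2 * real (Suc m) ^ 2 - 3 / 2 * real (Suc m)"
      by (simp add: field_simps power2_eq_square)
    finally have *: "Z (Suc m) (y + 2 * r) y 2 = 2 * ?H *
       (2 ^ (Suc m * (y + 2 * r)) * real (y + 2 * r) powr (- (real (Suc m) * (2 * real (Suc m) - 1) / 2))
        * 2 powr (2 * real (Suc m) ^ 2 - 3 / 2 * real (Suc m)) * pi powr (- (real (Suc m) / 2)) * u r)" .
    have two: "(2::real) powr 1 = 2" by simp
    from * show "Z (Suc m) (y + 2 * r) y 2 =
      2 ^ (Suc m * (y + 2 * r)) * real (y + 2 * r) powr (- (real (Suc m) * (2 * real (Suc m) - 1) / 2))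
            * 2 powr (2 * real (Suc m) ^ 2 - 3 / 2 * real (Suc m) + 1) * pi powr (- (real (Suc m) / 2))
            * (\<Prod>i<Suc m. fact i * fact (y + Suc m + i - 1) / fact (y + 2 * i)) * u r"
      by (simp only: base_factor_2_eq powr_add two mult_ac)
  qed
qed

text \<open>Only \<open>m\<close> factorial quotients remain. The last column turns into binomial
  coefficients of order N = 2 r + e divided by \<open>fact N\<close>, and their moment supplies the
  growth rate \<open>\<kappa> / sqrt (\<kappa> - 1)\<close>.\<close>

lemma Z_asymp_supercritical:
  assumes "2 < \<kappa>"
  shows "asymp_rel_inverse (at_top_parity y) (\<lambda>t. Z (Suc m) t y \<kappa>)
         (\<lambda>t. (2 ^ m * \<kappa> / sqrt (\<kappa> - 1)) ^ t * real t powr (- (real m * (2 * real m + 1) / 2))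
            * (2 powr (real m * (4 * real m - 1) / 2) * \<kappa> * (\<kappa> - 2) ^ (2 * m + 1)
               / (pi powr (real m / 2) * (\<kappa> - 1) powr (real y / 2 + 2 * real m + 1))) * base_factor m y)"
proof -
  define s where "s = \<kappa> - 1"
  define e where "e = y + 2 * m + 1"
  have s: "1 < s" "\<kappa> = s + 1" using assms by (auto simp: s_def)
  define c where "c = (1 / 4) ^ m * ((s - 1) / (s + 1)) ^ (2 * m + 1)"
  have c: "c \<noteq> 0" using s by (simp add: c_def)
  define u1 where "u1 = (\<lambda>r. (\<Sum>k\<le>r. s ^ k * (end_factor m y k * real ((2 * r + e) choose (r - k))))
    / (s ^ r * (1 + 1 / s) ^ (2 * r + e) * (c * real (2 * r + e) ^ (2 * m + 1))))"
  have u1: "near_one u1"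
    unfolding u1_def e_def c_def by (rule supercritical_sum_near_one[OF s(1)])
  obtain u2 where u2: "near_one u2"
    "\<And>r. r \<ge> 1 \<Longrightarrow> (\<Prod>j<m. fact (y + 2 * r + 2 * j) / (fact (r + (m - j)) * fact (r + y + (m + j + 1)))) =
      2 ^ (m * (y + 2 * r)) * real (y + 2 * r) powr (real m * (real m - 1) - real m / 2 - real m * real (2 * m + 1))
        * 2 powr (real m / 2 + real m * real (2 * m + 1)) * pi powr (- (real m / 2)) * u2 r"
    by (rule fact_quotient_prod_asymp[of m "\<lambda>j. m - j" "\<lambda>j. m + j + 1" "2 * m + 1" y]) auto
  \<comment> \<open>Replaces the power of N = t + 2 m + 1 by the same power of t.\<close>
  define u3 where "u3 = (\<lambda>r. ((real r + real e / 2) / (real r + real y / 2)) ^ (2 * m))"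
  have u3: "near_one u3" unfolding u3_def by (intro near_one_power near_one_linear) simp
  show ?thesis
  proof (rule asymp_rel_inverse_parityI)
    show "near_one (\<lambda>r. u2 r * u1 r * u3 r)" by (intro near_one_mult u1 u2 u3)
    fix r :: nat assume r: "r \<ge> 1"
    define N where "N = 2 * r + e"
    define T where "T = real (y + 2 * r)"
    have T: "T > 0" and N: "real N > 0" using r by (simp_all add: T_def N_def e_def)
    have sum: "(\<Sum>k\<le>r. (\<kappa> - 1) ^ k * (end_factor m y k / (fact (r - k) * fact (r + y + 2 * m + k + 1))))
        = u1 r * (s ^ r * (1 + 1 / s) ^ N * (c * real N ^ (2 * m + 1))) / fact N"
    proof -
      have "(\<Sum>k\<le>r. (\<kappa> - 1) ^ k * (end_factor m y k / (fact (r - k) * fact (r + y + 2 * m + k + 1))))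
        = (\<Sum>k\<le>r. s ^ k * (end_factor m y k * real (N choose (r - k)))) / fact N"
        unfolding sum_divide_distrib
      proof (rule sum.cong[OF refl])
        fix k assume "k \<in> {..r}"
        then have "r - k \<le> N" "N - (r - k) = r + y + 2 * m + k + 1" by (auto simp: N_def e_def)
        then have "real (N choose (r - k)) = fact N / (fact (r - k) * fact (r + y + 2 * m + k + 1))"
          by (simp only: binomial_fact)
        then show "(\<kappa> - 1) ^ k * (end_factor m y k / (fact (r - k) * fact (r + y + 2 * m + k + 1)))
          = s ^ k * (end_factor m y k * real (N choose (r - k))) / fact N"
          by (simp add: s_def)
      qed
      also have "(\<Sum>k\<le>r. s ^ k * (end_factor m y k * real (N choose (r - k)))) =
          u1 r * (s ^ r * (1 + 1 / s) ^ N * (c * real N ^ (2 * m + 1)))"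
      proof -
        have "1 + 1 / s > 0" using s(1) by (simp add: add_pos_pos)
        then have "1 + 1 / s \<noteq> 0" by linarith
        then show ?thesis unfolding u1_def N_def[symmetric] using s(1) c N by simp
      qed
      finally show ?thesis .
    qed
    \<comment> \<open>The factorial of the last row cancels \<open>fact N\<close> up to 1 / N, which
      lowers the moment's power of N from 2 m + 1 to 2 m.\<close>
    have factN: "fact (y + 2 * r + 2 * m) / fact N = 1 / real N"
    proof -
      have "N = Suc (y + 2 * r + 2 * m)" by (simp add: N_def e_def)
      then have "fact N = real N * fact (y + 2 * r + 2 * m)" by (simp only: fact_Suc)
      then show ?thesis by simp
    qed
    have pr: "(\<Prod>j<m. 1 / (fact (r + m - j) * fact (r + m + y + j + 1))) =
        (\<Prod>j<m. 1 / (fact (r + (m - j)) * fact (r + y + (m + j + 1))) :: real)"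
      by (intro prod.cong) (auto simp: add_ac)
    have "\<kappa> \<noteq> 0" using assms by simp
    then have "Z (Suc m) (y + 2 * r) y \<kappa> = \<kappa> * base_factor m y * u1 r *
        (s ^ r * (1 + 1 / s) ^ N * (c * real N ^ (2 * m + 1))) * (fact (y + 2 * r + 2 * m) / fact N) *
       ((\<Prod>j<m. fact (y + 2 * r + 2 * j)) * (\<Prod>j<m. 1 / (fact (r + (m - j)) * fact (r + y + (m + j + 1)))))"
      unfolding Z_formula[OF \<open>\<kappa> \<noteq> 0\<close>] unfolding sum pr unfolding lessThan_Suc_atMost[symmetric] prod.lessThan_Suc
      by (simp only: divide_inverse mult_ac)
    also have "\<dots> = \<kappa> * base_factor m y * u1 r * (s ^ r * (1 + 1 / s) ^ N * c * real N ^ (2 * m)) *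
      (2 ^ (m * (y + 2 * r)) * T powr (real m * (real m - 1) - real m / 2 - real m * real (2 * m + 1))
        * 2 powr (real m / 2 + real m * real (2 * m + 1)) * pi powr (- (real m / 2)) * u2 r)"
      unfolding prod_fact_quotient u2(2)[OF r] factN T_def using N by simp
    also have "real N ^ (2 * m) = T powr (2 * real m) * u3 r"
    proof -
      have "real N = T * ((real r + real e / 2) / (real r + real y / 2))"
        using r by (simp add: N_def T_def field_simps)
      then have "real N ^ (2 * m) = T ^ (2 * m) * u3 r"
        by (simp only: u3_def power_mult_distrib)
      then show ?thesis using T by (simp add: powr_realpow[symmetric])
    qed
    also have "s ^ r * (1 + 1 / s) ^ N * c =
      (\<kappa> / sqrt s) ^ (y + 2 * r) * (\<kappa> - 2) ^ (2 * m + 1) * 2 powr (- 2 * real m) / s powr (real y / 2 + 2 * real m + 1)"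
    proof -
      have 1: "(1 + 1 / s) ^ N = \<kappa> ^ (y + 2 * r) * \<kappa> ^ (2 * m + 1) / s ^ N"
      proof -
        have "1 + 1 / s = \<kappa> / s" using s by (simp add: field_simps)
        moreover have "N = (y + 2 * r) + (2 * m + 1)" by (simp add: N_def e_def)
        ultimately show ?thesis by (simp only: power_divide power_add times_divide_times_eq)
      qed
      have 2: "c = 2 powr (- 2 * real m) * ((\<kappa> - 2) ^ (2 * m + 1) / \<kappa> ^ (2 * m + 1))"
      proof -
        have "(1 / 4 :: real) ^ m = 2 powr (- 2 * real m)"
        proof -
          have "2 powr (- 2 * real m) = (2 powr (- 2)) powr real m" by (simp only: powr_powr)
          also have "2 powr (- 2) = (1 / 4 :: real)" by (simp add: powr_minus)
          also have "(1 / 4 :: real) powr real m = (1 / 4) ^ m" by (rule powr_realpow) simp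
          finally show ?thesis ..
        qed
        moreover have "(s - 1) / (s + 1) = (\<kappa> - 2) / \<kappa>" using s by simp
        ultimately show ?thesis by (simp only: c_def power_divide)
      qed
      \<comment> \<open>The exponent N - r = r + y + 2 m + 1 is split into t / 2, which joins the
        growth rate, and the constant y / 2 + 2 m + 1.\<close>
      have 3: "s ^ r / s ^ N = 1 / (sqrt s ^ (y + 2 * r) * s powr (real y / 2 + 2 * real m + 1))"
      proof -
        have "sqrt s ^ (y + 2 * r) = s powr (real (y + 2 * r) / 2)"
          using s by (simp add: powr_half_sqrt[symmetric] powr_power)
        then have "s ^ r * (sqrt s ^ (y + 2 * r) * s powr (real y / 2 + 2 * real m + 1)) =
            s powr (real r + (real (y + 2 * r) / 2 + (real y / 2 + 2 * real m + 1)))"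
          using s by (simp only: powr_add powr_realpow)
        also have "real r + (real (y + 2 * r) / 2 + (real y / 2 + 2 * real m + 1)) = real N"
          by (simp add: N_def e_def field_simps)
        also have "s powr real N = s ^ N" using s by (simp add: powr_realpow)
        finally show ?thesis using s by (simp add: divide_simps)
      qed
      have "s ^ r * (1 + 1 / s) ^ N * c = (s ^ r / s ^ N) * (\<kappa> ^ (y + 2 * r) * (\<kappa> - 2) ^ (2 * m + 1) * 2 powr (- 2 * real m))"
        unfolding 1 2 using assms by simp
      then show ?thesis unfolding 3 by (simp add: power_divide)
    qed
    also have "\<kappa> * base_factor m y * u1 r *
        ((\<kappa> / sqrt s) ^ (y + 2 * r) * (\<kappa> - 2) ^ (2 * m + 1) * 2 powr (- 2 * real m) / s powr (real y / 2 + 2 * real m + 1)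
          * (T powr (2 * real m) * u3 r)) *
      (2 ^ (m * (y + 2 * r)) * T powr (real m * (real m - 1) - real m / 2 - real m * real (2 * m + 1))
        * 2 powr (real m / 2 + real m * real (2 * m + 1)) * pi powr (- (real m / 2)) * u2 r) =
      (2 ^ (m * (y + 2 * r)) * (\<kappa> / sqrt s) ^ (y + 2 * r)) *
      (T powr (2 * real m) * T powr (real m * (real m - 1) - real m / 2 - real m * real (2 * m + 1))) *
      ((2 powr (- 2 * real m) * 2 powr (real m / 2 + real m * real (2 * m + 1))) * \<kappa> * (\<kappa> - 2) ^ (2 * m + 1)
        / (pi powr (real m / 2) * s powr (real y / 2 + 2 * real m + 1))) * base_factor m y * (u2 r * u1 r * u3 r)"
      by (simp only: powr_minus divide_inverse inverse_mult_distrib mult_ac)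
    also have "2 ^ (m * (y + 2 * r)) * (\<kappa> / sqrt s) ^ (y + 2 * r) = (2 ^ m * \<kappa> / sqrt s) ^ (y + 2 * r)"
      by (simp only: power_mult power_mult_distrib[symmetric] times_divide_eq_right)
    also have "T powr (2 * real m) * T powr (real m * (real m - 1) - real m / 2 - real m * real (2 * m + 1)) =
        T powr (- (real m * (2 * real m + 1) / 2))"
      unfolding powr_add[symmetric] by (rule arg_cong[where f="\<lambda>x. T powr x"]) (simp add: field_simps)
    also have "2 powr (- 2 * real m) * 2 powr (real m / 2 + real m * real (2 * m + 1)) = 2 powr (real m * (4 * real m - 1) / 2)"
      unfolding powr_add[symmetric] by (rule arg_cong[where f="\<lambda>x. 2 powr x"]) (simp add: field_simps)
    finally show "Z (Suc m) (y + 2 * r) y \<kappa> =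
      (2 ^ m * \<kappa> / sqrt (\<kappa> - 1)) ^ (y + 2 * r) * real (y + 2 * r) powr (- (real m * (2 * real m + 1) / 2))
            * (2 powr (real m * (4 * real m - 1) / 2) * \<kappa> * (\<kappa> - 2) ^ (2 * m + 1)
               / (pi powr (real m / 2) * (\<kappa> - 1) powr (real y / 2 + 2 * real m + 1))) * base_factor m y * (u2 r * u1 r * u3 r)"
      unfolding T_def s_def .
  qed
qed

theorem theorem12:
  fixes n y :: nat and \<kappa> :: real
  assumes "n \<ge> 1" and "\<kappa> > 0"
  shows
    "(\<kappa> < 2 \<longrightarrow>
       asymp_rel_inverse (at_top_parity y) (\<lambda>t. Z n t y \<kappa>)
         (\<lambda>t. 2 ^ (n * t) * real t powr (- (real n * (2 * real n + 1) / 2))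
            * 2 powr (2 * real n ^ 2 - real n / 2 + 1) * \<kappa> * pi powr (- (real n / 2))
            * fact (2 * n - 1)
            * (\<Prod>i<n - 1. fact i * fact (y + n + i - 1) / fact (y + 2 * i))
            * (\<Sum>h=0..n. real (n choose h) * ((real y + real h - 2) gchoose h)
                 / real (2 * n choose h) * (1 / (2 - \<kappa>) ^ (2 * n - h))))) \<and>
     (\<kappa> = 2 \<longrightarrow>
       asymp_rel_inverse (at_top_parity y) (\<lambda>t. Z n t y \<kappa>)
         (\<lambda>t. 2 ^ (n * t) * real t powr (- (real n * (2 * real n - 1) / 2))
            * 2 powr (2 * real n ^ 2 - 3 / 2 * real n + 1) * pi powr (- (real n / 2))
            * (\<Prod>i<n. fact i * fact (y + n + i - 1) / fact (y + 2 * i)))) \<and>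
     (\<kappa> > 2 \<longrightarrow>
       asymp_rel_inverse (at_top_parity y) (\<lambda>t. Z n t y \<kappa>)
         (\<lambda>t. (2 ^ (n - 1) * \<kappa> / sqrt (\<kappa> - 1)) ^ t
            * real t powr (- ((real n - 1) * (2 * real n - 1) / 2))
            * (2 powr ((real n - 1) * (4 * real n - 5) / 2) * \<kappa> * (\<kappa> - 2) ^ (2 * n - 1)
               / (pi powr ((real n - 1) / 2) * (\<kappa> - 1) powr (real y / 2 + 2 * real n - 1)))
            * (\<Prod>i<n - 1. fact i * fact (y + n + i - 1) / fact (y + 2 * i))))"
proof -
  obtain m where n: "n = Suc m" using assms(1) by (cases n) auto
  have base: "(\<Prod>i<n - 1. fact i * fact (y + n + i - 1) / fact (y + 2 * i)) = base_factor m y"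
    by (simp add: base_factor_eq n)
  have e: "2 * n - 1 = 2 * m + 1" "n - 1 = m" "real n - 1 = real m" "2 * real n - 1 = 2 * real m + 1"
    "4 * real n - 5 = 4 * real m - 1" "real y / 2 + 2 * real n - 1 = real y / 2 + 2 * real m + 1"
    by (simp_all add: n)
  show ?thesis
  proof (intro conjI impI)
    assume "\<kappa> < 2"
    from Z_asymp_subcritical[OF assms(2) this, of y m]
    show "asymp_rel_inverse (at_top_parity y) (\<lambda>t. Z n t y \<kappa>)
         (\<lambda>t. 2 ^ (n * t) * real t powr (- (real n * (2 * real n + 1) / 2))
            * 2 powr (2 * real n ^ 2 - real n / 2 + 1) * \<kappa> * pi powr (- (real n / 2))
            * fact (2 * n - 1)
            * (\<Prod>i<n - 1. fact i * fact (y + n + i - 1) / fact (y + 2 * i))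
            * (\<Sum>h=0..n. real (n choose h) * ((real y + real h - 2) gchoose h)
                 / real (2 * n choose h) * (1 / (2 - \<kappa>) ^ (2 * n - h))))"
      unfolding base unfolding e(1) wall_sum_def n[symmetric] .
  next
    assume "\<kappa> = 2"
    then show "asymp_rel_inverse (at_top_parity y) (\<lambda>t. Z n t y \<kappa>)
         (\<lambda>t. 2 ^ (n * t) * real t powr (- (real n * (2 * real n - 1) / 2))
            * 2 powr (2 * real n ^ 2 - 3 / 2 * real n + 1) * pi powr (- (real n / 2))
            * (\<Prod>i<n. fact i * fact (y + n + i - 1) / fact (y + 2 * i)))"
      using Z_asymp_critical[of y m] unfolding n by simp
  next
    assume "\<kappa> > 2"
    from Z_asymp_supercritical[OF this, of y m]
    show "asymp_rel_inverse (at_top_parity y) (\<lambda>t. Z n t y \<kappa>)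
         (\<lambda>t. (2 ^ (n - 1) * \<kappa> / sqrt (\<kappa> - 1)) ^ t
            * real t powr (- ((real n - 1) * (2 * real n - 1) / 2))
            * (2 powr ((real n - 1) * (4 * real n - 5) / 2) * \<kappa> * (\<kappa> - 2) ^ (2 * n - 1)
               / (pi powr ((real n - 1) / 2) * (\<kappa> - 1) powr (real y / 2 + 2 * real n - 1)))
            * (\<Prod>i<n - 1. fact i * fact (y + n + i - 1) / fact (y + 2 * i)))"
      unfolding base unfolding e n[symmetric] .
  qed
qed

end
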